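(* Let $\Phi$ be an irreducible finite root system. If $\lambda$ is dominant and minuscule, then the minuscule splitting poset $R(\lambda)$ is the unique splitting poset for $\chi_\lambda$, and it is connected and edge-minimal. If $\lambda$ is dominant and quasi-minuscule, then the quasi-minuscule splitting poset $R(\lambda)$ is the only connected edge-minimal splitting poset for $\chi_\lambda$. (Uniqueness is up to isomorphism of edge-colored posets.)
   Context: $\Phi$ is a finite (reduced, crystallographic) root system in a Euclidean space with simple roots $\{\alpha_i\}_{i\in I}$, $\alpha^\vee=2\alpha/\langle\alpha,\alpha\rangle$, fundamental weights $\omega_i$ dual to simple coroots, $\Lambda=\bigoplus\mathbb Z\omega_i$, $\Lambda^+=\bigoplus\mathbb Z_{\ge0}\omega_i$, Weyl group $W$, $\varrho=\sum\omega_i$. $\mathbb Z[\Lambda]$ is the group ring with basis $\{e^\mu\}$; $\mathcal A(e^\mu)=\sum_{w\in W}\det(w)e^{w(\mu)}$. For $\lambda\in\Lambda^+$ the Weyl bialternant $\chi_\lambda$ is the unique element of $\mathbb Z[\Lambda]$ with $\mathcal A(e^\varrho)\chi_\lambda=\mathcal A(e^{\lambda+\varrho})$. In the simply laced irreducible case all roots are regarded as short. All posets are finite, identified with Hasse diagrams (edge $\mathbf s\to\mathbf t$ iff $\mathbf t$ covers $\mathbf s$). Ranked means there is a surjection $\rho:R\to\{0,\dots,l\}$ with $\rho(\mathbf s)+1=\rho(\mathbf t)$ whenever $\mathbf s\to\mathbf t$; $l$ is the length. For a ranked poset with Hasse edges colored by $I$, $\mathrm{comp}_i(\mathbf x)$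 is the connected component of $\mathbf x$ using only color $i$ edges; $\rho_i(\mathbf x)$ is the rank of $\mathbf x$ there, $l_i(\mathbf x)$ its length, $m_i=2\rho_i-l_i$, $wt(\mathbf x)=\sum_i m_i(\mathbf x)\omega_i$, $\mathrm{WGF}(R)=\sum_{\mathbf x\in R}e^{wt(\mathbf x)}$. $R$ is $\Phi$-structured if $wt(\mathbf s)+\alpha_i=wt(\mathbf t)$ whenever $\mathbf s\xrightarrow{i}\mathbf t$. A splitting poset for $\chi_\lambda$ is a $\Phi$-structured poset $R$ with $\mathrm{WGF}(R)=\chi_\lambda$. A splitting poset $R$ for $\chi_\lambda$ is edge-minimal if no other splitting poset for $\chi_\lambda$ is isomorphic to a proper edge-colored subgraph of $R$. A nonzero weight $\mu\in\Lambda$ is minuscule if $\langle\mu,\alpha^\vee\rangle\in\{0,\pm1\}$ for all $\alpha\in\Phi$; quasi-minuscule if $\langle\mu,\alpha^\vee\rangle\in\{0,\pm1,\pm2\}$ for all $\alpha\in\Phi$ and there is a unique $\beta\in\Phi$ with $\langle\mu,\beta^\vee\rangle=2$. (The dominant quasi-minuscule weight is the highest short root.) For $\lambda$ dominant and minuscule, $R(\lambda)$ is the $W$-orbit $W\lambda$ with edges $\mu\xrightarrow{i}\nu$ iff $\mu+\alpha_i=\nu$. For $\lambda$ dominant and quasi-minuscule, $R(\lambda)$ has vertex set $W\lambda\sqcup\{\overline{\alpha_i}:\alpha_i\text{ a short simple root}\}$ (new symbols), with edges $\alpha\xrightarrow{i}\beta$ for $\alpha,\beta\in W\lambda$ with $\alpha+\alpha_i=\beta$,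 and $-\alpha_i\xrightarrow{i}\overline{\alpha_i}\xrightarrow{i}\alpha_i$ for each short simple $\alpha_i$. *)

theory Defs
  imports "HOL-Analysis.Analysis" "HOL-Library.Poly_Mapping"
begin

section \<open>Root systems and weights\<close>

definition coroot :: "'a::euclidean_space \<Rightarrow> 'a" where
  "coroot \<beta> = (2 / (\<beta> \<bullet> \<beta>)) *\<^sub>R \<beta>"

definition reflection :: "'a::euclidean_space \<Rightarrow> 'a \<Rightarrow> 'a" where
  "reflection \<beta> x = x - (x \<bullet> coroot \<beta>) *\<^sub>R \<beta>"

definition root_system :: "'a::euclidean_space set \<Rightarrow> bool" where
  "root_system \<Phi> \<longleftrightarrow>
     finite \<Phi> \<and> span \<Phi> = UNIV \<and> 0 \<notin> \<Phi> \<and>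
     (\<forall>\<beta>\<in>\<Phi>. reflection \<beta> ` \<Phi> = \<Phi>) \<and>
     (\<forall>\<beta>\<in>\<Phi>. \<forall>\<gamma>\<in>\<Phi>. \<gamma> \<bullet> coroot \<beta> \<in> \<int>) \<and>
     (\<forall>\<beta>\<in>\<Phi>. \<forall>c. c *\<^sub>R \<beta> \<in> \<Phi> \<longrightarrow> c = 1 \<or> c = -1)"

definition irreducible_root_system :: "'a::euclidean_space set \<Rightarrow> bool" where
  "irreducible_root_system \<Phi> \<longleftrightarrow>
     root_system \<Phi> \<and> \<Phi> \<noteq> {} \<and>
     \<not> (\<exists>A B. A \<noteq> {} \<and> B \<noteq> {} \<and> A \<union> B = \<Phi> \<and> (\<forall>x\<in>A. \<forall>y\<in>B. x \<bullet> y = 0))"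

text \<open>The finite type \<open>'i\<close> plays the role of the index set of the simple roots; it is also the
  set of edge colors below.\<close>

definition simple_roots :: "'a::euclidean_space set \<Rightarrow> ('i::finite \<Rightarrow> 'a) \<Rightarrow> bool" where
  "simple_roots \<Phi> \<alpha> \<longleftrightarrow>
     inj \<alpha> \<and> range \<alpha> \<subseteq> \<Phi> \<and> independent (range \<alpha>) \<and>
     (\<forall>\<beta>\<in>\<Phi>. \<exists>c :: 'i \<Rightarrow> nat.
        \<beta> = (\<Sum>i\<in>UNIV. real (c i) *\<^sub>R \<alpha> i) \<or> \<beta> = - (\<Sum>i\<in>UNIV. real (c i) *\<^sub>R \<alpha> i))"

definition fund_weight :: "('i::finite \<Rightarrow> 'a::euclidean_space) \<Rightarrow> 'i \<Rightarrow> 'a" where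
  "fund_weight \<alpha> i = (THE w. \<forall>j. w \<bullet> coroot (\<alpha> j) = (if i = j then 1 else 0))"

definition weight_lattice :: "('i::finite \<Rightarrow> 'a::euclidean_space) \<Rightarrow> 'a set" where
  "weight_lattice \<alpha> = {\<Sum>i\<in>UNIV. of_int (m i) *\<^sub>R fund_weight \<alpha> i | m :: 'i \<Rightarrow> int. True}"

definition dominant_weights :: "('i::finite \<Rightarrow> 'a::euclidean_space) \<Rightarrow> 'a set" where
  "dominant_weights \<alpha> = {\<Sum>i\<in>UNIV. of_nat (m i) *\<^sub>R fund_weight \<alpha> i | m :: 'i \<Rightarrow> nat. True}"

definition weyl_vector :: "('i::finite \<Rightarrow> 'a::euclidean_space) \<Rightarrow> 'a" where
  "weyl_vector \<alpha> = (\<Sum>i\<in>UNIV. fund_weight \<alpha> i)"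

inductive_set weyl_group :: "'a::euclidean_space set \<Rightarrow> ('a \<Rightarrow> 'a) set" for \<Phi> where
  weyl_id: "id \<in> weyl_group \<Phi>"
| weyl_reflection: "\<beta> \<in> \<Phi> \<Longrightarrow> w \<in> weyl_group \<Phi> \<Longrightarrow> reflection \<beta> \<circ> w \<in> weyl_group \<Phi>"

definition weyl_orbit :: "'a::euclidean_space set \<Rightarrow> 'a \<Rightarrow> 'a set" where
  "weyl_orbit \<Phi> \<mu> = (\<lambda>w. w \<mu>) ` weyl_group \<Phi>"

text \<open>Determinant of a linear map, computed from its matrix in the basis of fundamental weights:
  the coordinate of \<open>x\<close> at the \<open>i\<close>-th fundamental weight is \<open>x \<bullet> coroot (\<alpha> i)\<close>.\<close>

definition weyl_det :: "('i::finite \<Rightarrow> 'a::euclidean_space) \<Rightarrow> ('a \<Rightarrow> 'a) \<Rightarrow> real" where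
  "weyl_det \<alpha> w = det ((\<chi> i j. w (fund_weight \<alpha> j) \<bullet> coroot (\<alpha> i)) :: real^'i^'i)"

section \<open>The group ring and Weyl bialternants\<close>

text \<open>Finitely supported maps \<open>'a \<Rightarrow> int\<close> form, under convolution, the group ring of the
  additive group \<open>'a\<close>; the group ring of the weight lattice is the subring of those supported
  there.\<close>

definition group_ring :: "('i::finite \<Rightarrow> 'a::euclidean_space) \<Rightarrow> ('a, int) poly_mapping set" where
  "group_ring \<alpha> = {f. Poly_Mapping.keys f \<subseteq> weight_lattice \<alpha>}"

definition wexp :: "'a::euclidean_space \<Rightarrow> ('a, int) poly_mapping" where
  "wexp \<mu> = Poly_Mapping.single \<mu> 1"

text \<open>On the Weyl group the determinant is \<open>1\<close> or \<open>-1\<close>, so taking the floor only converts it to an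
  integer.\<close>

definition alternant ::
  "'a::euclidean_space set \<Rightarrow> ('i::finite \<Rightarrow> 'a) \<Rightarrow> 'a \<Rightarrow> ('a, int) poly_mapping" where
  "alternant \<Phi> \<alpha> \<mu> = (\<Sum>w\<in>weyl_group \<Phi>. of_int \<lfloor>weyl_det \<alpha> w\<rfloor> * wexp (w \<mu>))"

definition weyl_bialternant ::
  "'a::euclidean_space set \<Rightarrow> ('i::finite \<Rightarrow> 'a) \<Rightarrow> 'a \<Rightarrow> ('a, int) poly_mapping" where
  "weyl_bialternant \<Phi> \<alpha> \<mu> = (THE f. f \<in> group_ring \<alpha> \<and>
     alternant \<Phi> \<alpha> (weyl_vector \<alpha>) * f = alternant \<Phi> \<alpha> (\<mu> + weyl_vector \<alpha>))"

section \<open>Edge-colored ranked posets\<close>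

text \<open>A finite poset is given by its Hasse diagram; \<open>(s, i, t)\<close> is an edge of color \<open>i\<close> from \<open>s\<close> up
  to \<open>t\<close>. The order is the reflexive transitive closure of the edge relation.\<close>

record ('v, 'i) colored_graph =
  verts :: "'v set"
  edges :: "('v \<times> 'i \<times> 'v) set"

definition color_rel :: "('v, 'i) colored_graph \<Rightarrow> 'i \<Rightarrow> 'v rel" where
  "color_rel R i = {(s, t). (s, i, t) \<in> edges R}"

definition edge_rel :: "('v, 'i) colored_graph \<Rightarrow> 'v rel" where
  "edge_rel R = (\<Union>i. color_rel R i)"

definition cover_rel :: "'v rel \<Rightarrow> 'v rel" where
  "cover_rel le = {(s, t). (s, t) \<in> le \<and> s \<noteq> t \<and>
     \<not> (\<exists>u. u \<noteq> s \<and> u \<noteq> t \<and> (s, u) \<in> le \<and> (u, t) \<in> le)}"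

definition colored_poset :: "('v, 'i) colored_graph \<Rightarrow> bool" where
  "colored_poset R \<longleftrightarrow>
     finite (verts R) \<and> edges R \<subseteq> verts R \<times> UNIV \<times> verts R \<and>
     (\<forall>s t i j. (s, i, t) \<in> edges R \<longrightarrow> (s, j, t) \<in> edges R \<longrightarrow> i = j) \<and>
     antisym ((edge_rel R)\<^sup>*) \<and> edge_rel R = cover_rel ((edge_rel R)\<^sup>*)"

definition rank_function :: "'v set \<Rightarrow> 'v rel \<Rightarrow> ('v \<Rightarrow> nat) \<Rightarrow> nat \<Rightarrow> bool" where
  "rank_function V E \<rho> l \<longleftrightarrow> \<rho> ` V = {0..l} \<and> (\<forall>(s, t)\<in>E. \<rho> s + 1 = \<rho> t)"

definition ranked :: "('v, 'i) colored_graph \<Rightarrow> bool" where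
  "ranked R \<longleftrightarrow> (\<exists>\<rho> l. rank_function (verts R) (edge_rel R) \<rho> l)"

definition connected_poset :: "('v, 'i) colored_graph \<Rightarrow> bool" where
  "connected_poset R \<longleftrightarrow>
     (\<forall>x\<in>verts R. \<forall>y\<in>verts R. (x, y) \<in> (edge_rel R \<union> (edge_rel R)\<inverse>)\<^sup>*)"

definition color_comp :: "('v, 'i) colored_graph \<Rightarrow> 'i \<Rightarrow> 'v \<Rightarrow> 'v set" where
  "color_comp R i x = {y. (x, y) \<in> (color_rel R i \<union> (color_rel R i)\<inverse>)\<^sup>*}"

definition comp_edges :: "('v, 'i) colored_graph \<Rightarrow> 'i \<Rightarrow> 'v \<Rightarrow> 'v rel" where
  "comp_edges R i x = color_rel R i \<inter> color_comp R i x \<times> color_comp R i x"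

text \<open>In a ranked poset every monochromatic component is connected and ranked, so its rank function
  (onto an initial segment of the naturals) and its length are unique.\<close>

definition comp_rank :: "('v, 'i) colored_graph \<Rightarrow> 'i \<Rightarrow> 'v \<Rightarrow> nat" where
  "comp_rank R i x =
     (THE n. \<exists>\<rho> l. rank_function (color_comp R i x) (comp_edges R i x) \<rho> l \<and> \<rho> x = n)"

definition comp_length :: "('v, 'i) colored_graph \<Rightarrow> 'i \<Rightarrow> 'v \<Rightarrow> nat" where
  "comp_length R i x =
     (THE l. \<exists>\<rho>. rank_function (color_comp R i x) (comp_edges R i x) \<rho> l)"

definition wt :: "('i::finite \<Rightarrow> 'a::euclidean_space) \<Rightarrow> ('v, 'i) colored_graph \<Rightarrow> 'v \<Rightarrow> 'a" where
  "wt \<alpha> R x = (\<Sum>i\<in>UNIV.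
     of_int (2 * int (comp_rank R i x) - int (comp_length R i x)) *\<^sub>R fund_weight \<alpha> i)"

definition WGF ::
  "('i::finite \<Rightarrow> 'a::euclidean_space) \<Rightarrow> ('v, 'i) colored_graph \<Rightarrow> ('a, int) poly_mapping" where
  "WGF \<alpha> R = (\<Sum>x\<in>verts R. wexp (wt \<alpha> R x))"

definition structured_poset ::
  "('i::finite \<Rightarrow> 'a::euclidean_space) \<Rightarrow> ('v, 'i) colored_graph \<Rightarrow> bool" where
  "structured_poset \<alpha> R \<longleftrightarrow>
     colored_poset R \<and> ranked R \<and>
     (\<forall>s i t. (s, i, t) \<in> edges R \<longrightarrow> wt \<alpha> R s + \<alpha> i = wt \<alpha> R t)"

definition splitting_poset ::
  "'a::euclidean_space set \<Rightarrow> ('i::finite \<Rightarrow> 'a) \<Rightarrow> 'a \<Rightarrow> ('v, 'i) colored_graph \<Rightarrow> bool" where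
  "splitting_poset \<Phi> \<alpha> \<mu> R \<longleftrightarrow> structured_poset \<alpha> R \<and> WGF \<alpha> R = weyl_bialternant \<Phi> \<alpha> \<mu>"

definition poset_iso :: "('v, 'i) colored_graph \<Rightarrow> ('u, 'i) colored_graph \<Rightarrow> bool" where
  "poset_iso R Q \<longleftrightarrow> (\<exists>f. bij_betw f (verts R) (verts Q) \<and>
     (\<forall>s\<in>verts R. \<forall>t\<in>verts R. \<forall>i. (s, i, t) \<in> edges R \<longleftrightarrow> (f s, i, f t) \<in> edges Q))"

definition proper_subgraph :: "('v, 'i) colored_graph \<Rightarrow> ('v, 'i) colored_graph \<Rightarrow> bool" where
  "proper_subgraph S R \<longleftrightarrow>
     verts S \<subseteq> verts R \<and> edges S \<subseteq> edges R \<and> edges S \<subseteq> verts S \<times> UNIV \<times> verts S \<and>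
     (verts S \<noteq> verts R \<or> edges S \<noteq> edges R)"

text \<open>Anything isomorphic to a subgraph of \<open>R\<close> has a copy with vertices of the same type, so letting
  \<open>Q\<close> range over \<open>('v, 'i) colored_graph\<close> loses nothing. As \<open>R\<close> is finite, a \<open>Q\<close> isomorphic to a
  proper subgraph is automatically different from \<open>R\<close>.\<close>

definition edge_minimal ::
  "'a::euclidean_space set \<Rightarrow> ('i::finite \<Rightarrow> 'a) \<Rightarrow> 'a \<Rightarrow> ('v, 'i) colored_graph \<Rightarrow> bool" where
  "edge_minimal \<Phi> \<alpha> \<mu> R \<longleftrightarrow>
     splitting_poset \<Phi> \<alpha> \<mu> R \<and>
     \<not> (\<exists>(Q :: ('v, 'i) colored_graph) (S :: ('v, 'i) colored_graph).
          splitting_poset \<Phi> \<alpha> \<mu> Q \<and> proper_subgraph S R \<and> poset_iso Q S)"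

section \<open>Minuscule and quasi-minuscule weights\<close>

definition minuscule :: "'a::euclidean_space set \<Rightarrow> ('i::finite \<Rightarrow> 'a) \<Rightarrow> 'a \<Rightarrow> bool" where
  "minuscule \<Phi> \<alpha> \<mu> \<longleftrightarrow>
     \<mu> \<in> weight_lattice \<alpha> \<and> \<mu> \<noteq> 0 \<and> (\<forall>\<beta>\<in>\<Phi>. \<mu> \<bullet> coroot \<beta> \<in> {-1, 0, 1})"

definition quasi_minuscule :: "'a::euclidean_space set \<Rightarrow> ('i::finite \<Rightarrow> 'a) \<Rightarrow> 'a \<Rightarrow> bool" where
  "quasi_minuscule \<Phi> \<alpha> \<mu> \<longleftrightarrow>
     \<mu> \<in> weight_lattice \<alpha> \<and> \<mu> \<noteq> 0 \<and> (\<forall>\<beta>\<in>\<Phi>. \<mu> \<bullet> coroot \<beta> \<in> {-2, -1, 0, 1, 2}) \<and>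
     (\<exists>!\<beta>. \<beta> \<in> \<Phi> \<and> \<mu> \<bullet> coroot \<beta> = 2)"

text \<open>For an irreducible root system the short roots are those of minimal length; if there is only
  one root length, all roots are short.\<close>

definition short_root :: "'a::euclidean_space set \<Rightarrow> 'a \<Rightarrow> bool" where
  "short_root \<Phi> \<beta> \<longleftrightarrow> \<beta> \<in> \<Phi> \<and> (\<forall>\<gamma>\<in>\<Phi>. norm \<beta> \<le> norm \<gamma>)"

definition minuscule_poset ::
  "'a::euclidean_space set \<Rightarrow> ('i::finite \<Rightarrow> 'a) \<Rightarrow> 'a \<Rightarrow> ('a, 'i) colored_graph" where
  "minuscule_poset \<Phi> \<alpha> lam = \<lparr>
     verts = weyl_orbit \<Phi> lam,
     edges = {(\<mu>, i, \<nu>). \<mu> \<in> weyl_orbit \<Phi> lam \<and> \<nu> \<in> weyl_orbit \<Phi> lam \<and> \<mu> + \<alpha> i = \<nu>} \<rparr>"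

text \<open>\<open>Inl \<mu>\<close> is the orbit element \<open>\<mu>\<close>; \<open>Inr i\<close> is the new symbol attached to the short simple root
  \<open>\<alpha> i\<close>.\<close>

definition quasi_minuscule_poset ::
  "'a::euclidean_space set \<Rightarrow> ('i::finite \<Rightarrow> 'a) \<Rightarrow> 'a \<Rightarrow> ('a + 'i, 'i) colored_graph" where
  "quasi_minuscule_poset \<Phi> \<alpha> lam = \<lparr>
     verts = Inl ` weyl_orbit \<Phi> lam \<union> Inr ` {i. short_root \<Phi> (\<alpha> i)},
     edges = {(Inl \<mu>, i, Inl \<nu>) | \<mu> i \<nu>.
                \<mu> \<in> weyl_orbit \<Phi> lam \<and> \<nu> \<in> weyl_orbit \<Phi> lam \<and> \<mu> + \<alpha> i = \<nu>}
       \<union> {(Inl (- \<alpha> i), i, Inr i) | i. short_root \<Phi> (\<alpha> i)}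
       \<union> {(Inr i, i, Inl (\<alpha> i)) | i. short_root \<Phi> (\<alpha> i)} \<rparr>"

end

theory Submission
  imports Defs
begin

text \<open>The Weyl denominator is not a zero divisor, since \<open>\<rho>\<close> is the unique maximiser of
  \<open>\<langle>\<cdot>, \<rho>\<rangle>\<close> on its orbit. Multiplying it with the orbit sum of \<open>\<lambda>\<close> gives the sum of the
  alternants of \<open>\<mu> + \<rho>\<close> for \<open>\<mu> \<in> W\<lambda>\<close>; all of them vanish except for \<open>\<mu> = \<lambda>\<close> and for \<open>\<mu> = - \<alpha>\<^sub>i\<close>,
  where one gets minus the denominator. So \<open>\<chi>\<^sub>\<lambda>\<close> is the orbit sum plus \<open>k e\<^sup>0\<close>, where \<open>k\<close> is the number of
  simple roots in \<open>W\<lambda>\<close>: none for minuscule \<open>\<lambda>\<close>, the short ones for quasi-minuscule \<open>\<lambda>\<close>.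
  In a splitting poset each nonzero weight thus has one vertex, and as \<open>m\<^sub>i\<close> is the
  pairing with \<open>\<alpha>\<^sub>i\<^sup>\<or>\<close>, this forces all edges between nonzero weights and, for each short simple
  root, at least one path \<open>- \<alpha>\<^sub>i \<rightarrow> z \<rightarrow> \<alpha>\<^sub>i\<close> with \<open>z\<close> of weight \<open>0\<close>. Edge-minimality leaves a
  single such \<open>z = z\<^sub>i\<close>, and connectedness makes \<open>i \<mapsto> z\<^sub>i\<close> onto the \<open>k\<close> vertices of weight \<open>0\<close>,
  hence bijective.\<close>

section \<open>Roots and the Weyl group\<close>

text \<open>The weight of a vertex is computed from ranks inside monochromatic components, so it
  cannot be read off a poset that is given by its edges. The locale \<open>weight_model\<close>
  therefore takes a candidate weight \<open>f\<close> as a parameter, subject to conditions on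
  vertices and edges, and \<open>wt\<close> = \<open>f\<close> is derived. It is entered by
  R(\<lambda>) with the evident \<open>f\<close>, by an arbitrary splitting poset with its own
  \<open>wt\<close>, and by the pruned subgraph of an edge-minimal poset. Both families of weights
  satisfy the same bound on pairings with simple coroots (\<open>small_weight\<close>), so one
  treatment serves both. The extra work in the quasi-minuscule case is that \<lambda> is given only
  by its pairings: it has to be shown to be a root, and its orbit to consist of exactly the short
  roots. Irreducibility enters there, as connectedness of the roots under non-orthogonality. A
  competitor in the definition of edge-minimality is merely isomorphic to a subgraph; the numbers of
  vertices and edges survive an isomorphism, which is why edges are counted.\<close>

lemma inner_coroot: "x \<bullet> coroot \<beta> = 2 * (x \<bullet> \<beta>) / (\<beta> \<bullet> \<beta>)"
  by (simp add: coroot_def)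

lemma inner_coroot_self: "\<beta> \<noteq> 0 \<Longrightarrow> \<beta> \<bullet> coroot \<beta> = 2"
  by (simp add: inner_coroot)

lemma inner_coroot_pos_iff: "\<beta> \<noteq> 0 \<Longrightarrow> 0 < x \<bullet> coroot \<beta> \<longleftrightarrow> 0 < x \<bullet> \<beta>"
  by (simp add: inner_coroot zero_less_divide_iff inner_gt_zero_iff[symmetric] order_less_not_sym
      del: inner_gt_zero_iff)

lemma inner_coroot_neg_iff: "\<beta> \<noteq> 0 \<Longrightarrow> x \<bullet> coroot \<beta> < 0 \<longleftrightarrow> x \<bullet> \<beta> < 0"
  using inner_coroot_pos_iff[of \<beta> "- x"] by simp

lemma inner_coroot_eq_0_iff: "\<beta> \<noteq> 0 \<Longrightarrow> x \<bullet> coroot \<beta> = 0 \<longleftrightarrow> x \<bullet> \<beta> = 0"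
  by (simp add: inner_coroot)

lemma coroot_uminus: "coroot (- \<beta>) = - coroot \<beta>"
  by (simp add: coroot_def)

lemma reflection_uminus: "reflection (- \<beta>) = reflection \<beta>"
  by (simp add: fun_eq_iff reflection_def coroot_uminus)

lemma reflection_self: "reflection \<beta> \<beta> = - \<beta>"
  by (cases "\<beta> = 0") (simp_all add: reflection_def inner_coroot_self scaleR_2)

lemma reflection_reflection: "reflection \<beta> (reflection \<beta> x) = x"
  by (cases "\<beta> = 0") (simp_all add: reflection_def inner_coroot_self algebra_simps scaleR_2)

lemma reflection_comp_self: "reflection \<beta> \<circ> reflection \<beta> = id"
  by (simp add: fun_eq_iff reflection_reflection)

lemma linear_reflection: "linear (reflection \<beta>)"
  by (rule linearI) (simp_all add: reflection_def algebra_simps)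

lemma orthogonal_reflection: "orthogonal_transformation (reflection \<beta>)"
proof (cases "\<beta> = 0")
  case False
  then have "reflection \<beta> x \<bullet> reflection \<beta> y = x \<bullet> y" for x y
    by (simp add: reflection_def inner_coroot inner_diff_left inner_diff_right inner_commute field_simps)
  then show ?thesis
    by (simp add: orthogonal_transformation_def linear_reflection)
qed (simp add: orthogonal_transformation_def linear_reflection reflection_def)

lemma reflection_eq_self: "x \<bullet> \<beta> = 0 \<Longrightarrow> reflection \<beta> x = x"
  by (simp add: reflection_def inner_coroot)

lemma inner_coroot_image:
  "orthogonal_transformation w \<Longrightarrow> w x \<bullet> coroot (w \<beta>) = x \<bullet> coroot \<beta>"
  by (simp add: inner_coroot orthogonal_transformation_def)

lemma reflection_image:
  assumes "orthogonal_transformation w"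
  shows "reflection (w \<beta>) (w x) = w (reflection \<beta> x)"
proof -
  interpret linear w using assms by (simp add: orthogonal_transformation_def)
  show ?thesis
    by (simp add: reflection_def inner_coroot_image[OF assms] diff scale)
qed

text \<open>The prescribed values extend to a linear functional, which is represented by the vector
  of its values on the standard basis. This is the source of the height vector, of coordinate
  functionals and of fundamental weights.\<close>

lemma independent_dual_vector:
  fixes \<alpha> :: "'i \<Rightarrow> 'a::euclidean_space"
  assumes "inj \<alpha>" "independent (range \<alpha>)"
  obtains w where "\<And>i. w \<bullet> \<alpha> i = c i"
proof -
  obtain f :: "'a \<Rightarrow> real" where f: "linear f" "\<forall>x\<in>range \<alpha>. f x = c (inv \<alpha> x)"
    using linear_independent_extend[OF assms(2), of "\<lambda>x. c (inv \<alpha> x)"] by blast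
  interpret linear f by (rule f)
  have "(\<Sum>b\<in>Basis. f b *\<^sub>R b) \<bullet> x = f x" for x
  proof -
    have "f x = f (\<Sum>b\<in>Basis. (x \<bullet> b) *\<^sub>R b)"
      by (simp add: euclidean_representation)
    then show ?thesis
      by (simp add: sum scale inner_sum_right inner_commute mult.commute)
  qed
  then show thesis
    using that f assms(1) by (metis inv_f_f rangeI)
qed

section \<open>The Weyl group as a group of isometries, and its orbits\<close>

lemma weyl_orthogonal: "w \<in> weyl_group \<Phi> \<Longrightarrow> orthogonal_transformation w"
proof (induction rule: weyl_group.induct)
  case (weyl_reflection \<beta> w)
  then show ?case by (intro orthogonal_transformation_compose orthogonal_reflection)
qed (simp add: id_def)

lemma weyl_linear: "w \<in> weyl_group \<Phi> \<Longrightarrow> linear w"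
  using weyl_orthogonal orthogonal_transformation_def by blast

lemma weyl_inner: "w \<in> weyl_group \<Phi> \<Longrightarrow> w x \<bullet> w y = x \<bullet> y"
  using weyl_orthogonal orthogonal_transformation_def by blast

lemma weyl_comp: "v \<in> weyl_group \<Phi> \<Longrightarrow> w \<in> weyl_group \<Phi> \<Longrightarrow> v \<circ> w \<in> weyl_group \<Phi>"
  by (induction rule: weyl_group.induct)
    (simp only: id_comp, simp only: comp_assoc weyl_reflection)

lemma reflection_in_weyl: "\<beta> \<in> \<Phi> \<Longrightarrow> reflection \<beta> \<in> weyl_group \<Phi>"
  using weyl_reflection[OF _ weyl_id] by (metis comp_id)

text \<open>The inductive definition only generates a monoid; it is a group because each generator
  is an involution.\<close>

lemma weyl_inverse:
  assumes "w \<in> weyl_group \<Phi>"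
  obtains v where "v \<in> weyl_group \<Phi>" "v \<circ> w = id" "w \<circ> v = id"
proof -
  have "\<exists>v\<in>weyl_group \<Phi>. v \<circ> w = id \<and> w \<circ> v = id"
    using assms
  proof (induction rule: weyl_group.induct)
    case (weyl_reflection \<beta> w)
    then obtain v where "v \<in> weyl_group \<Phi>" "v \<circ> w = id" "w \<circ> v = id" by blast
    moreover from this have "v \<circ> reflection \<beta> \<circ> (reflection \<beta> \<circ> w) = id"
      "reflection \<beta> \<circ> w \<circ> (v \<circ> reflection \<beta>) = id"
      by (simp_all add: fun_eq_iff reflection_reflection)
    ultimately show ?case
      using weyl_reflection.hyps weyl_comp reflection_in_weyl by blast
  qed (metis weyl_id comp_id)
  then show thesis using that by blast
qed

lemma weyl_orbit_self: "x \<in> weyl_orbit \<Phi> x"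
  unfolding weyl_orbit_def by (rule image_eqI[OF _ weyl_id]) simp

lemma weyl_orbit_image:
  assumes "x \<in> weyl_orbit \<Phi> y" "w \<in> weyl_group \<Phi>"
  shows "w x \<in> weyl_orbit \<Phi> y"
proof -
  obtain v where v: "x = v y" "v \<in> weyl_group \<Phi>"
    using assms(1) unfolding weyl_orbit_def by blast
  show ?thesis
    unfolding weyl_orbit_def by (rule image_eqI[OF _ weyl_comp[OF assms(2) v(2)]]) (simp add: v)
qed

lemma weyl_orbit_reflection:
  "x \<in> weyl_orbit \<Phi> y \<Longrightarrow> \<beta> \<in> \<Phi> \<Longrightarrow> reflection \<beta> x \<in> weyl_orbit \<Phi> y"
  by (simp add: weyl_orbit_image reflection_in_weyl)

section \<open>Simple roots, height and positive roots\<close>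

locale root_basis =
  fixes \<Phi> :: "'a::euclidean_space set" and \<alpha> :: "'i::finite \<Rightarrow> 'a"
  assumes root_system: "root_system \<Phi>" and simple_roots: "simple_roots \<Phi> \<alpha>"
begin

lemma finite_roots: "finite \<Phi>"
  and span_roots: "span \<Phi> = UNIV"
  and root_nonzero: "\<beta> \<in> \<Phi> \<Longrightarrow> \<beta> \<noteq> 0"
  and integral: "\<beta> \<in> \<Phi> \<Longrightarrow> \<gamma> \<in> \<Phi> \<Longrightarrow> \<gamma> \<bullet> coroot \<beta> \<in> \<int>"
  and reduced: "\<beta> \<in> \<Phi> \<Longrightarrow> c *\<^sub>R \<beta> \<in> \<Phi> \<Longrightarrow> c = 1 \<or> c = -1"
  and reflection_root: "\<beta> \<in> \<Phi> \<Longrightarrow> \<gamma> \<in> \<Phi> \<Longrightarrow> reflection \<beta> \<gamma> \<in> \<Phi>"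
  using root_system unfolding root_system_def by blast+

lemma uminus_root: "\<beta> \<in> \<Phi> \<Longrightarrow> - \<beta> \<in> \<Phi>"
  using reflection_root[of \<beta> \<beta>] by (simp add: reflection_self)

lemma inj_simple: "inj \<alpha>"
  and simple_root: "\<alpha> i \<in> \<Phi>"
  and independent_simple: "independent (range \<alpha>)"
  using simple_roots unfolding simple_roots_def by blast+

lemma simple_nonzero: "\<alpha> i \<noteq> 0"
  using root_nonzero simple_root by blast

lemma root_cases:
  assumes "\<beta> \<in> \<Phi>"
  obtains c :: "'i \<Rightarrow> nat" where "\<beta> = (\<Sum>i\<in>UNIV. real (c i) *\<^sub>R \<alpha> i)"
  | c :: "'i \<Rightarrow> nat" where "\<beta> = - (\<Sum>i\<in>UNIV. real (c i) *\<^sub>R \<alpha> i)"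
  using simple_roots assms unfolding simple_roots_def by blast

lemma span_simple: "span (range \<alpha>) = UNIV"
proof -
  have "\<beta> \<in> span (range \<alpha>)" if "\<beta> \<in> \<Phi>" for \<beta>
    using that
    by (cases rule: root_cases) (simp_all add: span_neg span_sum span_scale span_base)
  then have "\<Phi> \<subseteq> span (range \<alpha>)" by blast
  then have "span \<Phi> \<subseteq> span (range \<alpha>)" by (rule span_minimal) simp
  then show ?thesis using span_roots by auto
qed

lemma eqI_simple:
  assumes "\<And>i. x \<bullet> \<alpha> i = y \<bullet> \<alpha> i"
  shows "x = y"
proof -
  have "(x - y) \<bullet> u = 0" if "u \<in> range \<alpha>" for u
    using assms that by (auto simp: inner_diff_left)
  then have "(x - y) \<bullet> (x - y) = 0"
    using span_simple by (metis UNIV_I orthogonal_def orthogonal_to_span)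
  then show ?thesis by simp
qed

lemma eqI_coroot:
  assumes "\<And>i. x \<bullet> coroot (\<alpha> i) = y \<bullet> coroot (\<alpha> i)"
  shows "x = y"
proof (rule eqI_simple)
  fix i
  show "x \<bullet> \<alpha> i = y \<bullet> \<alpha> i"
    using assms[of i] simple_nonzero[of i] by (simp add: inner_coroot)
qed

text \<open>Height is the pairing with a fixed vector, hence linear on the whole space and available
  for weights as well as roots. Its sign on a root separates positive from negative roots.\<close>

definition height_vector :: 'a where
  "height_vector = (SOME h. \<forall>i. h \<bullet> \<alpha> i = 1)"

definition height :: "'a \<Rightarrow> real" where
  "height x = height_vector \<bullet> x"

lemma height_simple: "height (\<alpha> i) = 1"
proof -
  have "\<exists>h. \<forall>i. h \<bullet> \<alpha> i = 1"
    using independent_dual_vector[OF inj_simple independent_simple, of "\<lambda>_. 1"] by metis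
  then have "\<forall>i. height_vector \<bullet> \<alpha> i = 1"
    unfolding height_vector_def by (rule someI_ex)
  then show ?thesis by (simp add: height_def)
qed

lemma height_add: "height (x + y) = height x + height y"
  and height_diff: "height (x - y) = height x - height y"
  and height_minus: "height (- x) = - height x"
  and height_scale: "height (r *\<^sub>R x) = r * height x"
  and height_0: "height 0 = 0"
  by (simp_all add: height_def inner_add_right inner_diff_right)

lemma height_combination: "height (\<Sum>i\<in>UNIV. c i *\<^sub>R \<alpha> i) = (\<Sum>i\<in>UNIV. c i)"
  using height_simple by (simp add: height_def inner_sum_right)

lemma positive_root:
  assumes "\<beta> \<in> \<Phi>" "0 < height \<beta>"
  obtains c :: "'i \<Rightarrow> nat" where "\<beta> = (\<Sum>i\<in>UNIV. real (c i) *\<^sub>R \<alpha> i)"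
  using assms(1)
proof (cases rule: root_cases)
  case (2 c)
  then have "height \<beta> \<le> 0"
    by (simp add: height_minus height_combination sum_nonneg)
  then show ?thesis using assms(2) by simp
qed (rule that)

lemma height_root_nonzero:
  assumes "\<beta> \<in> \<Phi>"
  shows "height \<beta> \<noteq> 0"
  using assms
proof (cases rule: root_cases)
  case (1 c)
  show ?thesis
  proof
    assume "height \<beta> = 0"
    then have "\<forall>i. c i = 0" using 1 by (simp add: height_combination sum_nonneg_eq_0_iff)
    then show False using 1 root_nonzero[OF assms] by simp
  qed
next
  case (2 c)
  show ?thesis
  proof
    assume "height \<beta> = 0"
    then have "\<forall>i. c i = 0" using 2 by (simp add: height_minus height_combination sum_nonneg_eq_0_iff)
    then show False using 2 root_nonzero[OF assms] by simp
  qed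
qed

text \<open>As the root system is reduced, \<open>\<beta>\<close> has a positive coefficient at some
  \<open>j\<close> other than \<open>i\<close>. The reflection changes only the coefficient at
  \<open>i\<close>, so the one at \<open>j\<close>, read off by the dual vector \<open>d\<close>,
  stays positive, and all coefficients of a root have the same sign.\<close>

lemma simple_reflection_positive:
  assumes "\<beta> \<in> \<Phi>" "0 < height \<beta>" "\<beta> \<noteq> \<alpha> i"
  shows "0 < height (reflection (\<alpha> i) \<beta>)"
proof -
  obtain c :: "'i \<Rightarrow> nat" where c: "\<beta> = (\<Sum>i\<in>UNIV. real (c i) *\<^sub>R \<alpha> i)"
    using positive_root assms by blast
  have "\<exists>j. j \<noteq> i \<and> c j \<noteq> 0"
  proof (rule ccontr)
    assume "\<not> ?thesis"
    then have "real (c j) *\<^sub>R \<alpha> j = (if j = i then real (c i) *\<^sub>R \<alpha> i else 0)" for j by auto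
    then have "(\<Sum>j\<in>UNIV. real (c j) *\<^sub>R \<alpha> j) =
        (\<Sum>j\<in>UNIV. if j = i then real (c i) *\<^sub>R \<alpha> i else 0)"
      by (rule sum.cong[OF refl])
    then have \<beta>: "\<beta> = real (c i) *\<^sub>R \<alpha> i" by (simp add: c)
    with assms(1) reduced[OF simple_root[of i], of "real (c i)"] have "real (c i) = 1" by auto
    with \<beta> assms(3) show False by simp
  qed
  then obtain j where j: "j \<noteq> i" "c j \<noteq> 0" by blast
  obtain d where d: "\<And>k. d \<bullet> \<alpha> k = (if k = j then 1 else 0)"
    using independent_dual_vector[OF inj_simple independent_simple, of "\<lambda>k. if k = j then 1 else 0"] by blast
  have d_sum: "d \<bullet> (\<Sum>k\<in>UNIV. r k *\<^sub>R \<alpha> k) = r j" for r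
  proof -
    have "d \<bullet> (\<Sum>k\<in>UNIV. r k *\<^sub>R \<alpha> k) = (\<Sum>k\<in>UNIV. if k = j then r k else 0)"
      unfolding inner_sum_right by (rule sum.cong) (simp_all add: d)
    then show ?thesis by simp
  qed
  have pos: "0 < d \<bullet> reflection (\<alpha> i) \<beta>"
    using j d_sum[of "\<lambda>k. real (c k)"] d[of i] c
    by (simp add: reflection_def inner_diff_right)
  have root: "reflection (\<alpha> i) \<beta> \<in> \<Phi>" using reflection_root simple_root assms(1) by blast
  then show ?thesis
  proof (cases rule: root_cases)
    case (1 c')
    then have "0 \<le> height (reflection (\<alpha> i) \<beta>)" by (simp add: height_combination sum_nonneg)
    then show ?thesis using height_root_nonzero[OF root] by simp
  next
    case (2 c')
    then have "d \<bullet> reflection (\<alpha> i) \<beta> = - real (c' j)"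
      using d_sum[of "\<lambda>k. real (c' k)"] by simp
    then show ?thesis using pos by simp
  qed
qed

section \<open>Words in the simple reflections and the deletion property\<close>

primrec simple_word :: "'i list \<Rightarrow> 'a \<Rightarrow> 'a" where
  "simple_word [] = id"
| "simple_word (i # is) = reflection (\<alpha> i) \<circ> simple_word is"

lemma simple_word_append: "simple_word (is @ js) = simple_word is \<circ> simple_word js"
  by (induction "is") auto

lemma simple_word_weyl: "simple_word is \<in> weyl_group \<Phi>"
  by (induction "is")
    (simp_all only: simple_word.simps weyl_id weyl_reflection simple_root)

lemma simple_word_rev: "simple_word is \<circ> simple_word (rev is) = id"
proof (induction "is")
  case (Cons i "is")
  have "simple_word (i # is) \<circ> simple_word (rev (i # is)) =
      reflection (\<alpha> i) \<circ> (simple_word is \<circ> simple_word (rev is)) \<circ> reflection (\<alpha> i)"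
    by (simp add: simple_word_append comp_assoc)
  then show ?case by (simp only: Cons comp_id reflection_comp_self)
qed simp

lemma weyl_root: "w \<in> weyl_group \<Phi> \<Longrightarrow> \<beta> \<in> \<Phi> \<Longrightarrow> w \<beta> \<in> \<Phi>"
  by (induction rule: weyl_group.induct) (auto intro: reflection_root)

text \<open>Since \<langle>\<beta>, \<beta>\<rangle> > 0 and the coefficients of \<beta> are
  nonnegative, \<beta> pairs positively with some simple coroot. Unless \<beta> is simple, that
  simple reflection keeps it positive and lowers its height by a positive integer.\<close>

lemma positive_root_conjugate_simple:
  assumes "\<beta> \<in> \<Phi>" "0 < height \<beta>"
  shows "\<exists>is k. \<beta> = simple_word is (\<alpha> k)"
  using assms
proof (induction "nat \<lfloor>height \<beta>\<rfloor>" arbitrary: \<beta> rule: less_induct)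
  case less
  show ?case
  proof (cases "\<beta> \<in> range \<alpha>")
    case True
    then show ?thesis by (metis simple_word.simps(1) id_apply rangeE)
  next
    case False
    obtain c :: "'i \<Rightarrow> nat" where c: "\<beta> = (\<Sum>i\<in>UNIV. real (c i) *\<^sub>R \<alpha> i)"
      using positive_root less.prems by blast
    have "0 < \<beta> \<bullet> \<beta>" using root_nonzero less.prems by simp
    also have "\<beta> \<bullet> \<beta> = (\<Sum>i\<in>UNIV. real (c i) * (\<beta> \<bullet> \<alpha> i))"
      by (subst (2) c) (simp add: inner_sum_right)
    finally have "\<not> (\<forall>i\<in>UNIV. real (c i) * (\<beta> \<bullet> \<alpha> i) \<le> 0)"
      using sum_nonpos[of UNIV "\<lambda>i. real (c i) * (\<beta> \<bullet> \<alpha> i)"] by force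
    then obtain i where "0 < real (c i) * (\<beta> \<bullet> \<alpha> i)"
      by (auto simp: not_le)
    then have i: "0 < \<beta> \<bullet> coroot (\<alpha> i)"
      by (simp add: inner_coroot_pos_iff simple_nonzero zero_less_mult_iff)
    let ?\<gamma> = "reflection (\<alpha> i) \<beta>"
    have \<gamma>: "?\<gamma> \<in> \<Phi>" using reflection_root simple_root less.prems by blast
    have pos: "0 < height ?\<gamma>" using simple_reflection_positive less.prems False by blast
    obtain k where k: "\<beta> \<bullet> coroot (\<alpha> i) = of_int k"
      using integral[OF simple_root less.prems(1)] by (auto elim: Ints_cases)
    have "height ?\<gamma> = height \<beta> - of_int k"
      by (simp add: reflection_def k height_diff height_scale height_simple)
    moreover have "k \<ge> 1" using i k by simp
    ultimately have "\<lfloor>height ?\<gamma>\<rfloor> < \<lfloor>height \<beta>\<rfloor>" by simp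
    then have "nat \<lfloor>height ?\<gamma>\<rfloor> < nat \<lfloor>height \<beta>\<rfloor>"
      using pos by (subst nat_less_eq_zless) simp_all
    from less.hyps[OF this \<gamma> pos] obtain "is" k where "?\<gamma> = simple_word is (\<alpha> k)" by blast
    then have "\<beta> = simple_word (i # is) (\<alpha> k)"
      by (metis comp_apply reflection_reflection simple_word.simps(2))
    then show ?thesis by blast
  qed
qed

lemma reflection_simple_word: "reflection (simple_word is (\<alpha> k)) = simple_word (is @ [k] @ rev is)"
proof
  fix x
  have "x = simple_word is (simple_word (rev is) x)"
    using simple_word_rev by (metis comp_apply id_apply)
  then have "reflection (simple_word is (\<alpha> k)) x =
      simple_word is (reflection (\<alpha> k) (simple_word (rev is) x))"
    using reflection_image[OF weyl_orthogonal[OF simple_word_weyl]] by metis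
  then show "reflection (simple_word is (\<alpha> k)) x = simple_word (is @ [k] @ rev is) x"
    by (simp add: simple_word_append)
qed

lemma reflection_is_simple_word:
  assumes "\<beta> \<in> \<Phi>"
  shows "\<exists>is. reflection \<beta> = simple_word is"
proof (cases "0 < height \<beta>")
  case True
  then show ?thesis
    using positive_root_conjugate_simple[OF assms] reflection_simple_word by metis
next
  case False
  then have "0 < height (- \<beta>)" using height_root_nonzero[OF assms] by (simp add: height_minus)
  then show ?thesis
    using positive_root_conjugate_simple[OF uminus_root[OF assms]] reflection_simple_word
    by (metis reflection_uminus)
qed

lemma weyl_is_simple_word: "w \<in> weyl_group \<Phi> \<Longrightarrow> \<exists>is. w = simple_word is"
proof (induction rule: weyl_group.induct)
  case weyl_id
  then show ?case by (metis simple_word.simps(1))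
next
  case (weyl_reflection \<beta> w)
  then show ?case by (metis reflection_is_simple_word simple_word_append)
qed

text \<open>Read the word from the right and follow the image of \<open>\<alpha> k\<close>: it
  starts positive and ends negative. At a letter \<open>i\<close> that turns it negative, the image
  so far must be \<open>\<alpha> i\<close> itself. Hence the reflection in \<open>\<alpha> i\<close>
  is the conjugate of the one in \<open>\<alpha> k\<close> by the suffix in between, and the letter
  \<open>i\<close> cancels against the final \<open>k\<close>.\<close>

lemma deletion:
  assumes "height (simple_word is (\<alpha> k)) < 0"
  shows "\<exists>js. length js < length is \<and> simple_word (is @ [k]) = simple_word js"
  using assms
proof (induction "is")
  case Nil
  then show ?case by (simp add: height_simple)
next
  case (Cons i "is")
  have root: "simple_word is (\<alpha> k) \<in> \<Phi>"
    using weyl_root simple_word_weyl simple_root by blast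
  show ?case
  proof (cases "height (simple_word is (\<alpha> k)) < 0")
    case True
    then obtain js where "length js < length is" "simple_word (is @ [k]) = simple_word js"
      using Cons.IH by blast
    then show ?thesis by (intro exI[of _ "i # js"]) simp
  next
    case False
    then have "0 < height (simple_word is (\<alpha> k))" using height_root_nonzero[OF root] by simp
    then have eq: "simple_word is (\<alpha> k) = \<alpha> i"
      using simple_reflection_positive[OF root] Cons.prems by fastforce
    have "simple_word ((i # is) @ [k]) = reflection (\<alpha> i) \<circ> simple_word (is @ [k])" by simp
    also have "\<dots> = reflection (simple_word is (\<alpha> k)) \<circ> simple_word is \<circ> reflection (\<alpha> k)"
      by (simp add: eq simple_word_append comp_assoc)
    also have "\<dots> = simple_word is"
      by (simp add: fun_eq_iff reflection_image[OF weyl_orthogonal[OF simple_word_weyl]]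
          reflection_reflection)
    finally show ?thesis by auto
  qed
qed

text \<open>Induction along reduced words: the last letter of a shortest word is sent to a negative root.\<close>

lemma weyl_induct [consumes 1, case_names id step]:
  assumes "w \<in> weyl_group \<Phi>"
    and "P id"
    and "\<And>v k. v \<in> weyl_group \<Phi> \<Longrightarrow> height ((v \<circ> reflection (\<alpha> k)) (\<alpha> k)) < 0 \<Longrightarrow> P v \<Longrightarrow>
      P (v \<circ> reflection (\<alpha> k))"
  shows "P w"
proof -
  have "\<forall>w. w = simple_word is \<longrightarrow> P w" for "is"
  proof (induction "length is" arbitrary: "is" rule: less_induct)
    case less
    show ?case
    proof (cases "\<exists>js. length js < length is \<and> simple_word is = simple_word js")
      case True
      then show ?thesis using less by metis
    next
      case minimal: False
      show ?thesis
      proof (cases "is" rule: rev_cases)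
        case Nil
        then show ?thesis using assms(2) by simp
      next
        case (snoc js k)
        have root: "simple_word js (\<alpha> k) \<in> \<Phi>"
          using weyl_root simple_word_weyl simple_root by blast
        have "\<not> height (simple_word js (\<alpha> k)) < 0"
        proof
          assume "height (simple_word js (\<alpha> k)) < 0"
          then obtain js' where "length js' < length js" "simple_word is = simple_word js'"
            using deletion snoc by blast
          then show False using minimal snoc by (metis length_append_singleton less_SucI)
        qed
        then have "0 < height (simple_word js (\<alpha> k))" using height_root_nonzero[OF root] by simp
        moreover have "simple_word js (- \<alpha> k) = - simple_word js (\<alpha> k)"
          using weyl_linear[OF simple_word_weyl] linear_neg by blast
        ultimately have neg: "height ((simple_word js \<circ> reflection (\<alpha> k)) (\<alpha> k)) < 0"
          by (simp add: reflection_self height_minus)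
        have "P (simple_word js)" using less snoc by simp
        then have "P (simple_word js \<circ> reflection (\<alpha> k))"
          using assms(3) neg simple_word_weyl by blast
        then show ?thesis by (simp add: snoc simple_word_append)
      qed
    qed
  qed
  then show ?thesis using weyl_is_simple_word[OF assms(1)] by blast
qed

section \<open>Dominant vectors, stabilizers and finiteness\<close>

definition dominant :: "'a \<Rightarrow> bool" where
  "dominant x \<longleftrightarrow> (\<forall>i. 0 \<le> x \<bullet> \<alpha> i)"

lemma dominant_inner_positive:
  assumes "dominant x" "\<beta> \<in> \<Phi>" "0 < height \<beta>"
  shows "0 \<le> x \<bullet> \<beta>"
proof -
  obtain c :: "'i \<Rightarrow> nat" where "\<beta> = (\<Sum>i\<in>UNIV. real (c i) *\<^sub>R \<alpha> i)"
    using positive_root assms by blast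
  then show ?thesis
    using assms(1) by (simp add: dominant_def inner_sum_right sum_nonneg)
qed

lemma dominant_inner_negative:
  assumes "dominant x" "\<beta> \<in> \<Phi>" "height \<beta> < 0"
  shows "x \<bullet> \<beta> \<le> 0"
  using dominant_inner_positive[OF assms(1) uminus_root[OF assms(2)]] assms(3)
  by (simp add: height_minus)

lemma dominant_fixed:
  assumes "w \<in> weyl_group \<Phi>" "dominant x" "dominant (w x)"
  shows "w x = x"
  using assms
proof (induction rule: weyl_induct)
  case (step v k)
  let ?w = "v \<circ> reflection (\<alpha> k)"
  have w: "?w \<in> weyl_group \<Phi>"
    using step.hyps reflection_in_weyl simple_root weyl_comp by blast
  then have "?w (\<alpha> k) \<in> \<Phi>" using weyl_root simple_root by blast
  then have "?w x \<bullet> ?w (\<alpha> k) \<le> 0"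
    using dominant_inner_negative step by blast
  then have "x \<bullet> \<alpha> k \<le> 0" using weyl_inner[OF w] by simp
  moreover have "0 \<le> x \<bullet> \<alpha> k" using step.prems by (simp add: dominant_def)
  ultimately have "reflection (\<alpha> k) x = x" by (intro reflection_eq_self) simp
  then show ?case using step by simp
qed simp

text \<open>The inequality of \<open>dominant_fixed\<close> again: with strictly positive pairings
  it becomes a contradiction as soon as a last letter exists.\<close>

lemma regular_stabilizer:
  assumes "w \<in> weyl_group \<Phi>" "\<And>i. 0 < x \<bullet> \<alpha> i" "w x = x"
  shows "w = id"
proof -
  have "w x = x \<longrightarrow> w = id"
    using assms(1)
  proof (induction rule: weyl_induct)
    case (step v k)
    let ?w = "v \<circ> reflection (\<alpha> k)"
    have w: "?w \<in> weyl_group \<Phi>"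
      using step.hyps reflection_in_weyl simple_root weyl_comp by blast
    have dom: "dominant x" using assms(2) by (simp add: dominant_def less_imp_le)
    have "?w (\<alpha> k) \<in> \<Phi>" using w weyl_root simple_root by blast
    then have "x \<bullet> ?w (\<alpha> k) \<le> 0"
      using dominant_inner_negative[OF dom] step by blast
    moreover have "?w x \<bullet> ?w (\<alpha> k) = x \<bullet> \<alpha> k" using weyl_inner[OF w] by blast
    ultimately have "?w x \<noteq> x" using assms(2)[of k] by auto
    then show ?case by blast
  qed simp
  then show ?thesis using assms(3) by blast
qed

lemma dominant_in_orbit:
  assumes "dominant x" "dominant y" "y \<in> weyl_orbit \<Phi> x"
  shows "y = x"
  using assms dominant_fixed unfolding weyl_orbit_def by blast

text \<open>A group element is linear and maps the finite spanning set of roots to itself, so it is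
  determined by one of finitely many restrictions.\<close>

lemma finite_weyl: "finite (weyl_group \<Phi>)"
proof (rule inj_on_finite)
  show "inj_on (\<lambda>w. restrict w \<Phi>) (weyl_group \<Phi>)"
  proof (rule inj_onI)
    fix v w
    assume vw: "v \<in> weyl_group \<Phi>" "w \<in> weyl_group \<Phi>" "restrict v \<Phi> = restrict w \<Phi>"
    then have "\<And>x. x \<in> \<Phi> \<Longrightarrow> v x = w x" by (metis restrict_apply')
    then show "v = w"
      using linear_eq_on_span[OF weyl_linear[OF vw(1)] weyl_linear[OF vw(2)], of \<Phi>] span_roots
      by auto
  qed
  show "(\<lambda>w. restrict w \<Phi>) ` weyl_group \<Phi> \<subseteq> \<Phi> \<rightarrow>\<^sub>E \<Phi>"
    using weyl_root by auto
  show "finite (\<Phi> \<rightarrow>\<^sub>E \<Phi>)" by (intro finite_PiE finite_roots)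
qed

lemma finite_orbit: "finite (weyl_orbit \<Phi> x)"
  unfolding weyl_orbit_def using finite_weyl by blast

end

section \<open>Weyl bialternants\<close>

lemma lookup_of_int_mult:
  fixes p :: "('b::monoid_add, int) poly_mapping"
  shows "Poly_Mapping.lookup (of_int k * p) x = k * Poly_Mapping.lookup p x"
proof (induction k rule: int_induct[of _ 0])
  case (step1 i)
  then show ?case by (simp add: algebra_simps lookup_add)
next
  case (step2 i)
  then show ?case by (simp add: algebra_simps lookup_minus)
qed simp

lemma wexp_0: "wexp 0 = 1"
  by (simp add: wexp_def)

lemma wexp_add: "wexp (x + y) = wexp x * wexp y"
  by (simp add: wexp_def mult_single)

lemma lookup_wexp: "Poly_Mapping.lookup (wexp \<mu>) x = (if \<mu> = x then 1 else 0)"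
  by (simp add: wexp_def lookup_single when_def)

lemma lookup_wexp_mult:
  "Poly_Mapping.lookup (wexp \<mu> * f) x = Poly_Mapping.lookup f (x - \<mu>)"
proof -
  have "f = (\<Sum>k\<in>Poly_Mapping.keys f. Poly_Mapping.single k (Poly_Mapping.lookup f k))"
    by (rule poly_mapping_eqI) (simp add: lookup_sum lookup_single when_def in_keys_iff)
  then have "wexp \<mu> * f =
      (\<Sum>k\<in>Poly_Mapping.keys f. Poly_Mapping.single (\<mu> + k) (Poly_Mapping.lookup f k))"
    by (metis (no_types, lifting) sum.cong sum_distrib_left mult_single mult_1 wexp_def)
  then have "Poly_Mapping.lookup (wexp \<mu> * f) x =
      (\<Sum>k\<in>Poly_Mapping.keys f. if k = x - \<mu> then Poly_Mapping.lookup f k else 0)"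
    by (simp add: lookup_sum lookup_single when_def eq_diff_eq add.commute)
  also have "\<dots> = Poly_Mapping.lookup f (x - \<mu>)"
    by (simp add: in_keys_iff)
  finally show ?thesis .
qed

section \<open>Fundamental weights, the weight lattice and the sign of a group element\<close>

context root_basis
begin

lemma fund_weight_coroot: "fund_weight \<alpha> i \<bullet> coroot (\<alpha> j) = (if i = j then 1 else 0)"
proof -
  \<comment> \<open>Half the squared length turns the pairing with \<open>\<alpha> j\<close> into
    the pairing 1 with its coroot.\<close>
  obtain w where w: "\<And>j. w \<bullet> \<alpha> j = (if i = j then \<alpha> j \<bullet> \<alpha> j / 2 else 0)"
    using independent_dual_vector[OF inj_simple independent_simple,
        of "\<lambda>j. if i = j then \<alpha> j \<bullet> \<alpha> j / 2 else 0"] by blast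
  have w': "\<forall>j. w \<bullet> coroot (\<alpha> j) = (if i = j then 1 else 0)"
    using simple_nonzero by (simp add: inner_coroot w)
  have "\<forall>j. fund_weight \<alpha> i \<bullet> coroot (\<alpha> j) = (if i = j then 1 else 0)"
    unfolding fund_weight_def
  proof (rule theI[of _ w])
    fix v assume "\<forall>j. v \<bullet> coroot (\<alpha> j) = (if i = j then 1 else 0)"
    then show "v = w" using w' by (intro eqI_coroot) simp
  qed (rule w')
  then show ?thesis by blast
qed

lemma inner_combination_coroot: "(\<Sum>i\<in>UNIV. c i *\<^sub>R fund_weight \<alpha> i) \<bullet> coroot (\<alpha> j) = c j"
proof -
  have "(\<Sum>i\<in>UNIV. c i *\<^sub>R fund_weight \<alpha> i) \<bullet> coroot (\<alpha> j) = (\<Sum>i\<in>UNIV. if i = j then c i else 0)"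
    unfolding inner_sum_left by (rule sum.cong) (simp_all add: fund_weight_coroot)
  then show ?thesis by simp
qed

lemma weight_expansion: "(\<Sum>i\<in>UNIV. (x \<bullet> coroot (\<alpha> i)) *\<^sub>R fund_weight \<alpha> i) = x"
  by (rule eqI_coroot) (rule inner_combination_coroot)

lemma weight_lattice_iff: "x \<in> weight_lattice \<alpha> \<longleftrightarrow> (\<forall>i. x \<bullet> coroot (\<alpha> i) \<in> \<int>)"
proof
  assume "x \<in> weight_lattice \<alpha>"
  then show "\<forall>i. x \<bullet> coroot (\<alpha> i) \<in> \<int>"
    by (auto simp: weight_lattice_def inner_combination_coroot)
next
  assume "\<forall>i. x \<bullet> coroot (\<alpha> i) \<in> \<int>"
  then have "\<forall>i. \<exists>k. x \<bullet> coroot (\<alpha> i) = of_int k" by (auto elim: Ints_cases)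
  then obtain m where "\<And>i. x \<bullet> coroot (\<alpha> i) = of_int (m i)" by metis
  then have "x = (\<Sum>i\<in>UNIV. of_int (m i) *\<^sub>R fund_weight \<alpha> i)"
    using weight_expansion[of x] by simp
  then show "x \<in> weight_lattice \<alpha>" unfolding weight_lattice_def by blast
qed

lemma dominant_weightsD:
  assumes "x \<in> dominant_weights \<alpha>"
  shows "dominant x" "x \<in> weight_lattice \<alpha>"
proof -
  obtain m :: "'i \<Rightarrow> nat" where m: "x = (\<Sum>i\<in>UNIV. of_nat (m i) *\<^sub>R fund_weight \<alpha> i)"
    using assms unfolding dominant_weights_def by blast
  then have pairing: "x \<bullet> coroot (\<alpha> i) = of_nat (m i)" for i
    by (simp add: inner_combination_coroot)
  then have "\<not> x \<bullet> coroot (\<alpha> i) < 0" for i by simp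
  then show "dominant x"
    using inner_coroot_neg_iff[OF simple_nonzero] by (simp add: dominant_def not_less)
  show "x \<in> weight_lattice \<alpha>" by (simp add: weight_lattice_iff pairing)
qed

lemma weyl_vector_coroot: "weyl_vector \<alpha> \<bullet> coroot (\<alpha> i) = 1"
  using inner_combination_coroot[of "\<lambda>_. 1"] by (simp add: weyl_vector_def)

text \<open>Membership in the lattice concerns simple coroots only, so integrality is at hand for a
  simple reflection but not yet for an arbitrary one; hence the passage to words.\<close>

lemma weyl_weight_lattice:
  assumes "w \<in> weyl_group \<Phi>" "x \<in> weight_lattice \<alpha>"
  shows "w x \<in> weight_lattice \<alpha>"
proof -
  have "simple_word is x \<in> weight_lattice \<alpha>" for "is"
  proof (induction "is")
    case (Cons k "is")
    then show ?case
      unfolding weight_lattice_iff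
      by (simp add: reflection_def inner_diff_left integral simple_root)
  qed (simp add: assms)
  then show ?thesis using weyl_is_simple_word[OF assms(1)] by blast
qed

lemma weyl_det_id: "weyl_det \<alpha> id = 1"
proof -
  have "(\<chi> i j. id (fund_weight \<alpha> j) \<bullet> coroot (\<alpha> i)) = (mat 1 :: real^'i^'i)"
    by (simp add: vec_eq_iff fund_weight_coroot mat_def eq_commute)
  then show ?thesis unfolding weyl_det_def by (simp only: det_I)
qed

lemma weyl_det_comp:
  assumes "linear v"
  shows "weyl_det \<alpha> (v \<circ> w) = weyl_det \<alpha> v * weyl_det \<alpha> w"
proof -
  interpret linear v by fact
  have "v (w x) \<bullet> coroot (\<alpha> i) =
      (\<Sum>k\<in>UNIV. (v (fund_weight \<alpha> k) \<bullet> coroot (\<alpha> i)) * (w x \<bullet> coroot (\<alpha> k)))" for x i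
    by (subst weight_expansion[of "w x", symmetric])
      (simp add: sum scale inner_sum_left mult.commute)
  then have "(\<chi> i j. (v \<circ> w) (fund_weight \<alpha> j) \<bullet> coroot (\<alpha> i)) =
      (\<chi> i j. v (fund_weight \<alpha> j) \<bullet> coroot (\<alpha> i)) **
      ((\<chi> i j. w (fund_weight \<alpha> j) \<bullet> coroot (\<alpha> i)) :: real^'i^'i)"
    by (simp add: matrix_matrix_mult_def)
  then show ?thesis unfolding weyl_det_def by (simp only: det_mul)
qed

text \<open>A simple reflection changes a single column of the identity matrix, so Cramer's rule gives
  its determinant.\<close>

lemma weyl_det_simple_reflection: "weyl_det \<alpha> (reflection (\<alpha> k)) = -1"
proof -
  let ?x = "(\<chi> i. reflection (\<alpha> k) (fund_weight \<alpha> k) \<bullet> coroot (\<alpha> i)) :: real^'i"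
  have "(\<chi> i j. reflection (\<alpha> k) (fund_weight \<alpha> j) \<bullet> coroot (\<alpha> i)) =
      ((\<chi> i j. if j = k then (mat 1 *v ?x) $ i else (mat 1 :: real^'i^'i) $ i $ j) :: real^'i^'i)"
    unfolding matrix_vector_mul_lid
    by (simp add: vec_eq_iff mat_def reflection_def fund_weight_coroot)
  then have "weyl_det \<alpha> (reflection (\<alpha> k)) = ?x $ k * det (mat 1 :: real^'i^'i)"
    unfolding weyl_det_def by (simp only: cramer_lemma)
  then show ?thesis
    by (simp add: reflection_def fund_weight_coroot inner_diff_left inner_coroot_self simple_nonzero)
qed

definition weyl_sign :: "('a \<Rightarrow> 'a) \<Rightarrow> int" where
  "weyl_sign w = \<lfloor>weyl_det \<alpha> w\<rfloor>"

lemma weyl_sign_id: "weyl_sign id = 1"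
  by (simp add: weyl_sign_def weyl_det_id)

lemma weyl_sign_comp_simple_reflection:
  assumes "w \<in> weyl_group \<Phi>"
  shows "weyl_sign (w \<circ> reflection (\<alpha> k)) = - weyl_sign w"
proof -
  \<comment> \<open>Floor commutes with negation only on integers, so the determinant is first
    pinned down to 1 or -1.\<close>
  have "weyl_det \<alpha> (simple_word is) \<in> {1, -1}" for "is"
  proof (induction "is")
    case (Cons i "is")
    then show ?case
      unfolding simple_word.simps weyl_det_comp[OF linear_reflection] weyl_det_simple_reflection
      by auto
  qed (simp only: simple_word.simps weyl_det_id insertI1)
  then have "weyl_det \<alpha> w \<in> {1, -1}" using weyl_is_simple_word[OF assms] by blast
  then show ?thesis
    unfolding weyl_sign_def weyl_det_comp[OF weyl_linear[OF assms]] weyl_det_simple_reflection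
    by (auto simp: floor_eq_iff)
qed

section \<open>Alternants and cancellation of the Weyl denominator\<close>

lemma alternant_altdef:
  "alternant \<Phi> \<alpha> \<mu> = (\<Sum>w\<in>weyl_group \<Phi>. of_int (weyl_sign w) * wexp (w \<mu>))"
  by (simp add: alternant_def weyl_sign_def)

text \<open>Right multiplication by the reflection permutes the group and flips every sign.\<close>

lemma alternant_simple_reflection:
  "alternant \<Phi> \<alpha> (reflection (\<alpha> k) \<mu>) = - alternant \<Phi> \<alpha> \<mu>"
proof -
  let ?s = "\<lambda>w. w \<circ> reflection (\<alpha> k)"
  have closed: "?s w \<in> weyl_group \<Phi>" if "w \<in> weyl_group \<Phi>" for w
    using that weyl_comp reflection_in_weyl simple_root by blast
  have inv: "?s (?s w) = w" for w
    by (simp add: comp_assoc reflection_comp_self)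
  have "alternant \<Phi> \<alpha> (reflection (\<alpha> k) \<mu>) =
      (\<Sum>w\<in>weyl_group \<Phi>. of_int (- weyl_sign w) * wexp (w \<mu>))"
    unfolding alternant_altdef
    by (rule sum.reindex_bij_witness[of _ ?s ?s])
      (simp_all only: inv closed weyl_sign_comp_simple_reflection comp_apply minus_minus)
  then show ?thesis by (simp add: alternant_altdef sum_negf)
qed

text \<open>A weight on the wall of a simple root is fixed by that reflection, so its alternant
  equals its own negative; integer coefficients have no 2-torsion.\<close>

lemma alternant_eq_0:
  assumes "\<mu> \<bullet> coroot (\<alpha> k) = 0"
  shows "alternant \<Phi> \<alpha> \<mu> = 0"
proof -
  have "reflection (\<alpha> k) \<mu> = \<mu>" using assms by (simp add: reflection_def)
  then have "alternant \<Phi> \<alpha> \<mu> = - alternant \<Phi> \<alpha> \<mu>"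
    using alternant_simple_reflection[of k \<mu>] by simp
  then have "Poly_Mapping.lookup (alternant \<Phi> \<alpha> \<mu>) x = - Poly_Mapping.lookup (alternant \<Phi> \<alpha> \<mu>) x" for x
    by (metis lookup_uminus)
  then show ?thesis by (intro poly_mapping_eqI) (simp add: eq_neg_iff_add_eq_0)
qed

text \<open>In the summand of \<open>w\<close>, the invariant set \<open>M\<close> may be reindexed
  by \<open>w\<close>, which merges the two exponentials into one at
  \<open>w (\<mu> + \<nu>)\<close>; then the sums are swapped.\<close>

lemma alternant_mult_invariant:
  assumes "finite M" "\<And>w x. w \<in> weyl_group \<Phi> \<Longrightarrow> x \<in> M \<Longrightarrow> w x \<in> M"
  shows "alternant \<Phi> \<alpha> \<nu> * (\<Sum>\<mu>\<in>M. wexp \<mu>) = (\<Sum>\<mu>\<in>M. alternant \<Phi> \<alpha> (\<mu> + \<nu>))"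
proof -
  have M: "(\<Sum>\<mu>\<in>M. wexp (w \<nu>) * wexp \<mu>) = (\<Sum>\<mu>\<in>M. wexp (w (\<mu> + \<nu>)))"
    if w: "w \<in> weyl_group \<Phi>" for w
  proof -
    obtain v where v: "v \<in> weyl_group \<Phi>" "v \<circ> w = id" "w \<circ> v = id"
      using weyl_inverse[OF w] by blast
    have "(\<Sum>\<mu>\<in>M. wexp (w (\<mu> + \<nu>))) = (\<Sum>\<mu>\<in>M. wexp (w \<nu>) * wexp \<mu>)"
    proof (rule sum.reindex_bij_witness[of _ v w])
      fix \<mu>
      show "wexp (w \<nu>) * wexp (w \<mu>) = wexp (w (\<mu> + \<nu>))"
        using linear_add[OF weyl_linear[OF w]] by (simp add: wexp_add mult.commute)
      show "v (w \<mu>) = \<mu>" "w (v \<mu>) = \<mu>" using v(2,3) by (metis comp_apply id_apply)+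
    qed (use assms(2) v(1) w in blast)+
    then show ?thesis by simp
  qed
  have "alternant \<Phi> \<alpha> \<nu> * (\<Sum>\<mu>\<in>M. wexp \<mu>) =
      (\<Sum>w\<in>weyl_group \<Phi>. of_int (weyl_sign w) * (\<Sum>\<mu>\<in>M. wexp (w \<nu>) * wexp \<mu>))"
    unfolding alternant_altdef sum_distrib_right by (simp only: sum_distrib_left mult.assoc)
  also have "\<dots> = (\<Sum>w\<in>weyl_group \<Phi>. \<Sum>\<mu>\<in>M. of_int (weyl_sign w) * wexp (w (\<mu> + \<nu>)))"
    by (rule sum.cong[OF refl]) (simp only: M sum_distrib_left)
  also have "\<dots> = (\<Sum>\<mu>\<in>M. alternant \<Phi> \<alpha> (\<mu> + \<nu>))"
    unfolding alternant_altdef by (rule sum.swap)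
  finally show ?thesis .
qed

text \<open>Cauchy--Schwarz makes \<open>\<rho>\<close> the only maximiser of \<open>\<langle>\<cdot>, \<rho>\<rangle>\<close> on its orbit; hence leading
  coefficients with respect to this functional do not cancel.\<close>

lemma alternant_weyl_vector_cancel:
  assumes "alternant \<Phi> \<alpha> (weyl_vector \<alpha>) * f = 0"
  shows "f = 0"
proof (rule ccontr)
  let ?\<rho> = "weyl_vector \<alpha>"
  assume "f \<noteq> 0"
  then have "Poly_Mapping.keys f \<noteq> {}" by simp
  then obtain \<kappa> where \<kappa>: "\<kappa> \<in> Poly_Mapping.keys f"
    and max: "\<And>x. x \<in> Poly_Mapping.keys f \<Longrightarrow> x \<bullet> ?\<rho> \<le> \<kappa> \<bullet> ?\<rho>"
    using finite_keys[of f] obtains_MAX[of "Poly_Mapping.keys f" "\<lambda>x. x \<bullet> ?\<rho>"]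
    by (metis (no_types, lifting) Max_ge finite_imageI imageI)
  have "0 < ?\<rho> \<bullet> \<alpha> i" for i
    using inner_coroot_pos_iff[OF simple_nonzero, of ?\<rho>] weyl_vector_coroot by simp
  then have stab: "w = id" if "w \<in> weyl_group \<Phi>" "w ?\<rho> = ?\<rho>" for w
    using regular_stabilizer that by blast
  \<comment> \<open>In the coefficient of the product at \<open>?\<rho> + \<kappa>\<close>, this is
    the contribution of \<open>w\<close>. Were it nonzero, maximality of \<open>\<kappa>\<close>
    would give \<langle>\<rho>, \<rho>\<rangle> \<le> \<langle>w \<rho>, \<rho>\<rangle>, so
    \<open>w\<close> would fix \<rho>.\<close>
  have zero: "Poly_Mapping.lookup f (?\<rho> + \<kappa> - w ?\<rho>) = 0" if w: "w \<in> weyl_group \<Phi>" "w \<noteq> id" for w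
  proof (rule ccontr)
    assume "Poly_Mapping.lookup f (?\<rho> + \<kappa> - w ?\<rho>) \<noteq> 0"
    then have "?\<rho> + \<kappa> - w ?\<rho> \<in> Poly_Mapping.keys f" by (simp add: in_keys_iff)
    then have "?\<rho> \<bullet> ?\<rho> \<le> w ?\<rho> \<bullet> ?\<rho>"
      using max by (fastforce simp: inner_add_left inner_diff_left)
    moreover have "w ?\<rho> \<bullet> w ?\<rho> = ?\<rho> \<bullet> ?\<rho>" using weyl_inner w by blast
    ultimately have "(w ?\<rho> - ?\<rho>) \<bullet> (w ?\<rho> - ?\<rho>) \<le> 0"
      by (simp add: inner_diff_left inner_diff_right inner_commute)
    then have "w ?\<rho> = ?\<rho>" by (metis eq_iff_diff_eq_0 inner_eq_zero_iff inner_ge_zero order_antisym)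
    then show False using stab w by blast
  qed
  have "0 = Poly_Mapping.lookup (alternant \<Phi> \<alpha> ?\<rho> * f) (?\<rho> + \<kappa>)"
    by (simp add: assms)
  also have "\<dots> = (\<Sum>w\<in>weyl_group \<Phi>. weyl_sign w * Poly_Mapping.lookup f (?\<rho> + \<kappa> - w ?\<rho>))"
    unfolding alternant_altdef sum_distrib_right lookup_sum
    by (simp only: mult.assoc lookup_of_int_mult lookup_wexp_mult)
  also have "\<dots> = (\<Sum>w\<in>weyl_group \<Phi>. if w = id then Poly_Mapping.lookup f \<kappa> else 0)"
  proof (rule sum.cong[OF refl])
    fix w assume w: "w \<in> weyl_group \<Phi>"
    show "weyl_sign w * Poly_Mapping.lookup f (?\<rho> + \<kappa> - w ?\<rho>) =
        (if w = id then Poly_Mapping.lookup f \<kappa> else 0)"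
      by (cases "w = id") (simp_all add: zero[OF w] weyl_sign_id)
  qed
  also have "\<dots> = Poly_Mapping.lookup f \<kappa>"
    by (subst sum.delta[OF finite_weyl]) (simp only: weyl_id if_True)
  finally show False using \<kappa> by (simp add: in_keys_iff)
qed

lemma weyl_bialternant_eqI:
  assumes "f \<in> group_ring \<alpha>"
    and "alternant \<Phi> \<alpha> (weyl_vector \<alpha>) * f = alternant \<Phi> \<alpha> (\<mu> + weyl_vector \<alpha>)"
  shows "weyl_bialternant \<Phi> \<alpha> \<mu> = f"
  unfolding weyl_bialternant_def
proof (rule the_equality)
  fix g
  assume "g \<in> group_ring \<alpha> \<and>
    alternant \<Phi> \<alpha> (weyl_vector \<alpha>) * g = alternant \<Phi> \<alpha> (\<mu> + weyl_vector \<alpha>)"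
  then have "alternant \<Phi> \<alpha> (weyl_vector \<alpha>) * (g - f) = 0"
    using assms by (simp add: right_diff_distrib)
  then show "g = f" using alternant_weyl_vector_cancel by fastforce
qed (use assms in blast)

end

text \<open>The common ground of the two cases. Allowing larger pairings only for a simple root and
  its negative is what confines the exceptional alternants to \<open>- \<alpha> i\<close> and the
  longer monochromatic strings to those through weight 0.\<close>

locale small_weight = root_basis \<Phi> \<alpha>
  for \<Phi> :: "'a::euclidean_space set" and \<alpha> :: "'i::finite \<Rightarrow> 'a" +
  fixes lam :: 'a
  assumes lam: "lam \<in> dominant_weights \<alpha>"
    and lam_nonzero: "lam \<noteq> 0"
    and pairing: "\<mu> \<in> weyl_orbit \<Phi> lam \<Longrightarrow>
      \<mu> \<bullet> coroot (\<alpha> i) \<in> {-1, 0, 1} \<or> \<mu> = \<alpha> i \<or> \<mu> = - \<alpha> i"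
begin

abbreviation M :: "'a set" where
  "M \<equiv> weyl_orbit \<Phi> lam"

definition K :: "'i set" where
  "K = {i. \<alpha> i \<in> M}"

definition character :: "('a, int) poly_mapping" where
  "character = (\<Sum>\<mu>\<in>M. wexp \<mu>) + of_nat (card K) * wexp 0"

lemma lam_in_M: "lam \<in> M"
  by (rule weyl_orbit_self)

lemma M_nonzero: "\<mu> \<in> M \<Longrightarrow> \<mu> \<noteq> 0"
proof
  assume "\<mu> \<in> M" "\<mu> = 0"
  then obtain w where w: "w \<in> weyl_group \<Phi>" "w lam = 0" unfolding weyl_orbit_def by blast
  have "lam \<bullet> lam = w lam \<bullet> w lam" using weyl_inner[OF w(1)] by simp
  then show False using w lam_nonzero by simp
qed

lemma M_reflection: "\<mu> \<in> M \<Longrightarrow> reflection (\<alpha> i) \<mu> \<in> M"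
  by (rule weyl_orbit_reflection[OF _ simple_root])

lemma uminus_simple_in_M: "- \<alpha> i \<in> M \<longleftrightarrow> i \<in> K"
proof -
  have "reflection (\<alpha> i) (- \<alpha> i) = \<alpha> i"
    by (metis reflection_reflection reflection_self)
  then show ?thesis
    unfolding K_def using M_reflection[of "\<alpha> i" i] M_reflection[of "- \<alpha> i" i]
    by (auto simp: reflection_self)
qed

lemma simple_in_M: "\<alpha> i \<in> M \<longleftrightarrow> i \<in> K"
  by (simp add: K_def)

lemma M_weight_lattice: "\<mu> \<in> M \<Longrightarrow> \<mu> \<in> weight_lattice \<alpha>"
  unfolding weyl_orbit_def using weyl_weight_lattice dominant_weightsD lam by blast

text \<open>An orbit contains at most one dominant element, so some simple coroot is negative on
  \<open>\<mu>\<close>. The same dichotomy evaluates the alternants and, in the posets, provides a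
  step upward from every weight other than \<open>lam\<close>.\<close>

lemma not_dominant:
  assumes "\<mu> \<in> M" "\<mu> \<noteq> lam"
  obtains i where "\<mu> = - \<alpha> i" | i where "\<mu> \<bullet> coroot (\<alpha> i) = -1"
proof -
  have "\<not> dominant \<mu>" using dominant_in_orbit[OF dominant_weightsD(1)[OF lam]] assms by blast
  then obtain i where "\<mu> \<bullet> \<alpha> i < 0" by (auto simp: dominant_def not_le)
  then have neg: "\<mu> \<bullet> coroot (\<alpha> i) < 0" by (simp add: inner_coroot_neg_iff simple_nonzero)
  then have "\<mu> \<noteq> \<alpha> i" using inner_coroot_self[OF simple_nonzero, of i] by auto
  then show thesis using pairing[OF assms(1), of i] neg that by auto
qed

lemma sum_alternants:
  "(\<Sum>\<mu>\<in>M. alternant \<Phi> \<alpha> (\<mu> + weyl_vector \<alpha>)) =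
    alternant \<Phi> \<alpha> (lam + weyl_vector \<alpha>) - of_nat (card K) * alternant \<Phi> \<alpha> (weyl_vector \<alpha>)"
proof -
  let ?\<rho> = "weyl_vector \<alpha>"
  let ?N = "(\<lambda>i. - \<alpha> i) ` K"
  have lamN: "lam \<notin> ?N"
  proof
    assume "lam \<in> ?N"
    then obtain i where "lam = - \<alpha> i" by blast
    then have "lam \<bullet> \<alpha> i < 0" using simple_nonzero by simp
    then show False using dominant_weightsD(1)[OF lam] by (meson dominant_def not_le)
  qed
  have "alternant \<Phi> \<alpha> (\<mu> + ?\<rho>) = 0" if \<mu>: "\<mu> \<in> M - insert lam ?N" for \<mu>
  proof -
    have "\<mu> \<in> M" "\<mu> \<noteq> lam" using \<mu> by auto
    then show ?thesis
    proof (cases rule: not_dominant)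
      case (1 i)
      then show ?thesis using \<mu> uminus_simple_in_M by blast
    next
      \<comment> \<open>Here \<open>\<mu> + ?\<rho>\<close> pairs to -1 + 1 = 0 with the coroot of
        \<open>\<alpha> i\<close>: it lies on a wall.\<close>
      case (2 i)
      then show ?thesis
        by (intro alternant_eq_0[of _ i]) (simp add: inner_add_left weyl_vector_coroot)
    qed
  qed
  then have "(\<Sum>\<mu>\<in>M. alternant \<Phi> \<alpha> (\<mu> + ?\<rho>)) = (\<Sum>\<mu>\<in>insert lam ?N. alternant \<Phi> \<alpha> (\<mu> + ?\<rho>))"
    using lam_in_M uminus_simple_in_M by (intro sum.mono_neutral_right finite_orbit) auto
  also have "\<dots> = alternant \<Phi> \<alpha> (lam + ?\<rho>) + (\<Sum>\<mu>\<in>?N. alternant \<Phi> \<alpha> (\<mu> + ?\<rho>))"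
    using lamN by simp
  also have "(\<Sum>\<mu>\<in>?N. alternant \<Phi> \<alpha> (\<mu> + ?\<rho>)) = (\<Sum>i\<in>K. alternant \<Phi> \<alpha> (- \<alpha> i + ?\<rho>))"
    using inj_simple by (subst sum.reindex) (auto simp: inj_on_def)
  also have "\<dots> = (\<Sum>i\<in>K. - alternant \<Phi> \<alpha> ?\<rho>)"
  proof (rule sum.cong[OF refl])
    fix i
    have "- \<alpha> i + ?\<rho> = reflection (\<alpha> i) ?\<rho>"
      by (simp add: reflection_def weyl_vector_coroot)
    then show "alternant \<Phi> \<alpha> (- \<alpha> i + ?\<rho>) = - alternant \<Phi> \<alpha> ?\<rho>"
      by (simp add: alternant_simple_reflection)
  qed
  finally show ?thesis by simp
qed

lemma character_in_group_ring: "character \<in> group_ring \<alpha>"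
proof -
  have "x \<in> weight_lattice \<alpha>" if "Poly_Mapping.lookup character x \<noteq> 0" for x
  proof (cases "x = 0")
    case True
    then show ?thesis by (simp add: weight_lattice_iff)
  next
    case False
    then have "Poly_Mapping.lookup character x = (\<Sum>\<mu>\<in>M. if \<mu> = x then 1 else 0)"
      by (simp add: character_def wexp_0 lookup_add lookup_sum lookup_wexp lookup_of_nat)
    then show ?thesis using that M_weight_lattice by (auto simp: finite_orbit split: if_splits)
  qed
  then show ?thesis by (auto simp: group_ring_def in_keys_iff)
qed

lemma weyl_bialternant_eq: "weyl_bialternant \<Phi> \<alpha> lam = character"
proof (rule weyl_bialternant_eqI[OF character_in_group_ring])
  have invariant: "alternant \<Phi> \<alpha> (weyl_vector \<alpha>) * (\<Sum>\<mu>\<in>M. wexp \<mu>) =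
      (\<Sum>\<mu>\<in>M. alternant \<Phi> \<alpha> (\<mu> + weyl_vector \<alpha>))"
    by (rule alternant_mult_invariant, rule finite_orbit, rule weyl_orbit_image)
  show "alternant \<Phi> \<alpha> (weyl_vector \<alpha>) * character = alternant \<Phi> \<alpha> (lam + weyl_vector \<alpha>)"
    unfolding character_def distrib_left invariant
    by (simp add: character_def wexp_0 distrib_left sum_alternants mult.commute)
qed

end

section \<open>Quasi-minuscule weights are short roots\<close>

context root_basis
begin

text \<open>The definitions constrain \<open>lam\<close> against all roots, whereas
  \<open>small_weight\<close> asks about every orbit element against the simple roots. Moving both
  arguments by a group element that brings \<open>\<mu>\<close> back to \<open>x\<close> translates
  between the two.\<close>

lemma weyl_orbit_pairing:
  assumes "\<mu> \<in> weyl_orbit \<Phi> x" "\<beta> \<in> \<Phi>"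
  obtains w where "w \<in> weyl_group \<Phi>" "w \<beta> \<in> \<Phi>" "\<mu> \<bullet> coroot \<beta> = x \<bullet> coroot (w \<beta>)"
    "w \<mu> = x"
proof -
  obtain v where v: "v \<in> weyl_group \<Phi>" "\<mu> = v x"
    using assms(1) unfolding weyl_orbit_def by blast
  obtain w where w: "w \<in> weyl_group \<Phi>" "w \<circ> v = id" using weyl_inverse[OF v(1)] by blast
  have wv: "w \<mu> = x" using w(2) v(2) by (metis comp_apply id_apply)
  then have "\<mu> \<bullet> coroot \<beta> = x \<bullet> coroot (w \<beta>)"
    using inner_coroot_image[OF weyl_orthogonal[OF w(1)], of \<mu> \<beta>] by simp
  then show thesis using that w(1) weyl_root[OF w(1) assms(2)] wv by blast
qed

lemma weyl_orbit_inner_self: "\<mu> \<in> weyl_orbit \<Phi> x \<Longrightarrow> \<mu> \<bullet> \<mu> = x \<bullet> x"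
  unfolding weyl_orbit_def using weyl_inner by blast

lemma weyl_orbit_root: "\<beta> \<in> \<Phi> \<Longrightarrow> \<mu> \<in> weyl_orbit \<Phi> \<beta> \<Longrightarrow> \<mu> \<in> \<Phi>"
  unfolding weyl_orbit_def using weyl_root by blast

end

section \<open>Irreducibility and root lengths\<close>

locale irreducible_root_basis = root_basis +
  assumes irreducible: "irreducible_root_system \<Phi>"
begin

text \<open>Irreducibility as a closure principle: otherwise \<open>S\<close> and its complement
  would be an orthogonal decomposition of the roots.\<close>

lemma root_connected:
  assumes "S \<subseteq> \<Phi>" "S \<noteq> {}"
    and "\<And>x y. x \<in> S \<Longrightarrow> y \<in> \<Phi> \<Longrightarrow> x \<bullet> y \<noteq> 0 \<Longrightarrow> y \<in> S"
  shows "S = \<Phi>"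
proof (rule ccontr)
  assume "S \<noteq> \<Phi>"
  then have "\<exists>A B. A \<noteq> {} \<and> B \<noteq> {} \<and> A \<union> B = \<Phi> \<and> (\<forall>x\<in>A. \<forall>y\<in>B. x \<bullet> y = 0)"
    using assms by (intro exI[of _ S] exI[of _ "\<Phi> - S"]) auto
  then show False using irreducible unfolding irreducible_root_system_def by blast
qed

text \<open>The roots that are not orthogonal to the whole orbit are closed under non-orthogonality:
  if \<mu> meets x, x meets y and \<mu> is orthogonal to y, then the reflection of \<mu> in x meets
  y.\<close>

lemma orbit_not_orthogonal:
  assumes "\<beta> \<in> \<Phi>" "\<gamma> \<in> \<Phi>"
  obtains \<mu> where "\<mu> \<in> weyl_orbit \<Phi> \<beta>" "\<mu> \<bullet> \<gamma> \<noteq> 0"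
proof -
  let ?S = "{\<gamma> \<in> \<Phi>. \<exists>\<mu>\<in>weyl_orbit \<Phi> \<beta>. \<mu> \<bullet> \<gamma> \<noteq> 0}"
  have "?S = \<Phi>"
  proof (rule root_connected)
    show "?S \<noteq> {}" using assms(1) weyl_orbit_self root_nonzero[OF assms(1)] by force
    fix x y assume xy: "x \<in> ?S" "y \<in> \<Phi>" "x \<bullet> y \<noteq> 0"
    then obtain \<mu> where \<mu>: "\<mu> \<in> weyl_orbit \<Phi> \<beta>" "\<mu> \<bullet> x \<noteq> 0" "x \<in> \<Phi>" by blast
    show "y \<in> ?S"
    proof (cases "\<mu> \<bullet> y = 0")
      case True
      have "\<mu> \<bullet> coroot x \<noteq> 0" using \<mu> inner_coroot_eq_0_iff root_nonzero by blast
      then have "reflection x \<mu> \<bullet> y \<noteq> 0"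
        using True xy(3) by (simp add: reflection_def inner_diff_left)
      then show ?thesis using xy(2) weyl_orbit_reflection[OF \<mu>(1,3)] by blast
    qed (use \<mu> xy in blast)
  qed auto
  then show thesis using assms(2) that by blast
qed

text \<open>Let \<open>\<beta>\<close> be the root with \<open>\<langle>\<lambda>, \<beta>\<^sup>\<or>\<rangle> = 2\<close> and \<open>\<nu> = \<lambda> - \<beta>\<close>. Every root is orthogonal to
  \<open>\<beta>\<close> or to \<open>\<nu>\<close>, whereas in an irreducible root system two nonzero vectors always have a common
  non-orthogonal root; hence \<open>\<nu> = 0\<close>.\<close>

lemma quasi_minuscule_root:
  assumes "quasi_minuscule \<Phi> \<alpha> lam"
  shows "lam \<in> \<Phi>"
proof -
  obtain \<beta> where \<beta>: "\<beta> \<in> \<Phi>" "lam \<bullet> coroot \<beta> = 2"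
    and unique: "\<And>\<gamma>. \<gamma> \<in> \<Phi> \<Longrightarrow> lam \<bullet> coroot \<gamma> = 2 \<Longrightarrow> \<gamma> = \<beta>"
    using assms unfolding quasi_minuscule_def by blast
  have range: "lam \<bullet> coroot \<gamma> \<in> {-2, -1, 0, 1, 2}" if "\<gamma> \<in> \<Phi>" for \<gamma>
    using assms that unfolding quasi_minuscule_def by blast
  define \<nu> where "\<nu> = lam - \<beta>"
  have "\<nu> \<bullet> coroot \<beta> = 0"
    using \<beta> root_nonzero by (simp add: \<nu>_def inner_diff_left inner_coroot_self)
  then have \<nu>\<beta>: "\<nu> \<bullet> \<beta> = 0" using inner_coroot_eq_0_iff root_nonzero \<beta>(1) by blast
  \<comment> \<open>Write p for the pairing of \<open>lam\<close> with the coroot of \<gamma>. If p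
    = 0, the reflection in \<gamma> fixes \<open>lam\<close>, hence by uniqueness also \<beta>. If p
    is 2 or -2, then \<gamma> is \<beta> or its negative. If p is 1 or -1, the root reflected in
    \<beta> pairs to p - 2b with \<open>lam\<close>, and the bound 2 leaves only b = 0 or b = p, the
    latter meaning that \<nu> is orthogonal to \<gamma>.\<close>
  have split: "\<nu> \<bullet> \<gamma> = 0 \<or> \<beta> \<bullet> \<gamma> = 0" if \<gamma>: "\<gamma> \<in> \<Phi>" for \<gamma>
  proof -
    have nz: "\<gamma> \<noteq> 0" using root_nonzero \<gamma> by blast
    obtain b where b: "\<beta> \<bullet> coroot \<gamma> = of_int b"
      using integral[OF \<gamma> \<beta>(1)] by (auto elim: Ints_cases)
    consider "lam \<bullet> coroot \<gamma> = 0" | "lam \<bullet> coroot \<gamma> = 2" | "lam \<bullet> coroot \<gamma> = -2"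
      | "lam \<bullet> coroot \<gamma> \<in> {1, -1}"
      using range[OF \<gamma>] by auto
    then show ?thesis
    proof cases
      case 1
      then have "reflection \<gamma> lam = lam" by (simp add: reflection_def)
      then have "lam \<bullet> coroot (reflection \<gamma> \<beta>) = 2"
        using inner_coroot_image[OF orthogonal_reflection, of \<gamma> lam \<beta>] \<beta>(2) by simp
      then have "reflection \<gamma> \<beta> = \<beta>" using unique reflection_root[OF \<gamma> \<beta>(1)] by blast
      then have "\<beta> \<bullet> coroot \<gamma> = 0" using nz by (simp add: reflection_def)
      then show ?thesis using inner_coroot_eq_0_iff nz by blast
    next
      case 2
      then have "\<gamma> = \<beta>" using unique \<gamma> by blast
      then show ?thesis using \<nu>\<beta> by simp
    next
      case 3
      then have "lam \<bullet> coroot (- \<gamma>) = 2" by (simp add: coroot_uminus)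
      then have "- \<gamma> = \<beta>" using unique uminus_root[OF \<gamma>] by blast
      then have "\<gamma> = - \<beta>" by auto
      then show ?thesis using \<nu>\<beta> by simp
    next
      case 4
      have "lam \<bullet> coroot (reflection \<beta> \<gamma>) = reflection \<beta> lam \<bullet> coroot \<gamma>"
        using inner_coroot_image[OF orthogonal_reflection, of \<beta> "reflection \<beta> lam" \<gamma>]
        by (simp add: reflection_reflection)
      also have "\<dots> = lam \<bullet> coroot \<gamma> - 2 * of_int b"
        by (simp add: reflection_def \<beta>(2) inner_diff_left b)
      finally have "lam \<bullet> coroot \<gamma> - 2 * of_int b \<in> {-2, -1, 0, 1, 2}"
        using range[OF reflection_root[OF \<beta>(1) \<gamma>]] by simp
      then have "-2 \<le> lam \<bullet> coroot \<gamma> - 2 * of_int b" "lam \<bullet> coroot \<gamma> - 2 * of_int b \<le> 2" by auto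
      then have "b = 0 \<or> lam \<bullet> coroot \<gamma> = of_int b"
        using 4
      proof (elim insertE)
        assume *: "lam \<bullet> coroot \<gamma> = 1" "-2 \<le> lam \<bullet> coroot \<gamma> - 2 * of_int b"
          "lam \<bullet> coroot \<gamma> - 2 * of_int b \<le> 2"
        then have "-1 < real_of_int b" "real_of_int b < 2" by linarith+
        then have "b = 0 \<or> b = 1" by auto
        then show ?thesis using * by auto
      next
        assume *: "lam \<bullet> coroot \<gamma> = -1" "-2 \<le> lam \<bullet> coroot \<gamma> - 2 * of_int b"
          "lam \<bullet> coroot \<gamma> - 2 * of_int b \<le> 2"
        then have "-2 < real_of_int b" "real_of_int b < 1" by linarith+
        then have "b = 0 \<or> b = -1" by auto
        then show ?thesis using * by auto
      qed simp
      then have "\<beta> \<bullet> coroot \<gamma> = 0 \<or> \<nu> \<bullet> coroot \<gamma> = 0"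
        using b by (auto simp: \<nu>_def inner_diff_left)
      then show ?thesis using inner_coroot_eq_0_iff nz by blast
    qed
  qed
  have "\<nu> \<bullet> \<gamma> = 0" if "\<gamma> \<in> \<Phi>" for \<gamma>
  proof (rule ccontr)
    assume \<gamma>: "\<nu> \<bullet> \<gamma> \<noteq> 0"
    \<comment> \<open>The roots at distance at most two from \<nu> in the non-orthogonality graph. A
      path \<nu>, \<eta>, \<delta>, \<epsilon> without shortcuts is shortened by reflecting \<delta>
      in \<eta>: the result meets both \<nu> and \<epsilon>. So \<open>?D\<close> contains \<beta>,
      and a common neighbor of \<beta> and \<nu> contradicts \<open>split\<close>.\<close>
    let ?D = "{\<delta> \<in> \<Phi>. \<nu> \<bullet> \<delta> \<noteq> 0 \<or> (\<exists>\<gamma>\<in>\<Phi>. \<nu> \<bullet> \<gamma> \<noteq> 0 \<and> \<delta> \<bullet> \<gamma> \<noteq> 0)}"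
    have "?D = \<Phi>"
    proof (rule root_connected)
      show "?D \<noteq> {}" using \<gamma> that by blast
      fix \<delta> \<epsilon> assume \<delta>: "\<delta> \<in> ?D" and \<epsilon>: "\<epsilon> \<in> \<Phi>" "\<delta> \<bullet> \<epsilon> \<noteq> 0"
      show "\<epsilon> \<in> ?D"
      proof (cases "\<nu> \<bullet> \<delta> = 0")
        case False
        then show ?thesis using \<delta> \<epsilon> by (auto simp: inner_commute)
      next
        case True
        then obtain \<eta> where \<eta>: "\<eta> \<in> \<Phi>" "\<nu> \<bullet> \<eta> \<noteq> 0" "\<delta> \<bullet> \<eta> \<noteq> 0" using \<delta> by blast
        show ?thesis
        proof (cases "\<epsilon> \<bullet> \<eta> = 0")
          case orth: True
          have "\<delta> \<bullet> coroot \<eta> \<noteq> 0" using \<eta> inner_coroot_eq_0_iff root_nonzero by blast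
          then have "\<nu> \<bullet> reflection \<eta> \<delta> \<noteq> 0" "\<epsilon> \<bullet> reflection \<eta> \<delta> \<noteq> 0"
            using True \<eta> \<epsilon> orth by (simp_all add: reflection_def inner_diff_right inner_commute)
          moreover have "reflection \<eta> \<delta> \<in> \<Phi>" using reflection_root \<eta>(1) \<delta> by blast
          ultimately show ?thesis using \<epsilon>(1) by blast
        qed (use \<eta> \<epsilon> in blast)
      qed
    qed auto
    then have "\<beta> \<in> ?D" using \<beta>(1) by blast
    then show False using \<nu>\<beta> split by blast
  qed
  then have "\<nu> = 0" using simple_root by (intro eqI_simple) simp
  then show ?thesis using \<beta>(1) by (simp add: \<nu>_def)
qed

text \<open>As a root, \<open>lam\<close> pairs to 2 with its own coroot, so it is itself the unique
  root of the definition; this is transported along the orbit.\<close>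

lemma quasi_minuscule_pairing:
  assumes "quasi_minuscule \<Phi> \<alpha> lam" "\<mu> \<in> weyl_orbit \<Phi> lam" "\<beta> \<in> \<Phi>"
  shows "\<mu> \<bullet> coroot \<beta> \<in> {-1, 0, 1} \<or> \<mu> = \<beta> \<or> \<mu> = - \<beta>"
proof -
  have lam: "lam \<in> \<Phi>" by (rule quasi_minuscule_root[OF assms(1)])
  have unique: "\<gamma> = lam" if "\<gamma> \<in> \<Phi>" "lam \<bullet> coroot \<gamma> = 2" for \<gamma>
    using assms(1) that lam inner_coroot_self[OF root_nonzero[OF lam]]
    unfolding quasi_minuscule_def by blast
  obtain w where w: "w \<in> weyl_group \<Phi>" "w \<beta> \<in> \<Phi>" "\<mu> \<bullet> coroot \<beta> = lam \<bullet> coroot (w \<beta>)" "w \<mu> = lam"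
    using weyl_orbit_pairing[OF assms(2,3)] by blast
  have inj: "x = y" if "w x = w y" for x y
    using orthogonal_transformation_inj[OF weyl_orthogonal[OF w(1)]] that by (simp add: inj_eq)
  have neg: "w (- \<beta>) = - w \<beta>" using linear_neg[OF weyl_linear[OF w(1)]] by blast
  have "lam \<bullet> coroot (w \<beta>) \<in> {-2, -1, 0, 1, 2}"
    using assms(1) w(2) unfolding quasi_minuscule_def by blast
  moreover have "\<mu> = \<beta>" if "lam \<bullet> coroot (w \<beta>) = 2"
    using unique[OF w(2) that] w(4) inj by simp
  moreover have "\<mu> = - \<beta>" if "lam \<bullet> coroot (w \<beta>) = -2"
  proof -
    have "lam \<bullet> coroot (- w \<beta>) = 2" using that by (simp add: coroot_uminus)
    then have "w (- \<beta>) = w \<mu>" using unique uminus_root[OF w(2)] w(4) neg by metis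
    then show ?thesis using inj by blast
  qed
  ultimately show ?thesis using w(3) by auto
qed

text \<open>Take \<mu> in the orbit not orthogonal to \<gamma>. Unless \<mu> is \<gamma> or its
  negative, its pairing with the coroot of \<gamma> is 1 or -1, so 2 |\<langle>\<mu>,
  \<gamma>\<rangle>| = \<langle>\<gamma>, \<gamma>\<rangle>. The pairing of \<gamma> with the coroot
  of \<mu> is a nonzero integer, so \<langle>\<mu>, \<mu>\<rangle> is at most the same
  number.\<close>

lemma quasi_minuscule_orbit_short:
  assumes "quasi_minuscule \<Phi> \<alpha> lam" "\<gamma> \<in> \<Phi>"
  shows "lam \<bullet> lam \<le> \<gamma> \<bullet> \<gamma>"
proof -
  have lam: "lam \<in> \<Phi>" by (rule quasi_minuscule_root[OF assms(1)])
  obtain \<mu> where \<mu>: "\<mu> \<in> weyl_orbit \<Phi> lam" "\<mu> \<bullet> \<gamma> \<noteq> 0"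
    using orbit_not_orthogonal[OF lam assms(2)] by blast
  have root: "\<mu> \<in> \<Phi>" using weyl_orbit_root lam \<mu>(1) by blast
  have pos: "0 < \<mu> \<bullet> \<mu>" "0 < \<gamma> \<bullet> \<gamma>" using root assms(2) root_nonzero by auto
  have "\<mu> \<bullet> \<mu> \<le> \<gamma> \<bullet> \<gamma>"
  proof (cases "\<mu> = \<gamma> \<or> \<mu> = - \<gamma>")
    case False
    then have "\<mu> \<bullet> coroot \<gamma> = 1 \<or> \<mu> \<bullet> coroot \<gamma> = -1"
      using quasi_minuscule_pairing[OF assms(1) \<mu>(1) assms(2)] \<mu>(2)
        inner_coroot_eq_0_iff[OF root_nonzero[OF assms(2)], of \<mu>] by auto
    then have "2 * (\<mu> \<bullet> \<gamma>) = \<gamma> \<bullet> \<gamma> \<or> 2 * (\<mu> \<bullet> \<gamma>) = - (\<gamma> \<bullet> \<gamma>)"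
      using pos(2) by (auto simp: inner_coroot field_simps)
    then have eq: "2 * \<bar>\<mu> \<bullet> \<gamma>\<bar> = \<gamma> \<bullet> \<gamma>"
      using pos(2) by (elim disjE) linarith+
    obtain k where k: "\<gamma> \<bullet> coroot \<mu> = of_int k"
      using integral[OF root assms(2)] by (auto elim: Ints_cases)
    have "k \<noteq> 0"
      using k \<mu>(2) inner_coroot_eq_0_iff[OF root_nonzero[OF root], of \<gamma>] by (auto simp: inner_commute)
    then have "1 \<le> \<bar>\<gamma> \<bullet> coroot \<mu>\<bar>" unfolding k by linarith
    then show ?thesis
      using pos(1) eq by (simp add: inner_coroot abs_mult inner_commute field_simps)
  qed auto
  then show ?thesis using weyl_orbit_inner_self[OF \<mu>(1)] by simp
qed

text \<open>For a short \<beta>, equal length makes both pairings between \<beta> and a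
  non-orthogonal orbit element \<mu> the same number c. If c is 1 or -1, reflecting \<mu> in \<beta>
  and then in \<mu> yields -c times \<beta>; and the orbit, consisting of roots, is closed under
  negation.\<close>

lemma short_root_in_orbit_iff:
  assumes "quasi_minuscule \<Phi> \<alpha> lam" "\<beta> \<in> \<Phi>"
  shows "short_root \<Phi> \<beta> \<longleftrightarrow> \<beta> \<in> weyl_orbit \<Phi> lam"
proof
  assume "\<beta> \<in> weyl_orbit \<Phi> lam"
  then have "\<beta> \<bullet> \<beta> = lam \<bullet> lam" by (rule weyl_orbit_inner_self)
  then show "short_root \<Phi> \<beta>"
    using assms quasi_minuscule_orbit_short[OF assms(1)] by (simp add: short_root_def norm_eq_sqrt_inner)
next
  assume "short_root \<Phi> \<beta>"
  have lam: "lam \<in> \<Phi>" by (rule quasi_minuscule_root[OF assms(1)])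
  have "\<beta> \<bullet> \<beta> \<le> lam \<bullet> lam"
    using \<open>short_root \<Phi> \<beta>\<close> lam by (simp add: short_root_def norm_eq_sqrt_inner)
  then have len: "\<beta> \<bullet> \<beta> = lam \<bullet> lam"
    using quasi_minuscule_orbit_short[OF assms] by simp
  obtain \<mu> where \<mu>: "\<mu> \<in> weyl_orbit \<Phi> lam" "\<mu> \<bullet> \<beta> \<noteq> 0"
    using orbit_not_orthogonal[OF lam assms(2)] by blast
  have neg: "x \<in> weyl_orbit \<Phi> lam" if "- x \<in> weyl_orbit \<Phi> lam" for x
    using weyl_orbit_reflection[OF that weyl_orbit_root[OF lam that]] by (simp add: reflection_self)
  show "\<beta> \<in> weyl_orbit \<Phi> lam"
  proof (cases "\<mu> = \<beta> \<or> \<mu> = - \<beta>")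
    case True
    then show ?thesis using \<mu>(1) neg by blast
  next
    case False
    define c where "c = \<mu> \<bullet> coroot \<beta>"
    have c: "c = 1 \<or> c = -1"
      using quasi_minuscule_pairing[OF assms(1) \<mu>(1) assms(2)] False \<mu>(2)
        inner_coroot_eq_0_iff[OF root_nonzero[OF assms(2)], of \<mu>] by (auto simp: c_def)
    have c': "\<beta> \<bullet> coroot \<mu> = c"
      by (simp add: c_def inner_coroot inner_commute len weyl_orbit_inner_self[OF \<mu>(1)])
    have root: "\<mu> \<in> \<Phi>" using weyl_orbit_root lam \<mu>(1) by blast
    have "reflection \<beta> \<mu> = \<mu> - c *\<^sub>R \<beta>" by (simp add: reflection_def c_def)
    then have "reflection \<mu> (reflection \<beta> \<mu>) = - c *\<^sub>R \<beta>"
      using c inner_coroot_self[OF root_nonzero[OF root]] c'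
      by (auto simp: reflection_def inner_diff_left inner_add_left)
    then have "- c *\<^sub>R \<beta> \<in> weyl_orbit \<Phi> lam"
      using weyl_orbit_reflection \<mu>(1) root assms(2) by metis
    then show ?thesis using c neg by auto
  qed
qed

end

section \<open>Monochromatic components\<close>

lemma color_comp_self: "x \<in> color_comp R i x"
  by (simp add: color_comp_def)

lemma color_comp_step:
  "u \<in> color_comp R i x \<Longrightarrow> (u, i, v) \<in> edges R \<or> (v, i, u) \<in> edges R \<Longrightarrow> v \<in> color_comp R i x"
  unfolding color_comp_def color_rel_def by (auto intro: rtrancl_into_rtrancl)

lemma color_comp_eq:
  assumes "y \<in> color_comp R i x"
  shows "color_comp R i y = color_comp R i x"
proof -
  let ?E = "color_rel R i \<union> (color_rel R i)\<inverse>"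
  have "sym (?E\<^sup>*)" by (intro sym_rtrancl) (auto simp: sym_def)
  moreover have xy: "(x, y) \<in> ?E\<^sup>*" using assms by (simp add: color_comp_def)
  ultimately have yx: "(y, x) \<in> ?E\<^sup>*" by (rule symD)
  show ?thesis
    using rtrancl_trans[OF xy] rtrancl_trans[OF yx] unfolding color_comp_def by blast
qed

lemma color_comp_induct [consumes 1, case_names base step]:
  assumes "y \<in> color_comp R i x" "P x"
    and "\<And>u v. u \<in> color_comp R i x \<Longrightarrow> v \<in> color_comp R i x \<Longrightarrow> P u \<Longrightarrow>
      (u, i, v) \<in> edges R \<or> (v, i, u) \<in> edges R \<Longrightarrow> P v"
  shows "P y"
proof -
  have "(x, y) \<in> (color_rel R i \<union> (color_rel R i)\<inverse>)\<^sup>*"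
    using assms(1) by (simp add: color_comp_def)
  then show ?thesis
  proof (induction rule: rtrancl_induct)
    case (step u v)
    have u: "u \<in> color_comp R i x" using step(1) by (simp add: color_comp_def)
    have e: "(u, i, v) \<in> edges R \<or> (v, i, u) \<in> edges R"
      using step(2) by (auto simp: color_rel_def)
    show ?case using assms(3)[OF u color_comp_step[OF u e] step.IH e] .
  qed (rule assms(2))
qed

lemma color_comp_subset:
  assumes "edges R \<subseteq> verts R \<times> UNIV \<times> verts R" "x \<in> verts R"
  shows "color_comp R i x \<subseteq> verts R"
proof
  fix y assume "y \<in> color_comp R i x"
  then show "y \<in> verts R"
    using assms by (induction rule: color_comp_induct) auto
qed

lemma comp_edges_iff:
  "(u, v) \<in> comp_edges R i x \<longleftrightarrow>
    u \<in> color_comp R i x \<and> v \<in> color_comp R i x \<and> (u, i, v) \<in> edges R"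
  by (auto simp: comp_edges_def color_rel_def)

text \<open>Along a component two rank functions differ by a constant, and both attain 0 as their
  minimum. This makes the definite descriptions \<open>comp_rank\<close> and
  \<open>comp_length\<close> meaningful.\<close>

lemma comp_rank_function_unique:
  assumes \<rho>: "rank_function (color_comp R i x) (comp_edges R i x) \<rho> l"
    and \<rho>': "rank_function (color_comp R i x) (comp_edges R i x) \<rho>' l'"
  shows "l = l'" "y \<in> color_comp R i x \<Longrightarrow> \<rho> y = \<rho>' y"
proof -
  let ?C = "color_comp R i x"
  have diff: "int (\<rho> y) - int (\<rho>' y) = int (\<rho> x) - int (\<rho>' x)" if "y \<in> ?C" for y
    using that
  proof (induction rule: color_comp_induct)
    case (step u v)
    then have "(u, v) \<in> comp_edges R i x \<or> (v, u) \<in> comp_edges R i x"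
      by (auto simp: comp_edges_iff)
    then have "(\<rho> u + 1 = \<rho> v \<and> \<rho>' u + 1 = \<rho>' v) \<or> (\<rho> v + 1 = \<rho> u \<and> \<rho>' v + 1 = \<rho>' u)"
      using \<rho> \<rho>' unfolding rank_function_def by blast
    then show ?case using step.IH step.hyps by auto
  qed simp
  have im: "\<rho> ` ?C = {0..l}" "\<rho>' ` ?C = {0..l'}"
    using \<rho> \<rho>' by (simp_all add: rank_function_def)
  obtain a where a: "a \<in> ?C" "\<rho> a = 0"
    using im(1) by (metis atLeastAtMost_iff imageE le0)
  obtain b where b: "b \<in> ?C" "\<rho>' b = 0"
    using im(2) by (metis atLeastAtMost_iff imageE le0)
  have eq: "\<rho> y = \<rho>' y" if "y \<in> ?C" for y
    using diff[OF a(1)] diff[OF b(1)] diff[OF that] a(2) b(2) by linarith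
  then show "y \<in> ?C \<Longrightarrow> \<rho> y = \<rho>' y" .
  have "\<rho> ` ?C = \<rho>' ` ?C" using eq by (rule image_cong[OF refl])
  then show "l = l'" using im by simp
qed

section \<open>Component ranks in a graded graph\<close>

locale ranked_graph =
  fixes R :: "('v, 'i) colored_graph" and r :: "'v \<Rightarrow> nat"
  assumes finite_verts: "finite (verts R)"
    and edges_verts: "edges R \<subseteq> verts R \<times> UNIV \<times> verts R"
    and rank_step: "(s, i, t) \<in> edges R \<Longrightarrow> r t = r s + 1"
begin

text \<open>The global grading \<open>r\<close>, shifted by its minimum on the component, is the
  required rank function; only the absence of gaps needs an argument.\<close>

lemma comp_rank_function_exists:
  assumes "x \<in> verts R"
  obtains \<rho> l where "rank_function (color_comp R i x) (comp_edges R i x) \<rho> l"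
proof -
  let ?C = "color_comp R i x"
  have fin: "finite ?C"
    using color_comp_subset[OF edges_verts assms] finite_verts by (rule finite_subset)
  define m n where "m = Min (r ` ?C)" and "n = Max (r ` ?C)"
  have ne: "r ` ?C \<noteq> {}" using color_comp_self by fast
  obtain a where a: "a \<in> ?C" "r a = m"
    using Min_in[OF finite_imageI[OF fin] ne] unfolding m_def by (metis imageE)
  obtain b where b: "b \<in> ?C" "r b = n"
    using Max_in[OF finite_imageI[OF fin] ne] unfolding n_def by (metis imageE)
  have bounds: "m \<le> r y" "r y \<le> n" if "y \<in> ?C" for y
    using that fin by (simp_all add: m_def n_def)
  \<comment> \<open>Discrete intermediate values: on a path from the minimiser \<open>a\<close> each
    edge changes \<open>r\<close> by one, so no value is skipped.\<close>
  have ivl: "{m..r y} \<subseteq> r ` ?C" if "y \<in> color_comp R i a" for y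
    using that
  proof (induction rule: color_comp_induct)
    case base
    then show ?case using a by (simp add: image_iff) (metis a(2))
  next
    case (step u v)
    have v: "v \<in> ?C" using step color_comp_eq[OF a(1)] by simp
    have "r v = r u + 1 \<or> r u = r v + 1" using step.hyps rank_step by blast
    then have "{m..r v} \<subseteq> insert (r v) {m..r u}" by auto
    then show ?case using step v by blast
  qed
  have image: "r ` ?C = {m..n}"
    using ivl[of b] b bounds color_comp_eq[OF a(1)] by auto
  have "rank_function ?C (comp_edges R i x) (\<lambda>y. r y - m) (n - m)"
    unfolding rank_function_def
  proof (intro conjI)
    have "(\<lambda>y. r y - m) ` ?C = (\<lambda>k. k - m) ` (r ` ?C)" by (simp add: image_image)
    also have "\<dots> = {0..n - m}"
    proof -
      have "m \<le> n" using bounds[OF a(1)] by simp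
      then show ?thesis
        unfolding image by (auto simp: image_iff intro!: bexI[of _ "_ + m"])
    qed
    finally show "(\<lambda>y. r y - m) ` ?C = {0..n - m}" .
    show "\<forall>(s, t)\<in>comp_edges R i x. r s - m + 1 = r t - m"
      using rank_step bounds by (fastforce simp: comp_edges_iff)
  qed
  then show thesis by (rule that)
qed

lemma comp_rank_function:
  assumes "x \<in> verts R"
  obtains l where "rank_function (color_comp R i x) (comp_edges R i x) (comp_rank R i) l"
    and "\<And>y. y \<in> color_comp R i x \<Longrightarrow> comp_length R i y = l"
proof -
  obtain \<rho> l where \<rho>: "rank_function (color_comp R i x) (comp_edges R i x) \<rho> l"
    using comp_rank_function_exists[OF assms] .
  have same: "color_comp R i y = color_comp R i x" "comp_edges R i y = comp_edges R i x"
    if "y \<in> color_comp R i x" for y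
    using color_comp_eq[OF that] by (simp_all add: comp_edges_def)
  have rank: "comp_rank R i y = \<rho> y" if y: "y \<in> color_comp R i x" for y
    unfolding comp_rank_def same[OF y]
    by (rule the_equality) (use \<rho> comp_rank_function_unique(2)[OF _ \<rho> y] in blast)+
  have len: "comp_length R i y = l" if y: "y \<in> color_comp R i x" for y
    unfolding comp_length_def same[OF y]
    by (rule the_equality) (use \<rho> comp_rank_function_unique(1)[OF _ \<rho>] in blast)+
  have "rank_function (color_comp R i x) (comp_edges R i x) (comp_rank R i) l"
    using \<rho> rank unfolding rank_function_def by (auto simp: comp_edges_iff)
  then show thesis using len that by blast
qed

text \<open>The number m_i, which is the pairing of \<open>wt\<close> with the i-th simple coroot,
  kept as an integer.\<close>

definition imbalance :: "'i \<Rightarrow> 'v \<Rightarrow> int" where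
  "imbalance i x = 2 * int (comp_rank R i x) - int (comp_length R i x)"

lemma imbalance_step:
  assumes "(s, i, t) \<in> edges R"
  shows "imbalance i t = imbalance i s + 2"
proof -
  have s: "s \<in> verts R" using assms edges_verts by blast
  obtain l where l: "rank_function (color_comp R i s) (comp_edges R i s) (comp_rank R i) l"
    "\<And>y. y \<in> color_comp R i s \<Longrightarrow> comp_length R i y = l"
    using comp_rank_function[OF s] by blast
  have t: "t \<in> color_comp R i s"
    by (rule color_comp_step[OF color_comp_self]) (use assms in blast)
  then have "(s, t) \<in> comp_edges R i s" using assms color_comp_self by (simp add: comp_edges_iff)
  then show ?thesis
    using l(1) l(2)[OF t] l(2)[OF color_comp_self] unfolding rank_function_def imbalance_def by force
qed

lemma comp_extremes:
  assumes "x \<in> verts R"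
  obtains a b l where "a \<in> color_comp R i x" "b \<in> color_comp R i x"
    "imbalance i a = - int l" "imbalance i b = int l"
    "\<And>y. y \<in> color_comp R i x \<Longrightarrow> \<bar>imbalance i y\<bar> \<le> int l"
proof -
  obtain l where l: "rank_function (color_comp R i x) (comp_edges R i x) (comp_rank R i) l"
    "\<And>y. y \<in> color_comp R i x \<Longrightarrow> comp_length R i y = l"
    using comp_rank_function[OF assms] by blast
  have im: "comp_rank R i ` color_comp R i x = {0..l}" using l(1) by (simp add: rank_function_def)
  obtain a where a: "a \<in> color_comp R i x" "comp_rank R i a = 0"
    using im by (metis atLeastAtMost_iff imageE le0)
  obtain b where b: "b \<in> color_comp R i x" "comp_rank R i b = l"
    using im by (metis atLeastAtMost_iff imageE le0 le_refl)
  have "comp_rank R i y \<le> l" if "y \<in> color_comp R i x" for y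
    using im that by (metis atLeastAtMost_iff imageI)
  then have "\<bar>imbalance i y\<bar> \<le> int l" if "y \<in> color_comp R i x" for y
    using that l(2)[OF that] unfolding imbalance_def abs_le_iff by force
  moreover have "imbalance i a = - int l" "imbalance i b = int l"
    using a b l(2) by (simp_all add: imbalance_def)
  ultimately show thesis using that[OF a(1) b(1)] by blast
qed

text \<open>Along a component both \<open>p\<close> and the imbalance grow by 2 per edge, and the imbalance is
  normalised by its extreme values being opposite.\<close>

lemma imbalance_eqI:
  fixes p :: "'v \<Rightarrow> real"
  assumes "x \<in> verts R"
    and step: "\<And>s t. (s, i, t) \<in> edges R \<Longrightarrow> p t = p s + 2"
    and y: "y \<in> color_comp R i x" and z: "z \<in> color_comp R i x" and opp: "p y = - p z"
    and bounds: "\<And>u. u \<in> color_comp R i x \<Longrightarrow> p y \<le> p u \<and> p u \<le> p z"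
  shows "of_int (imbalance i x) = p x"
proof -
  obtain a b l where ab: "a \<in> color_comp R i x" "b \<in> color_comp R i x"
    "imbalance i a = - int l" "imbalance i b = int l"
    and l: "\<And>y. y \<in> color_comp R i x \<Longrightarrow> \<bar>imbalance i y\<bar> \<le> int l"
    using comp_extremes[OF assms(1)] by blast
  have const: "of_int (imbalance i u) - p u = of_int (imbalance i x) - p x"
    if "u \<in> color_comp R i x" for u
    using that
  proof (induction rule: color_comp_induct)
    case (step u v)
    then show ?case using assms(2) imbalance_step by fastforce
  qed simp
  have "real_of_int (imbalance i y) \<ge> - real l" "real_of_int (imbalance i z) \<le> real l"
    using l[OF y] l[OF z] by linarith+
  then show ?thesis
    using const[OF y] const[OF z] const[OF ab(1)] const[OF ab(2)] ab(3,4) opp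
      bounds[OF ab(1)] bounds[OF ab(2)]
    by simp
qed

text \<open>A vertex without edges of color \<open>i\<close> is its whole component, so the opposite
  extreme values coincide there.\<close>

lemma imbalance_nonzero_neighbor:
  assumes "x \<in> verts R" "imbalance i x \<noteq> 0"
  obtains y where "(x, i, y) \<in> edges R \<or> (y, i, x) \<in> edges R"
proof (rule ccontr)
  assume "\<not> thesis"
  then have no: "\<not> ((x, i, y) \<in> edges R \<or> (y, i, x) \<in> edges R)" for y using that by blast
  have "y = x" if "y \<in> color_comp R i x" for y
    using that by (induction rule: color_comp_induct) (use no in auto)
  then show False using comp_extremes[OF assms(1), of i] assms(2)
    by (metis add.inverse_inverse add.inverse_neutral equal_neg_zero)
qed

lemma rtrancl_rank: "(s, t) \<in> (edge_rel R)\<^sup>* \<Longrightarrow> s = t \<or> r s < r t"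
proof (induction rule: rtrancl_induct)
  case (step u v)
  then have "r v = r u + 1" using rank_step by (auto simp: edge_rel_def color_rel_def)
  then show ?case using step.IH by auto
qed simp

text \<open>Ranks grow strictly along paths, which gives antisymmetry, and by exactly one along an
  edge, which leaves no room for a vertex in between.\<close>

lemma colored_posetI:
  assumes "\<And>s t i j. (s, i, t) \<in> edges R \<Longrightarrow> (s, j, t) \<in> edges R \<Longrightarrow> i = j"
  shows "colored_poset R"
proof -
  have rank_edge: "r t = r s + 1" if "(s, t) \<in> edge_rel R" for s t
    using that rank_step by (auto simp: edge_rel_def color_rel_def)
  have "antisym ((edge_rel R)\<^sup>*)"
  proof (rule antisymI)
    fix s t assume "(s, t) \<in> (edge_rel R)\<^sup>*" "(t, s) \<in> (edge_rel R)\<^sup>*"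
    then show "s = t" using rtrancl_rank[of s t] rtrancl_rank[of t s] by auto
  qed
  moreover have "edge_rel R = cover_rel ((edge_rel R)\<^sup>*)"
  proof (intro equalityI subrelI)
    fix s t assume st: "(s, t) \<in> edge_rel R"
    have "\<not> (r s < r u \<and> r u < r t)" for u using rank_edge[OF st] by simp
    moreover have "s \<noteq> t" using rank_edge[OF st] by auto
    ultimately show "(s, t) \<in> cover_rel ((edge_rel R)\<^sup>*)"
      using st rtrancl_rank unfolding cover_rel_def by blast
  next
    fix s t assume "(s, t) \<in> cover_rel ((edge_rel R)\<^sup>*)"
    then have st: "(s, t) \<in> (edge_rel R)\<^sup>*" "s \<noteq> t"
      and no: "\<And>u. u \<noteq> s \<Longrightarrow> u \<noteq> t \<Longrightarrow> (s, u) \<in> (edge_rel R)\<^sup>* \<Longrightarrow> (u, t) \<notin> (edge_rel R)\<^sup>*"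
      unfolding cover_rel_def by blast+
    obtain u where u: "(s, u) \<in> edge_rel R" "(u, t) \<in> (edge_rel R)\<^sup>*"
      using st by (meson converse_rtranclE)
    have "u \<noteq> s" using rank_edge[OF u(1)] by auto
    then have "u = t" using no u by blast
    then show "(s, t) \<in> edge_rel R" using u(1) by simp
  qed
  ultimately show ?thesis
    unfolding colored_poset_def using finite_verts edges_verts assms by blast
qed

end

lemma (in root_basis) wt_coroot:
  "wt \<alpha> R x \<bullet> coroot (\<alpha> i) = of_int (2 * int (comp_rank R i x) - int (comp_length R i x))"
  unfolding wt_def by (rule inner_combination_coroot)

lemma poset_iso_sym:
  assumes "poset_iso R Q"
  shows "poset_iso Q R"
proof -
  obtain f where f: "bij_betw f (verts R) (verts Q)"
    "\<And>s t i. s \<in> verts R \<Longrightarrow> t \<in> verts R \<Longrightarrow> (s, i, t) \<in> edges R \<longleftrightarrow> (f s, i, f t) \<in> edges Q"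
    using assms unfolding poset_iso_def by blast
  let ?g = "inv_into (verts R) f"
  have "bij_betw ?g (verts Q) (verts R)" by (rule bij_betw_inv_into[OF f(1)])
  moreover have "(s, i, t) \<in> edges Q \<longleftrightarrow> (?g s, i, ?g t) \<in> edges R"
    if "s \<in> verts Q" "t \<in> verts Q" for s t i
    using f(2)[of "?g s" "?g t" i] bij_betw_inv_into_right[OF f(1)] that
      bij_betw_apply[OF calculation] by metis
  ultimately show ?thesis unfolding poset_iso_def by blast
qed

lemma finite_edges:
  fixes R :: "('v, 'i::finite) colored_graph"
  assumes "finite (verts R)" "edges R \<subseteq> verts R \<times> UNIV \<times> verts R"
  shows "finite (edges R)"
  using assms(2) by (rule finite_subset) (simp add: assms(1))

lemma poset_iso_card:
  fixes R Q :: "(_, 'i::finite) colored_graph"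
  assumes "poset_iso R Q" and fin: "finite (verts R)"
    and edges: "edges R \<subseteq> verts R \<times> UNIV \<times> verts R" "edges Q \<subseteq> verts Q \<times> UNIV \<times> verts Q"
  shows "card (verts R) = card (verts Q)" "card (edges R) = card (edges Q)"
proof -
  obtain f where f: "bij_betw f (verts R) (verts Q)"
    "\<And>s t i. s \<in> verts R \<Longrightarrow> t \<in> verts R \<Longrightarrow> (s, i, t) \<in> edges R \<longleftrightarrow> (f s, i, f t) \<in> edges Q"
    using assms unfolding poset_iso_def by blast
  show "card (verts R) = card (verts Q)" by (rule bij_betw_same_card[OF f(1)])
  have "bij_betw (\<lambda>(s, i, t). (f s, i, f t)) (edges R) (edges Q)"
    unfolding bij_betw_def
  proof
    show "inj_on (\<lambda>(s, i, t). (f s, i, f t)) (edges R)"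
      using edges(1) bij_betw_imp_inj_on[OF f(1)] unfolding inj_on_def by fast
    show "(\<lambda>(s, i, t). (f s, i, f t)) ` edges R = edges Q"
    proof (intro equalityI subsetI)
      fix e assume "e \<in> (\<lambda>(s, i, t). (f s, i, f t)) ` edges R"
      then show "e \<in> edges Q" using f(2) edges(1) by fast
    next
      fix e assume e: "e \<in> edges Q"
      obtain s i t where sit: "e = (s, i, t)" by (cases e)
      then have "s \<in> verts Q" "t \<in> verts Q" using e edges(2) by auto
      then obtain s' t' where "s' \<in> verts R" "f s' = s" "t' \<in> verts R" "f t' = t"
        using bij_betw_imp_surj_on[OF f(1)] by (metis imageE)
      then show "e \<in> (\<lambda>(s, i, t). (f s, i, f t)) ` edges R"
        using f(2)[of s' t' i] e sit by (intro image_eqI[of _ _ "(s', i, t')"]) auto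
    qed
  qed
  then show "card (edges R) = card (edges Q)" by (rule bij_betw_same_card)
qed

section \<open>The structure of splitting posets\<close>

lemma ranked_graph_of_poset:
  assumes "colored_poset R" "ranked R"
  obtains r where "ranked_graph R r"
proof -
  obtain r l where r: "rank_function (verts R) (edge_rel R) r l"
    using assms(2) unfolding ranked_def by blast
  have "ranked_graph R r"
  proof
    show "finite (verts R)" "edges R \<subseteq> verts R \<times> UNIV \<times> verts R"
      by (rule assms(1)[unfolded colored_poset_def, THEN conjunct1],
        rule assms(1)[unfolded colored_poset_def, THEN conjunct2, THEN conjunct1])
    fix s i t assume "(s, i, t) \<in> edges R"
    then have "(s, t) \<in> edge_rel R" by (auto simp: edge_rel_def color_rel_def)
    then show "r t = r s + 1" using r unfolding rank_function_def by fastforce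
  qed
  then show thesis by (rule that)
qed

text \<open>Meant for the heights of the weights in a poset, with \<open>m\<close> the height of
  \<open>lam\<close>. Heights of weights need not be integers, hence a real progression below
  \<open>m\<close>.\<close>

lemma finite_successor_closed:
  fixes S :: "real set"
  assumes "finite S" "m \<in> S" and succ: "\<And>h. h \<in> S \<Longrightarrow> h \<noteq> m \<Longrightarrow> h + 1 \<in> S"
  obtains N where "S = (\<lambda>k. m - real k) ` {0..N}"
proof -
  \<comment> \<open>The whole chain from \<open>h\<close> up to \<open>m\<close> is recorded, so
    that the lowest element alone yields the reverse inclusion.\<close>
  have below: "\<exists>k. h = m - real k \<and> (\<forall>j\<le>k. m - real j \<in> S)" if "h \<in> S" for h
    using that
  proof (induction "card {x \<in> S. h < x}" arbitrary: h rule: less_induct)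
    case less
    show ?case
    proof (cases "h = m")
      case True
      then show ?thesis using assms(2) by (intro exI[of _ 0]) simp
    next
      case False
      have h: "h + 1 \<in> S" using succ less.prems False by blast
      have "{x \<in> S. h + 1 < x} \<subset> {x \<in> S. h < x}" using h by force
      then have "card {x \<in> S. h + 1 < x} < card {x \<in> S. h < x}"
        using assms(1) by (intro psubset_card_mono) simp_all
      then obtain k where k: "h + 1 = m - real k" "\<forall>j\<le>k. m - real j \<in> S"
        using less.hyps h by blast
      have hk: "h = m - real (Suc k)" using k(1) by simp
      then have "\<forall>j\<le>Suc k. m - real j \<in> S" using k(2) less.prems by (auto simp: le_Suc_eq)
      then show ?thesis using hk by blast
    qed
  qed
  have "finite ((\<lambda>k. m - real k) -` S)"
    using assms(1) by (rule finite_vimageI) (simp add: inj_def)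
  moreover define N where "N = Max ((\<lambda>k. m - real k) -` S)"
  moreover have "0 \<in> (\<lambda>k. m - real k) -` S" using assms(2) by simp
  ultimately have "N \<in> (\<lambda>k. m - real k) -` S" and max: "\<And>k. m - real k \<in> S \<Longrightarrow> k \<le> N"
    using Max_in[of "(\<lambda>k. m - real k) -` S"] by (blast, simp add: Max_ge)
  then have N: "m - real N \<in> S" by simp
  have "S \<subseteq> (\<lambda>k. m - real k) ` {0..N}"
  proof
    fix h assume "h \<in> S"
    then obtain k where "h = m - real k" "m - real k \<in> S" using below by blast
    then show "h \<in> (\<lambda>k. m - real k) ` {0..N}" using max by auto
  qed
  moreover have "(\<lambda>k. m - real k) ` {0..N} \<subseteq> S"
    using below[OF N] by auto
  ultimately show thesis using that by blast
qed

text \<open>\<open>f\<close> plays the role of the weight. The axioms describe the splitting posets for the bialternant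
  of \<open>lam\<close>: the nonzero weights carry the same edges as in \<open>R(\<lambda>)\<close>, and for each \<open>i\<close> in \<open>K\<close> some
  vertex of weight \<open>0\<close> lies between \<open>- \<alpha> i\<close> and \<open>\<alpha> i\<close>, possibly several of them, and possibly
  one vertex for several \<open>i\<close>.\<close>

locale weight_model = small_weight \<Phi> \<alpha> lam
  for \<Phi> :: "'a::euclidean_space set" and \<alpha> :: "'i::finite \<Rightarrow> 'a" and lam :: 'a +
  fixes R :: "('v, 'i) colored_graph" and f :: "'v \<Rightarrow> 'a"
  assumes finite_vertices: "finite (verts R)"
    and edges_vertices: "edges R \<subseteq> verts R \<times> UNIV \<times> verts R"
    and edge_weight: "(s, i, t) \<in> edges R \<Longrightarrow> f s + \<alpha> i = f t"
    and weights_bij: "bij_betw f {v \<in> verts R. f v \<noteq> 0} M"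
    and card_zero: "card {v \<in> verts R. f v = 0} = card K"
    and nonzero_edge: "s \<in> verts R \<Longrightarrow> t \<in> verts R \<Longrightarrow> f s \<noteq> 0 \<Longrightarrow> f t \<noteq> 0 \<Longrightarrow>
      f s + \<alpha> i = f t \<Longrightarrow> (s, i, t) \<in> edges R"
    and middle: "i \<in> K \<Longrightarrow> \<exists>z\<in>verts R. f z = 0 \<and>
      (\<forall>s\<in>verts R. f s = - \<alpha> i \<longrightarrow> (s, i, z) \<in> edges R) \<and>
      (\<forall>t\<in>verts R. f t = \<alpha> i \<longrightarrow> (z, i, t) \<in> edges R)"
begin

lemma vertex_exists:
  assumes "\<mu> \<in> M"
  obtains v where "v \<in> verts R" "f v = \<mu>"
proof -
  have "\<mu> \<in> f ` {v \<in> verts R. f v \<noteq> 0}"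
    using assms by (simp only: bij_betw_imp_surj_on[OF weights_bij])
  then show thesis using that by blast
qed

lemma vertex_unique: "u \<in> verts R \<Longrightarrow> v \<in> verts R \<Longrightarrow> f u = f v \<Longrightarrow> f v \<noteq> 0 \<Longrightarrow> u = v"
  using bij_betw_imp_inj_on[OF weights_bij] by (auto simp: inj_on_def)

lemma weight_in_M: "v \<in> verts R \<Longrightarrow> f v \<noteq> 0 \<Longrightarrow> f v \<in> M"
  using bij_betw_apply[OF weights_bij] by simp

lemma edge_verts: "(s, i, t) \<in> edges R \<Longrightarrow> s \<in> verts R \<and> t \<in> verts R"
  using edges_vertices by blast

lemma edge_from_zero:
  assumes "(s, i, t) \<in> edges R" "f s = 0"
  shows "f t = \<alpha> i" "i \<in> K"
proof -
  show "f t = \<alpha> i" using edge_weight[OF assms(1)] assms(2) by simp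
  then show "i \<in> K" using weight_in_M edge_verts[OF assms(1)] simple_nonzero by (metis simple_in_M)
qed

lemma edge_to_zero:
  assumes "(s, i, t) \<in> edges R" "f t = 0"
  shows "f s = - \<alpha> i" "i \<in> K"
proof -
  show "f s = - \<alpha> i" using edge_weight[OF assms(1)] assms(2) by (simp add: eq_neg_iff_add_eq_0)
  then show "i \<in> K"
    using weight_in_M edge_verts[OF assms(1)] simple_nonzero uminus_simple_in_M
    by (metis neg_equal_0_iff_equal)
qed

lemma weights_image: "f ` verts R = M \<union> (if K = {} then {} else {0})"
proof -
  have "finite {v \<in> verts R. f v = 0}" using finite_vertices by simp
  then have "K = {} \<longleftrightarrow> {v \<in> verts R. f v = 0} = {}"
    using card_zero by (metis card_0_eq finite)
  moreover have "f ` verts R = f ` {v \<in> verts R. f v \<noteq> 0} \<union> f ` {v \<in> verts R. f v = 0}" by blast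
  ultimately show ?thesis using bij_betw_imp_surj_on[OF weights_bij] by auto
qed

text \<open>Height grows by one along each edge. Every weight except \<open>lam\<close> has another
  weight one higher: \<open>\<alpha> i\<close> above 0, 0 above \<open>- \<alpha> i\<close>, and
  \<open>\<mu> + \<alpha> i\<close> above a weight with pairing -1. So the heights have no
  gaps.\<close>

lemma height_ranking:
  obtains r N where "rank_function (verts R) (edge_rel R) r N"
    "ranked_graph R r"
proof -
  let ?S = "height ` f ` verts R"
  have "h + 1 \<in> ?S" if h: "h \<in> ?S" "h \<noteq> height lam" for h
  proof -
    obtain \<mu> where \<mu>: "\<mu> \<in> f ` verts R" "h = height \<mu>" using h(1) by blast
    have "\<exists>\<nu>\<in>f ` verts R. height \<nu> = height \<mu> + 1"
    proof (cases "\<mu> = 0")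
      case True
      then obtain i where "i \<in> K" using \<mu>(1) M_nonzero weights_image by (auto split: if_splits)
      then show ?thesis
        using True height_simple by (intro bexI[of _ "\<alpha> i"]) (auto simp: weights_image simple_in_M height_0)
    next
      case False
      then have "\<mu> \<in> M" using \<mu>(1) weights_image by (auto split: if_splits)
      moreover have "\<mu> \<noteq> lam" using h(2) \<mu>(2) by blast
      ultimately show ?thesis
      proof (cases rule: not_dominant)
        case (1 i)
        then have "K \<noteq> {}" using \<open>\<mu> \<in> M\<close> uminus_simple_in_M by blast
        then show ?thesis
          using 1 by (intro bexI[of _ 0]) (auto simp: weights_image height_0 height_minus height_simple)
      next
        case (2 i)
        then have "\<mu> + \<alpha> i \<in> M" using M_reflection[OF \<open>\<mu> \<in> M\<close>, of i] by (simp add: reflection_def)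
        then show ?thesis
          by (intro bexI[of _ "\<mu> + \<alpha> i"]) (auto simp: weights_image height_add height_simple)
      qed
    qed
    then show ?thesis using \<mu>(2) by (metis imageI)
  qed
  moreover have "height lam \<in> ?S" using weights_image lam_in_M by blast
  moreover have "finite ?S" using finite_vertices by blast
  ultimately obtain N where N: "?S = (\<lambda>k. height lam - real k) ` {0..N}"
    using finite_successor_closed[of ?S "height lam"] by metis
  \<comment> \<open>Height above the lowest weight; the floor is exact on the heights that
    occur.\<close>
  let ?\<rho> = "\<lambda>h. nat \<lfloor>h - (height lam - real N)\<rfloor>"
  have \<rho>: "?\<rho> (height lam - real k) = N - k" if "k \<le> N" for k
  proof -
    have "height lam - real k - (height lam - real N) = of_nat (N - k)" using that by simp
    then show ?thesis by (metis floor_of_nat nat_int)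
  qed
  have step: "?\<rho> (height (f t)) = ?\<rho> (height (f s)) + 1" if st: "(s, i, t) \<in> edges R" for s i t
  proof -
    have "height (f s) \<in> ?S" "height (f t) \<in> ?S" using edge_verts[OF st] by blast+
    then obtain k l where kl: "k \<le> N" "l \<le> N"
      "height (f s) = height lam - real k" "height (f t) = height lam - real l"
      unfolding N by auto
    moreover have "height (f t) = height (f s) + 1"
      using edge_weight[OF st, symmetric] by (simp add: height_add height_simple)
    ultimately have "k = l + 1" by linarith
    then show ?thesis using kl \<rho>[of k] \<rho>[of l] by simp
  qed
  have "(\<lambda>v. ?\<rho> (height (f v))) ` verts R = ?\<rho> ` ?S" by (simp add: image_image)
  also have "\<dots> = ?\<rho> ` (\<lambda>k. height lam - real k) ` {0..N}" by (simp only: N)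
  also have "\<dots> = (\<lambda>k. N - k) ` {0..N}"
    unfolding image_image by (rule image_cong[OF refl], rule \<rho>) simp
  also have "\<dots> = {0..N}"
  proof -
    have "n \<in> (\<lambda>k. N - k) ` {0..N}" if "n \<le> N" for n
      using that by (intro image_eqI[of _ _ "N - n"]) auto
    then show ?thesis by auto
  qed
  finally have "rank_function (verts R) (edge_rel R) (\<lambda>v. ?\<rho> (height (f v))) N"
    using step unfolding rank_function_def by (auto simp: edge_rel_def color_rel_def)
  moreover have "ranked_graph R (\<lambda>v. ?\<rho> (height (f v)))"
  proof
    show "?\<rho> (height (f t)) = ?\<rho> (height (f s)) + 1" if "(s, i, t) \<in> edges R" for s i t
      by (rule step[OF that])
  qed (rule finite_vertices, rule edges_vertices)
  ultimately show thesis by (rule that)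
qed

lemma weight_pairing:
  assumes "v \<in> verts R"
  shows "f v \<bullet> coroot (\<alpha> i) \<in> {-1, 0, 1} \<or> f v = \<alpha> i \<or> f v = - \<alpha> i"
proof (cases "f v = 0")
  case False
  then show ?thesis by (rule pairing[OF weight_in_M[OF assms]])
qed simp

lemma pairing_range:
  assumes "v \<in> verts R"
  shows "f v \<bullet> coroot (\<alpha> i) \<in> {-2, -1, 0, 1, 2}"
  using weight_pairing[OF assms, of i] inner_coroot_self[OF simple_nonzero, of i] by auto

lemma pairing_step:
  "(s, i, t) \<in> edges R \<Longrightarrow> f t \<bullet> coroot (\<alpha> i) = f s \<bullet> coroot (\<alpha> i) + 2"
  using edge_weight[of s i t] inner_coroot_self[OF simple_nonzero, of i]
  by (metis inner_add_left)

text \<open>Supplies the premises of \<open>imbalance_eqI\<close>. On a component the pairing with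
  the coroot of \<open>\<alpha> i\<close> runs between -2 and 2 if the component contains
  \<open>- \<alpha> i\<close> and \<open>\<alpha> i\<close>, between -1 and 1 if it has odd values,
  and is 0 on an isolated vertex.\<close>

lemma component_symmetric:
  assumes x: "x \<in> verts R"
  obtains y z where "y \<in> color_comp R i x" "z \<in> color_comp R i x"
    "f y \<bullet> coroot (\<alpha> i) = - (f z \<bullet> coroot (\<alpha> i))"
    "\<And>u. u \<in> color_comp R i x \<Longrightarrow>
      f y \<bullet> coroot (\<alpha> i) \<le> f u \<bullet> coroot (\<alpha> i) \<and> f u \<bullet> coroot (\<alpha> i) \<le> f z \<bullet> coroot (\<alpha> i)"
proof -
  let ?p = "\<lambda>u. f u \<bullet> coroot (\<alpha> i)"
  have self: "\<alpha> i \<bullet> coroot (\<alpha> i) = 2" by (rule inner_coroot_self[OF simple_nonzero])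
  have C: "color_comp R i x \<subseteq> verts R" by (rule color_comp_subset[OF edges_vertices x])
  show thesis
  \<comment> \<open>A vertex of weight 0 lies on a string through \<open>\<alpha> i\<close> only if
    an edge of color \<open>i\<close> meets it; otherwise it is a component by itself and belongs to
    the second case.\<close>
  proof (cases "f x = \<alpha> i \<or> f x = - \<alpha> i \<or> f x = 0 \<and> (\<exists>y. (x, i, y) \<in> edges R \<or> (y, i, x) \<in> edges R)")
    case True
    have "\<exists>w\<in>color_comp R i x. f w = \<alpha> i \<or> f w = - \<alpha> i"
    proof (cases "f x = 0")
      case False
      then show ?thesis using True color_comp_self[of x R i] by blast
    next
      case zero: True
      then obtain y where y: "(x, i, y) \<in> edges R \<or> (y, i, x) \<in> edges R"
        using True simple_nonzero[of i] by auto
      then have "y \<in> color_comp R i x" by (rule color_comp_step[OF color_comp_self])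
      then show ?thesis using y edge_from_zero edge_to_zero zero by blast
    qed
    then obtain w where w: "w \<in> color_comp R i x" "f w = \<alpha> i \<or> f w = - \<alpha> i" by blast
    have wV: "w \<in> verts R" using w(1) C by blast
    have "f w \<noteq> 0" using w(2) simple_nonzero[of i] by auto
    then have K: "i \<in> K" using w(2) weight_in_M[OF wV] simple_in_M uminus_simple_in_M by metis
    obtain a where a: "a \<in> verts R" "f a = - \<alpha> i" using vertex_exists K uminus_simple_in_M by blast
    obtain b where b: "b \<in> verts R" "f b = \<alpha> i" using vertex_exists K simple_in_M by blast
    obtain z where z: "(a, i, z) \<in> edges R" "(z, i, b) \<in> edges R" using middle[OF K] a b by blast
    have "w = a \<or> w = b"
      using vertex_unique[OF wV a(1)] vertex_unique[OF wV b(1)] w(2) a(2) b(2) simple_nonzero[of i] by auto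
    then have "a \<in> color_comp R i x \<and> b \<in> color_comp R i x"
    proof
      assume "w = a"
      then have "a \<in> color_comp R i x" using w(1) by simp
      moreover from this have "z \<in> color_comp R i x" by (rule color_comp_step) (use z in blast)
      then have "b \<in> color_comp R i x" by (rule color_comp_step) (use z in blast)
      ultimately show ?thesis by blast
    next
      assume "w = b"
      then have "b \<in> color_comp R i x" using w(1) by simp
      moreover from this have "z \<in> color_comp R i x" by (rule color_comp_step) (use z in blast)
      then have "a \<in> color_comp R i x" by (rule color_comp_step) (use z in blast)
      ultimately show ?thesis by blast
    qed
    moreover have "-2 \<le> ?p u \<and> ?p u \<le> 2" if "u \<in> color_comp R i x" for u
    proof -
      have "u \<in> verts R" using that C by blast
      then show ?thesis using pairing_range[of u i] by auto
    qed
    ultimately show thesis using that[of a b] a b self by simp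
  next
    case False
    then have cases: "?p x \<in> {-1, 0, 1}" using weight_pairing[OF x, of i] by blast
    then consider "?p x = 0" | "?p x = -1" | "?p x = 1" by auto
    then show thesis
    proof cases
      case 1
      have no: False if "(x, i, u) \<in> edges R \<or> (u, i, x) \<in> edges R" for u
      proof -
        have u: "u \<in> verts R" using that edge_verts by blast
        \<comment> \<open>A neighbor of \<open>x\<close> would have pairing 2 or -2, hence be
          \<open>\<alpha> i\<close> or \<open>- \<alpha> i\<close>, and \<open>x\<close> would have
          weight 0, which is the case already treated.\<close>
        have "?p u = 2 \<and> f x + \<alpha> i = f u \<or> ?p u = -2 \<and> f u + \<alpha> i = f x"
          using that pairing_step[of x i u] pairing_step[of u i x] edge_weight 1 by auto
        then have "f x = 0" using weight_pairing[OF u, of i] self by auto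
        then show False using that False by blast
      qed
      have single: "u = x" if "u \<in> color_comp R i x" for u
        using that by (induction rule: color_comp_induct) (use no in auto)
      show thesis
      proof (rule that[OF color_comp_self color_comp_self])
        show "?p x = - ?p x" using 1 by simp
        show "?p x \<le> ?p u \<and> ?p u \<le> ?p x" if "u \<in> color_comp R i x" for u
          using single[OF that] by simp
      qed
    next
      case 2
      have nz: "f x \<noteq> 0" using 2 by auto
      have "f x + \<alpha> i \<in> M"
        using M_reflection[OF weight_in_M[OF x nz], of i] 2 by (simp add: reflection_def)
      then obtain y where y: "y \<in> verts R" "f y = f x + \<alpha> i" using vertex_exists by metis
      then have "f y \<noteq> 0" using M_nonzero \<open>f x + \<alpha> i \<in> M\<close> by metis
      then have e: "(x, i, y) \<in> edges R" using nonzero_edge[OF x y(1) nz] y(2) by simp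
      have yC: "y \<in> color_comp R i x" by (rule color_comp_step[OF color_comp_self]) (use e in blast)
      have "?p u \<in> {-1, 1}" if "u \<in> color_comp R i x" for u
        using that
      proof (induction rule: color_comp_induct)
        case (step u v)
        then show ?case
          using pairing_range[of v i] C pairing_step[of u i v] pairing_step[of v i u] by auto
      qed (use 2 in simp)
      then show thesis using that[OF color_comp_self yC] 2 pairing_step[OF e] by fastforce
    next
      case 3
      have nz: "f x \<noteq> 0" using 3 by auto
      have "f x - \<alpha> i \<in> M"
        using M_reflection[OF weight_in_M[OF x nz], of i] 3 by (simp add: reflection_def)
      then obtain y where y: "y \<in> verts R" "f y = f x - \<alpha> i" using vertex_exists by metis
      then have "f y \<noteq> 0" using M_nonzero \<open>f x - \<alpha> i \<in> M\<close> by metis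
      then have e: "(y, i, x) \<in> edges R" using nonzero_edge[OF y(1) x] nz y(2) by simp
      have yC: "y \<in> color_comp R i x" by (rule color_comp_step[OF color_comp_self]) (use e in blast)
      have "?p u \<in> {-1, 1}" if "u \<in> color_comp R i x" for u
        using that
      proof (induction rule: color_comp_induct)
        case (step u v)
        then show ?case
          using pairing_range[of v i] C pairing_step[of u i v] pairing_step[of v i u] by auto
      qed (use 3 in simp)
      then show thesis using that[OF yC color_comp_self] 3 pairing_step[OF e] by fastforce
    qed
  qed
qed

lemma wt_eq:
  assumes "x \<in> verts R"
  shows "wt \<alpha> R x = f x"
proof (rule eqI_coroot)
  fix i
  obtain r N where "rank_function (verts R) (edge_rel R) r N" "ranked_graph R r"
    using height_ranking .
  then interpret ranked_graph R r by simp
  obtain y z where yz: "y \<in> color_comp R i x" "z \<in> color_comp R i x"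
    "f y \<bullet> coroot (\<alpha> i) = - (f z \<bullet> coroot (\<alpha> i))"
    "\<And>u. u \<in> color_comp R i x \<Longrightarrow>
      f y \<bullet> coroot (\<alpha> i) \<le> f u \<bullet> coroot (\<alpha> i) \<and> f u \<bullet> coroot (\<alpha> i) \<le> f z \<bullet> coroot (\<alpha> i)"
    using component_symmetric[OF assms] by blast
  have "of_int (imbalance i x) = f x \<bullet> coroot (\<alpha> i)"
    by (rule imbalance_eqI[where p = "\<lambda>u. f u \<bullet> coroot (\<alpha> i)", OF assms pairing_step yz])
  then show "wt \<alpha> R x \<bullet> coroot (\<alpha> i) = f x \<bullet> coroot (\<alpha> i)"
    by (simp only: wt_coroot imbalance_def)
qed

lemma splitting: "splitting_poset \<Phi> \<alpha> lam R"
proof -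
  obtain r N where r: "rank_function (verts R) (edge_rel R) r N" "ranked_graph R r"
    using height_ranking .
  interpret ranked_graph R r by (rule r(2))
  have "i = j" if "(s, i, t) \<in> edges R" "(s, j, t) \<in> edges R" for s t i j
    using edge_weight[OF that(1)] edge_weight[OF that(2)] inj_simple
    by (metis add_left_cancel injD)
  then have "colored_poset R" by (rule colored_posetI)
  moreover have "ranked R" using r(1) unfolding ranked_def by (intro exI)
  moreover have "wt \<alpha> R s + \<alpha> i = wt \<alpha> R t" if "(s, i, t) \<in> edges R" for s i t
    using edge_weight[OF that] edge_verts[OF that] wt_eq by simp
  moreover have "WGF \<alpha> R = character"
  proof -
    have "WGF \<alpha> R = (\<Sum>x\<in>verts R. wexp (f x))"
      unfolding WGF_def using wt_eq by simp
    also have "\<dots> = (\<Sum>x\<in>{x \<in> verts R. f x \<noteq> 0} \<union> {x \<in> verts R. f x = 0}. wexp (f x))"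
      by (rule sum.cong) auto
    also have "\<dots> = (\<Sum>x\<in>{x \<in> verts R. f x \<noteq> 0}. wexp (f x)) + (\<Sum>x\<in>{x \<in> verts R. f x = 0}. wexp (f x))"
      using finite_vertices by (intro sum.union_disjoint) auto
    also have "(\<Sum>x\<in>{x \<in> verts R. f x \<noteq> 0}. wexp (f x)) = (\<Sum>\<mu>\<in>M. wexp \<mu>)"
      by (rule sum.reindex_bij_betw[OF weights_bij])
    also have "(\<Sum>x\<in>{x \<in> verts R. f x = 0}. wexp (f x)) = of_nat (card K) * wexp 0"
      by (simp add: card_zero)
    finally show ?thesis by (simp add: character_def)
  qed
  ultimately show ?thesis
    unfolding splitting_poset_def structured_poset_def weyl_bialternant_eq by blast
qed

text \<open>Built from the orbit alone, without \<open>R\<close>, so it is the same set for all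
  models of \<open>lam\<close> and its size can be compared across them.\<close>

definition edge_weights :: "('a \<times> 'i \<times> 'a) set" where
  "edge_weights = {(\<mu>, i, \<nu>). \<mu> \<in> M \<and> \<nu> \<in> M \<and> \<mu> + \<alpha> i = \<nu>} \<union>
    (\<lambda>i. (- \<alpha> i, i, 0)) ` K \<union> (\<lambda>i. (0, i, \<alpha> i)) ` K"

lemma edge_weights_image: "(\<lambda>(s, i, t). (f s, i, f t)) ` edges R = edge_weights"
proof (intro equalityI subsetI)
  fix e assume "e \<in> (\<lambda>(s, i, t). (f s, i, f t)) ` edges R"
  then obtain s i t where e: "e = (f s, i, f t)" "(s, i, t) \<in> edges R" by auto
  show "e \<in> edge_weights"
  proof (cases "f s = 0 \<or> f t = 0")
    case True
    then show ?thesis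
      using e edge_from_zero[OF e(2)] edge_to_zero[OF e(2)] by (auto simp: edge_weights_def)
  next
    case False
    then show ?thesis
      using e edge_weight[OF e(2)] edge_verts[OF e(2)] weight_in_M by (auto simp: edge_weights_def)
  qed
next
  fix e assume "e \<in> edge_weights"
  then consider \<mu> i \<nu> where "e = (\<mu>, i, \<nu>)" "\<mu> \<in> M" "\<nu> \<in> M" "\<mu> + \<alpha> i = \<nu>"
    | i where "i \<in> K" "e = (- \<alpha> i, i, 0)" | i where "i \<in> K" "e = (0, i, \<alpha> i)"
    unfolding edge_weights_def by blast
  then show "e \<in> (\<lambda>(s, i, t). (f s, i, f t)) ` edges R"
  proof cases
    case 1
    obtain s where s: "s \<in> verts R" "f s = \<mu>" using vertex_exists[OF 1(2)] .
    obtain t where t: "t \<in> verts R" "f t = \<nu>" using vertex_exists[OF 1(3)] .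
    have "(s, i, t) \<in> edges R"
      using nonzero_edge[OF s(1) t(1)] s(2) t(2) 1(4) M_nonzero[OF 1(2)] M_nonzero[OF 1(3)] by simp
    then show ?thesis using s t 1(1) by (intro image_eqI[of _ _ "(s, i, t)"]) auto
  next
    case 2
    obtain s where s: "s \<in> verts R" "f s = - \<alpha> i" using vertex_exists uminus_simple_in_M 2(1) by blast
    obtain z where "f z = 0" "(s, i, z) \<in> edges R" using middle[OF 2(1)] s by blast
    then show ?thesis using s 2(2) by (intro image_eqI[of _ _ "(s, i, z)"]) auto
  next
    case 3
    obtain t where t: "t \<in> verts R" "f t = \<alpha> i" using vertex_exists simple_in_M 3(1) by blast
    obtain z where "f z = 0" "(z, i, t) \<in> edges R" using middle[OF 3(1)] t by blast
    then show ?thesis using t 3(2) by (intro image_eqI[of _ _ "(z, i, t)"]) auto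
  qed
qed

lemma card_edges_ge: "card edge_weights \<le> card (edges R)"
  unfolding edge_weights_image[symmetric]
  by (rule card_image_le) (rule finite_edges[OF finite_vertices edges_vertices])

lemma card_verts: "card (verts R) = card M + card K"
proof -
  have "card (verts R) = card ({v \<in> verts R. f v \<noteq> 0} \<union> {v \<in> verts R. f v = 0})"
    by (rule arg_cong[of _ _ card]) blast
  also have "\<dots> = card {v \<in> verts R. f v \<noteq> 0} + card {v \<in> verts R. f v = 0}"
    using finite_vertices by (intro card_Un_disjoint) auto
  finally show ?thesis using bij_betw_same_card[OF weights_bij] card_zero by simp
qed

text \<open>Equality in \<open>card_edges_ge\<close>; concretely, the edges of each color in
  \<open>K\<close> that touch weight 0 all pass through a single middle vertex.\<close>

definition tight :: bool where
  "tight \<longleftrightarrow> inj_on (\<lambda>(s, i, t). (f s, i, f t)) (edges R)"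

text \<open>From any nonzero weight \<open>not_dominant\<close> allows climbing to
  \<open>lam\<close>, possibly through a middle vertex, so that fewer and fewer orbit weights lie
  above. The premise excludes isolated vertices of weight 0, which a splitting poset may
  have.\<close>

lemma connected:
  assumes "\<And>z. z \<in> verts R \<Longrightarrow> f z = 0 \<Longrightarrow> \<exists>i y. (y, i, z) \<in> edges R \<or> (z, i, y) \<in> edges R"
  shows "connected_poset R"
proof -
  let ?E = "edge_rel R \<union> (edge_rel R)\<inverse>"
  have E: "(s, t) \<in> ?E" "(t, s) \<in> ?E" if "(s, i, t) \<in> edges R" for s i t
    using that by (auto simp: edge_rel_def color_rel_def)
  obtain c where c: "c \<in> verts R" "f c = lam" using vertex_exists[OF lam_in_M] .
  have main: "(x, c) \<in> ?E\<^sup>*" if "x \<in> verts R" "f x \<in> M" for x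
    using that
  proof (induction "card {\<mu> \<in> M. height (f x) < height \<mu>}" arbitrary: x rule: less_induct)
    case less
    have smaller: "card {\<mu> \<in> M. height \<nu> < height \<mu>} < card {\<mu> \<in> M. height (f x) < height \<mu>}"
      if "\<nu> \<in> M" "height (f x) < height \<nu>" for \<nu>
    proof (rule psubset_card_mono)
      show "finite {\<mu> \<in> M. height (f x) < height \<mu>}" by (simp add: finite_orbit)
      show "{\<mu> \<in> M. height \<nu> < height \<mu>} \<subset> {\<mu> \<in> M. height (f x) < height \<mu>}" using that by force
    qed
    show ?case
    proof (cases "f x = lam")
      case True
      then show ?thesis
        using vertex_unique[OF less.prems(1) c(1)] c(2) lam_nonzero by simp
    next
      case False
      with less.prems(2) show ?thesis
      proof (cases rule: not_dominant)
        case (1 i)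
        then have K: "i \<in> K" using less.prems(2) uminus_simple_in_M by metis
        obtain b where b: "b \<in> verts R" "f b = \<alpha> i" using vertex_exists K simple_in_M by blast
        obtain z where z: "(x, i, z) \<in> edges R" "(z, i, b) \<in> edges R"
          using middle[OF K] less.prems(1) 1 b by blast
        have "\<alpha> i \<in> M" using K simple_in_M by blast
        then have "(b, c) \<in> ?E\<^sup>*"
          using less.hyps[OF _ b(1)] smaller[of "\<alpha> i"] b(2) 1 by (simp add: height_minus height_simple)
        then show ?thesis using E(1)[OF z(1)] E(1)[OF z(2)] by (meson converse_rtrancl_into_rtrancl)
      next
        case (2 i)
        have \<nu>: "f x + \<alpha> i \<in> M"
          using M_reflection[OF less.prems(2), of i] 2 by (simp add: reflection_def)
        then obtain y where y: "y \<in> verts R" "f y = f x + \<alpha> i" using vertex_exists by metis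
        have "(x, i, y) \<in> edges R"
          using nonzero_edge[OF less.prems(1) y(1)] y(2) M_nonzero[OF \<nu>] M_nonzero[OF less.prems(2)] by simp
        moreover have "(y, c) \<in> ?E\<^sup>*"
          using less.hyps[OF _ y(1)] smaller[OF \<nu>] y(2) \<nu> by (simp add: height_add height_simple)
        ultimately show ?thesis using E(1) by (meson converse_rtrancl_into_rtrancl)
      qed
    qed
  qed
  have to_c: "(x, c) \<in> ?E\<^sup>*" if x: "x \<in> verts R" for x
  proof (cases "f x = 0")
    case False
    then show ?thesis using main x weight_in_M by blast
  next
    case True
    then obtain i y where y: "(y, i, x) \<in> edges R \<or> (x, i, y) \<in> edges R" using assms x by blast
    then have "f y \<noteq> 0"
      using edge_from_zero(1)[of x i y] edge_to_zero(1)[of y i x] True simple_nonzero[of i] by auto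
    then have "(y, c) \<in> ?E\<^sup>*" using main y edge_verts weight_in_M by blast
    then show ?thesis using y E by (meson converse_rtrancl_into_rtrancl)
  qed
  have "sym (?E\<^sup>*)" by (intro sym_rtrancl) (auto simp: sym_def)
  then show ?thesis
    unfolding connected_poset_def using to_c by (meson rtrancl_trans symD)
qed

end

section \<open>Weight models from splitting posets\<close>

context small_weight
begin

text \<open>The converse of \<open>weight_model.splitting\<close>. Comparing coefficients with
  \<open>character\<close> gives the multiplicities of the weights; the edges are then forced by the
  symmetric range of the imbalance on each component.\<close>

lemma splitting_poset_weight_model:
  assumes "splitting_poset \<Phi> \<alpha> lam R"
  shows "weight_model \<Phi> \<alpha> lam R (wt \<alpha> R)"
proof -
  let ?f = "wt \<alpha> R"
  have poset: "colored_poset R" "ranked R"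
    and weight_step: "\<And>s i t. (s, i, t) \<in> edges R \<Longrightarrow> ?f s + \<alpha> i = ?f t"
    and WGF: "WGF \<alpha> R = character"
    using assms unfolding splitting_poset_def structured_poset_def weyl_bialternant_eq by blast+
  obtain r where "ranked_graph R r" using ranked_graph_of_poset[OF poset] .
  then interpret ranked_graph R r .
  have wt_imbalance: "?f x \<bullet> coroot (\<alpha> i) = of_int (imbalance i x)" for x i
    by (simp only: wt_coroot imbalance_def)
  have self: "\<alpha> i \<bullet> coroot (\<alpha> i) = 2" for i by (rule inner_coroot_self[OF simple_nonzero])
  have count: "int (card {x \<in> verts R. ?f x = \<mu>}) =
      (if \<mu> \<in> M then 1 else 0) + (if \<mu> = 0 then int (card K) else 0)" for \<mu>
  proof -
    have "int (card {x \<in> verts R. ?f x = \<mu>}) = Poly_Mapping.lookup (WGF \<alpha> R) \<mu>"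
      using finite_verts by (simp add: WGF_def lookup_sum lookup_wexp sum.If_cases Int_def)
    also have "\<dots> = (if \<mu> \<in> M then 1 else 0) + (if \<mu> = 0 then int (card K) else 0)"
      by (simp add: WGF character_def wexp_0 lookup_add lookup_sum lookup_wexp lookup_of_nat
          finite_orbit when_def)
    finally show ?thesis .
  qed
  have one: "\<exists>x. {x \<in> verts R. ?f x = \<mu>} = {x}" if "\<mu> \<in> M" for \<mu>
  proof -
    have "card {x \<in> verts R. ?f x = \<mu>} = 1" using count[of \<mu>] that M_nonzero[OF that] by simp
    then show ?thesis by (rule card_1_singletonE) blast
  qed
  have inM: "?f x \<in> M" if "x \<in> verts R" "?f x \<noteq> 0" for x
  proof (rule ccontr)
    assume "?f x \<notin> M"
    then have "card {y \<in> verts R. ?f y = ?f x} = 0" using count[of "?f x"] that by simp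
    then show False using finite_verts that by auto
  qed
  have unique: "x = y" if "x \<in> verts R" "y \<in> verts R" "?f x = ?f y" "?f y \<noteq> 0" for x y
  proof -
    note xy = that
    obtain a where a: "{z \<in> verts R. ?f z = ?f y} = {a}" using one[OF inM[OF xy(2,4)]] by blast
    have "x \<in> {z \<in> verts R. ?f z = ?f y}" "y \<in> {z \<in> verts R. ?f z = ?f y}"
      using xy by simp_all
    then show ?thesis unfolding a by simp
  qed
  have exists: "\<exists>x\<in>verts R. ?f x = \<mu>" if "\<mu> \<in> M" for \<mu> using one[OF that] by blast
  have pair: "?f x \<bullet> coroot (\<alpha> i) \<in> {-1, 0, 1} \<or> ?f x = \<alpha> i \<or> ?f x = - \<alpha> i"
    if "x \<in> verts R" for x i
    using pairing[OF inM[OF that]] by fastforce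
  have verts: "s \<in> verts R" "t \<in> verts R" if "(s, i, t) \<in> edges R" for s i t
    using that edges_verts by blast+
  show ?thesis
  proof unfold_locales
    show "bij_betw ?f {v \<in> verts R. ?f v \<noteq> 0} M"
      unfolding bij_betw_def
    proof
      show "inj_on ?f {v \<in> verts R. ?f v \<noteq> 0}" using unique by (auto intro: inj_onI)
      show "?f ` {v \<in> verts R. ?f v \<noteq> 0} = M" using inM exists M_nonzero by blast
    qed
    have "0 \<notin> M" using M_nonzero by blast
    then show "card {v \<in> verts R. ?f v = 0} = card K" using count[of 0] by simp
  next
    fix s t i
    assume s: "s \<in> verts R" "?f s \<noteq> 0" and t: "t \<in> verts R" "?f t \<noteq> 0" and st: "?f s + \<alpha> i = ?f t"
    have pt: "?f t \<bullet> coroot (\<alpha> i) = ?f s \<bullet> coroot (\<alpha> i) + 2"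
      unfolding st[symmetric] by (simp add: inner_add_left self)
    \<comment> \<open>The pairing rises by 2 from \<open>s\<close> to \<open>t\<close>. From 0 it
      would reach 2, making \<open>t\<close> the weight \<open>\<alpha> i\<close> and
      \<open>s\<close> the weight 0; at -2 the vertex \<open>s\<close> would have weight
      \<open>- \<alpha> i\<close> and \<open>t\<close> weight 0.\<close>
    have "?f s \<bullet> coroot (\<alpha> i) = -1"
      using pair[OF s(1), of i] pair[OF t(1), of i] pt s(2) t(2) st self[of i] by auto
    then have "imbalance i s = -1" using wt_imbalance[of s i] by linarith
    \<comment> \<open>A neighbor below \<open>s\<close> would have pairing -3, so this one lies
      above; it has the weight of \<open>t\<close> and therefore is \<open>t\<close>.\<close>
    then obtain y where y: "(s, i, y) \<in> edges R \<or> (y, i, s) \<in> edges R"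
      using imbalance_nonzero_neighbor[OF s(1), of i] by auto
    have "(s, i, y) \<in> edges R"
    proof (rule ccontr)
      assume "(s, i, y) \<notin> edges R"
      then have ys: "(y, i, s) \<in> edges R" using y by blast
      then have "imbalance i y = -3" using imbalance_step[OF ys] \<open>imbalance i s = -1\<close> by simp
      then have "?f y \<bullet> coroot (\<alpha> i) = -3" using wt_imbalance[of y i] by simp
      then show False using pair[OF verts(1)[OF ys], of i] self[of i] by auto
    qed
    moreover have "y = t"
      using unique[OF verts(2)[OF calculation] t(1)] weight_step[OF calculation] st t(2) by simp
    ultimately show "(s, i, t) \<in> edges R" by simp
  next
    fix i assume "i \<in> K"
    obtain a where a: "a \<in> verts R" "?f a = - \<alpha> i" using exists uminus_simple_in_M \<open>i \<in> K\<close> by blast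
    obtain b where b: "b \<in> verts R" "?f b = \<alpha> i" using exists simple_in_M \<open>i \<in> K\<close> by blast
    have only: "x = a" if "x \<in> verts R" "?f x = - \<alpha> i" for x
      using unique[OF that(1) a(1)] that(2) a(2) simple_nonzero[of i] by simp
    have only': "x = b" if "x \<in> verts R" "?f x = \<alpha> i" for x
      using unique[OF that(1) b(1)] that(2) b(2) simple_nonzero[of i] by simp
    \<comment> \<open>Imbalance -2 forces a component of length at least 2, whose top has pairing at
      least 2. Only \<open>b\<close> has such a weight, so \<open>b\<close> lies in the component of
      \<open>a\<close>.\<close>
    have "imbalance i a = -2" using wt_imbalance[of a i] a(2) self[of i] by simp
    obtain a' b' l where ab: "a' \<in> color_comp R i a" "b' \<in> color_comp R i a"
      "imbalance i a' = - int l" "imbalance i b' = int l"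
      and l: "\<And>y. y \<in> color_comp R i a \<Longrightarrow> \<bar>imbalance i y\<bar> \<le> int l"
      using comp_extremes[OF a(1)] by blast
    have "2 \<le> l" using l[OF color_comp_self] \<open>imbalance i a = -2\<close> by simp
    have b': "b' \<in> verts R" using color_comp_subset[OF edges_verts a(1)] ab(2) by blast
    have "2 \<le> ?f b' \<bullet> coroot (\<alpha> i)" using wt_imbalance[of b' i] ab(4) \<open>2 \<le> l\<close> by simp
    then have "?f b' = \<alpha> i" using pair[OF b', of i] self[of i] by auto
    then have b_comp: "b \<in> color_comp R i a" using only'[OF b'] ab(2) by simp
    have "\<exists>z. (a, i, z) \<in> edges R \<and> (z, i, b) \<in> edges R"
    proof (rule ccontr)
      assume no: "\<nexists>z. (a, i, z) \<in> edges R \<and> (z, i, b) \<in> edges R"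
      \<comment> \<open>Invariant of a walk from \<open>a\<close>: if no middle vertex leads on to
        \<open>b\<close>, the walk never leaves \<open>a\<close> and the vertices of weight 0
        directly above it.\<close>
      have "b = a \<or> (a, i, b) \<in> edges R"
        using b_comp
      proof (induction rule: color_comp_induct)
        case (step u v)
        show ?case
        proof (cases "u = a")
          case True
          have "(v, i, a) \<notin> edges R"
          proof
            assume va: "(v, i, a) \<in> edges R"
            then have "?f v \<bullet> coroot (\<alpha> i) = -4"
              using imbalance_step[OF va] \<open>imbalance i a = -2\<close> wt_imbalance[of v i] by simp
            then show False using pair[OF verts(1)[OF va], of i] self[of i] by auto
          qed
          then show ?thesis using step.hyps True by blast
        next
          case False
          then have au: "(a, i, u) \<in> edges R" using step.IH by blast
          have zero: "?f u = 0" using weight_step[OF au] a(2) by simp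
          from step.hyps(3) show ?thesis
          proof
            assume uv: "(u, i, v) \<in> edges R"
            have "?f v = \<alpha> i" using weight_step[OF uv] zero by simp
            then have "v = b" using only' verts(2)[OF uv] by blast
            then show ?thesis using no au uv by blast
          next
            assume vu: "(v, i, u) \<in> edges R"
            have "?f v = - \<alpha> i"
              using weight_step[OF vu] zero
              by (simp add: eq_neg_iff_add_eq_0)
            then show ?thesis using only verts(1)[OF vu] by blast
          qed
        qed
      qed simp
      then show False
      proof
        assume "b = a"
        then have "2 *\<^sub>R \<alpha> i = 0" using a b by (simp add: scaleR_2 eq_neg_iff_add_eq_0)
        then show False using simple_nonzero[of i] by simp
      next
        assume "(a, i, b) \<in> edges R"
        then show False using weight_step a(2) b(2) simple_nonzero[of i] by fastforce
      qed
    qed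
    then obtain z where z: "(a, i, z) \<in> edges R" "(z, i, b) \<in> edges R" by blast
    show "\<exists>z\<in>verts R. ?f z = 0 \<and> (\<forall>s\<in>verts R. ?f s = - \<alpha> i \<longrightarrow> (s, i, z) \<in> edges R) \<and>
      (\<forall>t\<in>verts R. ?f t = \<alpha> i \<longrightarrow> (z, i, t) \<in> edges R)"
    proof (rule bexI[of _ z], intro conjI ballI impI)
      show "?f z = 0" using weight_step[OF z(1)] a(2) by simp
      show "z \<in> verts R" using verts(2)[OF z(1)] .
    qed (use z only only' in blast)+
  qed (use finite_verts edges_verts weight_step in blast)+
qed

end

section \<open>Edge-minimality and uniqueness\<close>

context weight_model
begin

text \<open>By counting edges: a splitting poset has at least as many edges as there are edge weights.\<close>

lemma tight_edge_minimal:
  assumes tight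
  shows "edge_minimal \<Phi> \<alpha> lam R"
  unfolding edge_minimal_def
proof (intro conjI notI splitting)
  assume "\<exists>(Q :: ('v, 'i) colored_graph) S. splitting_poset \<Phi> \<alpha> lam Q \<and> proper_subgraph S R \<and> poset_iso Q S"
  then obtain Q S :: "('v, 'i) colored_graph"
    where Q: "splitting_poset \<Phi> \<alpha> lam Q" and S: "proper_subgraph S R" and iso: "poset_iso Q S"
    by blast
  interpret Q: weight_model \<Phi> \<alpha> lam Q "wt \<alpha> Q" by (rule splitting_poset_weight_model[OF Q])
  have sub: "verts S \<subseteq> verts R" "edges S \<subseteq> edges R" "edges S \<subseteq> verts S \<times> UNIV \<times> verts S"
    using S unfolding proper_subgraph_def by blast+
  note card = poset_iso_card[OF iso Q.finite_vertices Q.edges_vertices sub(3)]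
  have "verts S = verts R"
    using card(1) card_verts Q.card_verts sub(1) finite_vertices by (metis card_subset_eq)
  then have "edges S \<subset> edges R" using S sub(2) unfolding proper_subgraph_def by blast
  then have "card (edges S) < card (edges R)"
    by (rule psubset_card_mono[OF finite_edges[OF finite_vertices edges_vertices]])
  also have "card (edges R) = card edge_weights"
    using assms card_image unfolding tight_def edge_weights_image[symmetric] by metis
  also have "\<dots> \<le> card (edges Q)" by (rule Q.card_edges_ge)
  finally show False using card(2) by simp
qed

lemma middle_choice:
  obtains z where "\<And>i. i \<in> K \<Longrightarrow> z i \<in> verts R" "\<And>i. i \<in> K \<Longrightarrow> f (z i) = 0"
    "\<And>i s. i \<in> K \<Longrightarrow> s \<in> verts R \<Longrightarrow> f s = - \<alpha> i \<Longrightarrow> (s, i, z i) \<in> edges R"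
    "\<And>i t. i \<in> K \<Longrightarrow> t \<in> verts R \<Longrightarrow> f t = \<alpha> i \<Longrightarrow> (z i, i, t) \<in> edges R"
proof -
  have "\<forall>i\<in>K. \<exists>z. z \<in> verts R \<and> f z = 0 \<and>
      (\<forall>s\<in>verts R. f s = - \<alpha> i \<longrightarrow> (s, i, z) \<in> edges R) \<and>
      (\<forall>t\<in>verts R. f t = \<alpha> i \<longrightarrow> (z, i, t) \<in> edges R)"
    using middle by blast
  then obtain z where "\<forall>i\<in>K. z i \<in> verts R \<and> f (z i) = 0 \<and>
      (\<forall>s\<in>verts R. f s = - \<alpha> i \<longrightarrow> (s, i, z i) \<in> edges R) \<and>
      (\<forall>t\<in>verts R. f t = \<alpha> i \<longrightarrow> (z i, i, t) \<in> edges R)"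
    by (rule bchoice[THEN exE])
  then show thesis by (intro that) blast+
qed

text \<open>Keeping one middle vertex per color leaves a splitting poset.\<close>

lemma edge_minimal_tight:
  assumes "edge_minimal \<Phi> \<alpha> lam R"
  shows tight
proof -
  obtain z where z: "\<And>i. i \<in> K \<Longrightarrow> z i \<in> verts R" "\<And>i. i \<in> K \<Longrightarrow> f (z i) = 0"
    "\<And>i s. i \<in> K \<Longrightarrow> s \<in> verts R \<Longrightarrow> f s = - \<alpha> i \<Longrightarrow> (s, i, z i) \<in> edges R"
    "\<And>i t. i \<in> K \<Longrightarrow> t \<in> verts R \<Longrightarrow> f t = \<alpha> i \<Longrightarrow> (z i, i, t) \<in> edges R"
    using middle_choice by blast
  define S :: "('v, 'i) colored_graph" where
    "S = \<lparr>verts = verts R, edges = {(s, i, t) \<in> edges R. (f s = 0 \<longrightarrow> s = z i) \<and> (f t = 0 \<longrightarrow> t = z i)}\<rparr>"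
  have S_iff: "(s, i, t) \<in> edges S \<longleftrightarrow>
      (s, i, t) \<in> edges R \<and> (f s = 0 \<longrightarrow> s = z i) \<and> (f t = 0 \<longrightarrow> t = z i)" for s i t
    by (simp add: S_def)
  have verts_S: "verts S = verts R" by (simp add: S_def)
  interpret S: weight_model \<Phi> \<alpha> lam S f
  proof
    show "finite (verts S)" unfolding verts_S by (rule finite_vertices)
    show "edges S \<subseteq> verts S \<times> UNIV \<times> verts S"
      unfolding verts_S using edges_vertices by (auto simp: S_def)
    show "bij_betw f {v \<in> verts S. f v \<noteq> 0} M" unfolding verts_S by (rule weights_bij)
    show "card {v \<in> verts S. f v = 0} = card K" unfolding verts_S by (rule card_zero)
    show "f s + \<alpha> i = f t" if "(s, i, t) \<in> edges S" for s i t
      using that edge_weight by (simp add: S_iff)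
    show "(s, i, t) \<in> edges S"
      if "s \<in> verts S" "t \<in> verts S" "f s \<noteq> 0" "f t \<noteq> 0" "f s + \<alpha> i = f t" for s i t
      using that nonzero_edge by (simp add: S_iff verts_S)
    fix i assume i: "i \<in> K"
    show "\<exists>z\<in>verts S. f z = 0 \<and> (\<forall>s\<in>verts S. f s = - \<alpha> i \<longrightarrow> (s, i, z) \<in> edges S) \<and>
        (\<forall>t\<in>verts S. f t = \<alpha> i \<longrightarrow> (z, i, t) \<in> edges S)"
      using z i simple_nonzero[of i] by (intro bexI[of _ "z i"]) (auto simp: S_iff verts_S)
  qed
  \<comment> \<open>\<open>S\<close> is a splitting poset isomorphic to itself, so it plays both
    roles in the definition of edge-minimality and cannot be proper.\<close>
  have "\<not> proper_subgraph S R"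
  proof
    assume "proper_subgraph S R"
    moreover have "poset_iso S S" unfolding poset_iso_def by (intro exI[of _ id] conjI) simp_all
    ultimately show False using assms S.splitting unfolding edge_minimal_def by blast
  qed
  then have "edges S = edges R"
    using S.edges_vertices verts_S S_iff unfolding proper_subgraph_def by auto
  then have zero: "s = z i" if "(s, i, t) \<in> edges R \<or> (t, i, s) \<in> edges R" "f s = 0" for s i t
    using S_iff that by blast
  show ?thesis
    unfolding tight_def
  proof (rule inj_onI)
    fix d d'
    assume d: "d \<in> edges R" "d' \<in> edges R"
      "(\<lambda>(s, i, t). (f s, i, f t)) d = (\<lambda>(s, i, t). (f s, i, f t)) d'"
    obtain s i t where sit: "d = (s, i, t)" by (cases d)
    obtain s' t' where sit': "d' = (s', i, t')" using d(3) sit by (cases d') auto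
    have e: "(s, i, t) \<in> edges R" "(s', i, t') \<in> edges R" and eq: "f s = f s'" "f t = f t'"
      using d sit sit' by simp_all
    have "s = s'"
      using zero[of s i t] zero[of s' i t'] vertex_unique[of s s'] edge_verts[OF e(1)] edge_verts[OF e(2)] e eq
      by (cases "f s = 0") auto
    moreover have "t = t'"
      using zero[of t i s] zero[of t' i s'] vertex_unique[of t t'] edge_verts[OF e(1)] edge_verts[OF e(2)] e eq
      by (cases "f t = 0") auto
    ultimately show "d = d'" using sit sit' by simp
  qed
qed

lemma tightD:
  assumes tight "(s, i, t) \<in> edges R" "(s', i, t') \<in> edges R" "f s = f s'" "f t = f t'"
  shows "s = s'" "t = t'"
  using inj_onD[OF assms(1)[unfolded tight_def] _ assms(2,3)] assms(4,5) by auto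

end

lemma edges_minuscule_poset: "(s, i, t) \<in> edges (minuscule_poset \<Phi> \<alpha> lam) \<longleftrightarrow>
    s \<in> weyl_orbit \<Phi> lam \<and> t \<in> weyl_orbit \<Phi> lam \<and> s + \<alpha> i = t"
  by (simp add: minuscule_poset_def)

lemma edges_quasi_minuscule_poset:
  "(Inl \<mu>, i, Inl \<nu>) \<in> edges (quasi_minuscule_poset \<Phi> \<alpha> lam) \<longleftrightarrow>
    \<mu> \<in> weyl_orbit \<Phi> lam \<and> \<nu> \<in> weyl_orbit \<Phi> lam \<and> \<mu> + \<alpha> i = \<nu>"
  "(Inl \<mu>, i, Inr j) \<in> edges (quasi_minuscule_poset \<Phi> \<alpha> lam) \<longleftrightarrow>
    short_root \<Phi> (\<alpha> i) \<and> \<mu> = - \<alpha> i \<and> j = i"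
  "(Inr j, i, Inl \<mu>) \<in> edges (quasi_minuscule_poset \<Phi> \<alpha> lam) \<longleftrightarrow>
    short_root \<Phi> (\<alpha> i) \<and> \<mu> = \<alpha> i \<and> j = i"
  "(Inr j, i, Inr k) \<notin> edges (quasi_minuscule_poset \<Phi> \<alpha> lam)"
  by (auto simp: quasi_minuscule_poset_def)

context weight_model
begin

text \<open>Without vertices of weight 0 the weight map itself is the isomorphism.\<close>

lemma iso_minuscule_poset:
  assumes "K = {}"
  shows "poset_iso R (minuscule_poset \<Phi> \<alpha> lam)"
proof -
  have "finite {v \<in> verts R. f v = 0}" using finite_vertices by simp
  then have zero: "{v \<in> verts R. f v = 0} = {}" using card_zero assms by simp
  have "bij_betw f (verts R) M"
  proof -
    have "{v \<in> verts R. f v \<noteq> 0} = verts R" using zero by blast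
    then show ?thesis using weights_bij by simp
  qed
  moreover have "(s, i, t) \<in> edges R \<longleftrightarrow> (f s, i, f t) \<in> edges (minuscule_poset \<Phi> \<alpha> lam)"
    if "s \<in> verts R" "t \<in> verts R" for s t i
  proof -
    have nz: "f s \<noteq> 0" "f t \<noteq> 0" using zero that by blast+
    show ?thesis
      using edge_weight[of s i t] nonzero_edge[OF that nz] weight_in_M that nz
      unfolding edges_minuscule_poset by blast
  qed
  ultimately show ?thesis
    unfolding poset_iso_def by (intro exI[of _ f]) (simp add: minuscule_poset_def)
qed

lemma iso_quasi_minuscule_poset:
  assumes tight: tight and connected: "connected_poset R"
    and short: "\<And>i. short_root \<Phi> (\<alpha> i) \<longleftrightarrow> i \<in> K"
  shows "poset_iso R (quasi_minuscule_poset \<Phi> \<alpha> lam)"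
\<comment> \<open>The map is built from the explicit poset to \<open>R\<close>, because the middle
  vertices come as a function of the color.\<close>
proof (rule poset_iso_sym)
  let ?P = "quasi_minuscule_poset \<Phi> \<alpha> lam"
  let ?Z = "{v \<in> verts R. f v = 0}"
  let ?N = "{v \<in> verts R. f v \<noteq> 0}"
  obtain z where z: "\<And>i. i \<in> K \<Longrightarrow> z i \<in> verts R" "\<And>i. i \<in> K \<Longrightarrow> f (z i) = 0"
    "\<And>i s. i \<in> K \<Longrightarrow> s \<in> verts R \<Longrightarrow> f s = - \<alpha> i \<Longrightarrow> (s, i, z i) \<in> edges R"
    "\<And>i t. i \<in> K \<Longrightarrow> t \<in> verts R \<Longrightarrow> f t = \<alpha> i \<Longrightarrow> (z i, i, t) \<in> edges R"
    using middle_choice by blast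
  have to_zero: "x = z i" if "(s, i, x) \<in> edges R" "f x = 0" for s i x
  proof -
    have i: "i \<in> K" "f s = - \<alpha> i" using edge_to_zero[OF that] by auto
    then have "(s, i, z i) \<in> edges R" using z(3) edge_verts[OF that(1)] by blast
    then show ?thesis using tightD(2)[OF tight that(1)] z(2)[OF i(1)] that(2) by simp
  qed
  have from_zero: "x = z i" if "(x, i, t) \<in> edges R" "f x = 0" for t i x
  proof -
    have i: "i \<in> K" "f t = \<alpha> i" using edge_from_zero[OF that] by auto
    then have "(z i, i, t) \<in> edges R" using z(4) edge_verts[OF that(1)] by blast
    then show ?thesis using tightD(1)[OF tight that(1)] z(2)[OF i(1)] that(2) by simp
  qed
  \<comment> \<open>By connectedness each vertex of weight 0 meets an edge; tightness makes it the
    middle vertex of that edge's color. As \<open>K\<close> and \<open>?Z\<close> have the same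
    size, \<open>z\<close> is then also injective.\<close>
  have "?Z \<subseteq> z ` K"
  proof
    fix x assume x: "x \<in> ?Z"
    obtain c where c: "c \<in> verts R" "f c = lam" using vertex_exists[OF lam_in_M] .
    have "(x, c) \<in> (edge_rel R \<union> (edge_rel R)\<inverse>)\<^sup>*"
      using connected x c(1) unfolding connected_poset_def by blast
    moreover have "x \<noteq> c" using x c(2) lam_nonzero by auto
    ultimately obtain y where "(x, y) \<in> edge_rel R \<union> (edge_rel R)\<inverse>"
      by (meson converse_rtranclE)
    then obtain i where i: "(x, i, y) \<in> edges R \<or> (y, i, x) \<in> edges R"
      by (auto simp: edge_rel_def color_rel_def)
    then have "i \<in> K" using edge_from_zero(2) edge_to_zero(2) x by blast
    moreover have "x = z i" using i from_zero to_zero x by blast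
    ultimately show "x \<in> z ` K" by blast
  qed
  then have Z: "z ` K = ?Z" using z(1,2) by blast
  then have inj_z: "inj_on z K" using card_zero by (intro eq_card_imp_inj_on) simp_all
  define v where "v = inv_into ?N f"
  have v: "bij_betw v M ?N" unfolding v_def by (rule bij_betw_inv_into[OF weights_bij])
  have fv: "f (v \<mu>) = \<mu>" if "\<mu> \<in> M" for \<mu>
    unfolding v_def by (rule bij_betw_inv_into_right[OF weights_bij that])
  have vV: "v \<mu> \<in> verts R" if "\<mu> \<in> M" for \<mu> using bij_betw_apply[OF v that] by blast
  let ?g = "case_sum v z"
  have P: "verts ?P = Inl ` M \<union> Inr ` K" by (simp add: quasi_minuscule_poset_def short)
  have "bij_betw ?g (verts ?P) (verts R)"
  proof -
    have "bij_betw ?g (Inl ` M) ?N"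
      using v by (auto simp: bij_betw_def inj_on_def image_image)
    moreover have "bij_betw ?g (Inr ` K) ?Z"
      using inj_z Z by (auto simp: bij_betw_def inj_on_def image_image)
    moreover have "?N \<inter> ?Z = {}" by blast
    ultimately have "bij_betw ?g (Inl ` M \<union> Inr ` K) (?N \<union> ?Z)" by (rule bij_betw_combine)
    moreover have "?N \<union> ?Z = verts R" by blast
    ultimately show ?thesis by (simp only: P)
  qed
  moreover have "(s, i, t) \<in> edges ?P \<longleftrightarrow> (?g s, i, ?g t) \<in> edges R"
    if st: "s \<in> verts ?P" "t \<in> verts ?P" for s t i
  proof -
    consider \<mu> \<nu> where "s = Inl \<mu>" "t = Inl \<nu>" "\<mu> \<in> M" "\<nu> \<in> M"
      | \<mu> j where "s = Inl \<mu>" "t = Inr j" "\<mu> \<in> M" "j \<in> K"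
      | \<nu> j where "s = Inr j" "t = Inl \<nu>" "\<nu> \<in> M" "j \<in> K"
      | j k where "s = Inr j" "t = Inr k" "j \<in> K" "k \<in> K"
      using st unfolding P by blast
    then show ?thesis
    proof cases
      case 1
      then show ?thesis
        using edge_weight[of "v \<mu>" i "v \<nu>"] nonzero_edge[of "v \<mu>" "v \<nu>" i] fv vV M_nonzero
        by (auto simp: edges_quasi_minuscule_poset)
    next
      case 2
      have "(v \<mu>, i, z j) \<in> edges R \<longleftrightarrow> i \<in> K \<and> \<mu> = - \<alpha> i \<and> j = i"
      proof
        assume e: "(v \<mu>, i, z j) \<in> edges R"
        have "i \<in> K" "\<mu> = - \<alpha> i" using edge_to_zero[OF e z(2)] 2 fv by auto
        moreover have "z j = z i" using to_zero[OF e z(2)] 2 by blast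
        ultimately show "i \<in> K \<and> \<mu> = - \<alpha> i \<and> j = i" using inj_onD[OF inj_z] 2 by blast
      next
        assume "i \<in> K \<and> \<mu> = - \<alpha> i \<and> j = i"
        then show "(v \<mu>, i, z j) \<in> edges R" using z(3) fv vV 2 by blast
      qed
      then show ?thesis using 2 by (simp add: edges_quasi_minuscule_poset short)
    next
      case 3
      have "(z j, i, v \<nu>) \<in> edges R \<longleftrightarrow> i \<in> K \<and> \<nu> = \<alpha> i \<and> j = i"
      proof
        assume e: "(z j, i, v \<nu>) \<in> edges R"
        have "i \<in> K" "\<nu> = \<alpha> i" using edge_from_zero[OF e z(2)] 3 fv by auto
        moreover have "z j = z i" using from_zero[OF e z(2)] 3 by blast
        ultimately show "i \<in> K \<and> \<nu> = \<alpha> i \<and> j = i" using inj_onD[OF inj_z] 3 by blast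
      next
        assume "i \<in> K \<and> \<nu> = \<alpha> i \<and> j = i"
        then show "(z j, i, v \<nu>) \<in> edges R" using z(4) fv vV 3 by blast
      qed
      then show ?thesis using 3 by (simp add: edges_quasi_minuscule_poset short)
    next
      case 4
      have "(z j, i, z k) \<notin> edges R"
        using edge_weight[of "z j" i "z k"] z(2) 4 simple_nonzero[of i] by auto
      then show ?thesis using 4 by (simp add: edges_quasi_minuscule_poset)
    qed
  qed
  ultimately show "poset_iso ?P R" unfolding poset_iso_def by blast
qed

end

theorem proposition4p15:
  fixes \<Phi> :: "'a::euclidean_space set"
    and \<alpha> :: "'i::finite \<Rightarrow> 'a"
    and lam :: 'a
  assumes "irreducible_root_system \<Phi>"
    and "simple_roots \<Phi> \<alpha>"
    and "lam \<in> dominant_weights \<alpha>"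
  shows "(minuscule \<Phi> \<alpha> lam \<longrightarrow>
            splitting_poset \<Phi> \<alpha> lam (minuscule_poset \<Phi> \<alpha> lam) \<and>
            (\<forall>R :: ('v, 'i) colored_graph.
               splitting_poset \<Phi> \<alpha> lam R \<longrightarrow> poset_iso R (minuscule_poset \<Phi> \<alpha> lam)) \<and>
            connected_poset (minuscule_poset \<Phi> \<alpha> lam) \<and>
            edge_minimal \<Phi> \<alpha> lam (minuscule_poset \<Phi> \<alpha> lam)) \<and>
         (quasi_minuscule \<Phi> \<alpha> lam \<longrightarrow>
            splitting_poset \<Phi> \<alpha> lam (quasi_minuscule_poset \<Phi> \<alpha> lam) \<and>
            connected_poset (quasi_minuscule_poset \<Phi> \<alpha> lam) \<and>
            edge_minimal \<Phi> \<alpha> lam (quasi_minuscule_poset \<Phi> \<alpha> lam) \<and>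
            (\<forall>R :: ('v, 'i) colored_graph.
               splitting_poset \<Phi> \<alpha> lam R \<and> connected_poset R \<and> edge_minimal \<Phi> \<alpha> lam R \<longrightarrow>
               poset_iso R (quasi_minuscule_poset \<Phi> \<alpha> lam)))"
proof -
  have "root_system \<Phi>" using assms(1) by (simp add: irreducible_root_system_def)
  then interpret irreducible_root_basis \<Phi> \<alpha>
    using assms by unfold_locales
  show ?thesis
  proof (intro conjI impI)
    assume minuscule: "minuscule \<Phi> \<alpha> lam"
    have small: "\<mu> \<bullet> coroot (\<alpha> i) \<in> {-1, 0, 1}" if \<mu>: "\<mu> \<in> weyl_orbit \<Phi> lam" for \<mu> i
    proof -
      obtain w where "w (\<alpha> i) \<in> \<Phi>" "\<mu> \<bullet> coroot (\<alpha> i) = lam \<bullet> coroot (w (\<alpha> i))"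
        using weyl_orbit_pairing[OF \<mu> simple_root[of i]] by blast
      then show ?thesis using minuscule unfolding minuscule_def by simp
    qed
    interpret small_weight \<Phi> \<alpha> lam
      using assms(3) minuscule small by unfold_locales (simp_all add: minuscule_def)
    \<comment> \<open>A simple root in the orbit would pair to 2 with its own coroot.\<close>
    have K: "K = {}"
      using small[of "\<alpha> i" i for i] inner_coroot_self[OF simple_nonzero] by (auto simp: K_def)
    interpret P: weight_model \<Phi> \<alpha> lam "minuscule_poset \<Phi> \<alpha> lam" "\<lambda>\<mu>. \<mu>"
    proof
      have "{\<mu> \<in> verts (minuscule_poset \<Phi> \<alpha> lam). \<mu> \<noteq> 0} = M"
        "{\<mu> \<in> verts (minuscule_poset \<Phi> \<alpha> lam). \<mu> = 0} = {}"
        using M_nonzero by (auto simp: minuscule_poset_def)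
      then show "bij_betw (\<lambda>\<mu>. \<mu>) {\<mu> \<in> verts (minuscule_poset \<Phi> \<alpha> lam). \<mu> \<noteq> 0} M"
        "card {\<mu> \<in> verts (minuscule_poset \<Phi> \<alpha> lam). \<mu> = 0} = card K"
        by (simp_all add: bij_betw_def K)
    qed (auto simp: minuscule_poset_def finite_orbit K)
    show "splitting_poset \<Phi> \<alpha> lam (minuscule_poset \<Phi> \<alpha> lam)" by (rule P.splitting)
    show "connected_poset (minuscule_poset \<Phi> \<alpha> lam)"
      using M_nonzero by (intro P.connected) (auto simp: minuscule_poset_def)
    show "edge_minimal \<Phi> \<alpha> lam (minuscule_poset \<Phi> \<alpha> lam)"
      by (intro P.tight_edge_minimal) (auto simp: P.tight_def inj_on_def)
    show "\<forall>R :: ('v, 'i) colored_graph.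
        splitting_poset \<Phi> \<alpha> lam R \<longrightarrow> poset_iso R (minuscule_poset \<Phi> \<alpha> lam)"
      using splitting_poset_weight_model weight_model.iso_minuscule_poset[OF _ K] by blast
  next
    let ?P = "quasi_minuscule_poset \<Phi> \<alpha> lam"
    assume quasi: "quasi_minuscule \<Phi> \<alpha> lam"
    interpret small_weight \<Phi> \<alpha> lam
      using assms(3) quasi quasi_minuscule_pairing[OF quasi _ simple_root]
      by unfold_locales (simp_all add: quasi_minuscule_def)
    have short: "short_root \<Phi> (\<alpha> i) \<longleftrightarrow> i \<in> K" for i
      by (simp add: short_root_in_orbit_iff[OF quasi simple_root] K_def)
    have vertices: "verts ?P = Inl ` M \<union> Inr ` K"
      by (simp add: quasi_minuscule_poset_def short)
    \<comment> \<open>Orbit elements are their own weights; the new symbols have weight 0.\<close>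
    let ?f = "case_sum (\<lambda>\<mu>. \<mu>) (\<lambda>_. 0) :: 'a + 'i \<Rightarrow> 'a"
    interpret P: weight_model \<Phi> \<alpha> lam ?P ?f
    proof
      have sets: "{v \<in> verts ?P. ?f v \<noteq> 0} = Inl ` M" "{v \<in> verts ?P. ?f v = 0} = Inr ` K"
        using M_nonzero by (auto simp: vertices)
      show "bij_betw ?f {v \<in> verts ?P. ?f v \<noteq> 0} M"
        unfolding sets by (auto simp: bij_betw_def inj_on_def image_image)
      show "card {v \<in> verts ?P. ?f v = 0} = card K"
        unfolding sets by (simp add: card_image)
      show "finite (verts ?P)" by (simp add: vertices finite_orbit)
      show "edges ?P \<subseteq> verts ?P \<times> UNIV \<times> verts ?P"
        unfolding vertices
        by (auto simp: quasi_minuscule_poset_def short simple_in_M uminus_simple_in_M)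
      show "?f s + \<alpha> i = ?f t" if "(s, i, t) \<in> edges ?P" for s i t
        using that by (auto simp: quasi_minuscule_poset_def)
      show "(s, i, t) \<in> edges ?P"
        if "s \<in> verts ?P" "t \<in> verts ?P" "?f s \<noteq> 0" "?f t \<noteq> 0" "?f s + \<alpha> i = ?f t" for s t i
        using that by (auto simp: vertices edges_quasi_minuscule_poset)
      show "\<exists>z\<in>verts ?P. ?f z = 0 \<and> (\<forall>s\<in>verts ?P. ?f s = - \<alpha> i \<longrightarrow> (s, i, z) \<in> edges ?P) \<and>
          (\<forall>t\<in>verts ?P. ?f t = \<alpha> i \<longrightarrow> (z, i, t) \<in> edges ?P)" if "i \<in> K" for i
        using that simple_nonzero[of i]
        by (intro bexI[of _ "Inr i"]) (auto simp: vertices edges_quasi_minuscule_poset short)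
    qed
    show "splitting_poset \<Phi> \<alpha> lam ?P" by (rule P.splitting)
    show "connected_poset ?P"
    proof (rule P.connected)
      fix v assume "v \<in> verts ?P" "?f v = 0"
      then obtain i where i: "v = Inr i" "i \<in> K" using M_nonzero by (auto simp: vertices)
      then have "(v, i, Inl (\<alpha> i)) \<in> edges ?P" by (simp add: edges_quasi_minuscule_poset short)
      then show "\<exists>i y. (y, i, v) \<in> edges ?P \<or> (v, i, y) \<in> edges ?P" by blast
    qed
    show "edge_minimal \<Phi> \<alpha> lam ?P"
    proof (rule P.tight_edge_minimal)
      show P.tight
        unfolding P.tight_def
        using M_nonzero[of 0] simple_nonzero by (auto simp: inj_on_def quasi_minuscule_poset_def)
    qed
    show "\<forall>R :: ('v, 'i) colored_graph.
        splitting_poset \<Phi> \<alpha> lam R \<and> connected_poset R \<and> edge_minimal \<Phi> \<alpha> lam R \<longrightarrow>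
        poset_iso R ?P"
      using splitting_poset_weight_model weight_model.edge_minimal_tight
        weight_model.iso_quasi_minuscule_poset short by blast
  qed
qed

end
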